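(* Let $\omega$, $\gamma_D$, $\lambda_1$, $\psi_1$, $\ell$, $\kappa$, $\tau$, $\beta$ and $T_{\ell,\beta}$ be as in the context. If for all $x_3\in\mathbb{R}$ and $x'\in\omega$ $$\kappa(x_3)\big(\partial_1\psi_1(x')\cos\beta(x_3)+\partial_2\psi_1(x')\sin\beta(x_3)\big)\ge 0,$$ then $\inf\sigma(T_{\ell,\beta})\ge\lambda_1$.
   Context: $\omega\subset\mathbb{R}^2$ is a bounded domain whose boundary is piecewise $C^2$ and has no cusps. $\gamma_D\subset\partial\omega$ is a union of finitely many arcs, each of positive measure, and $\gamma_N=\partial\omega\setminus\gamma_D$. $\lambda_1$ is the lowest eigenvalue of $-\Delta'\psi=\lambda\psi$ in $\omega$, $\psi=0$ on $\gamma_D$, $\partial_n\psi=0$ on $\gamma_N$ (form $\int_\omega|\nabla'\psi|^2$ on $H^1(\omega)$ functions vanishing on $\gamma_D$), and $\psi_1$ is the corresponding real eigenfunction, positive in $\omega$, normalized in $L^2(\omega)$. $\ell:\mathbb{R}\to\mathbb{R}^3$ is a $C^3$ arc-length parametrized curve, a diffeomorphism onto its image, with a global Frenet frame $\{\mathbf t,\mathbf n,\mathbf b\}$, curvature $\kappa=|\ddot\ell|\ge0$ and torsion $\tau$; $\beta\in C^1(\mathbb{R})$ with $\dot\beta=\tau$. The tube $Q_{\ell,\beta}=\{\ell(x_3)+x_1(\mathbf n\cos\beta-\mathbf b\sin\beta)+x_2(\mathbf n\sin\beta+\mathbf b\cos\beta): x'\in\omega, x_3\in\mathbb{R}\}$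 satisfies $\sup_{x'\in\omega}|x'|\cdot\|\kappa\|_\infty<1$ and has no self-intersections. With $Q=\omega\times\mathbb{R}$, $\Gamma=\gamma_D\times\mathbb{R}$, $g(x)=1-(x_1\cos\beta(x_3)+x_2\sin\beta(x_3))\kappa(x_3)$, $T_{\ell,\beta}$ is the self-adjoint operator in $L^2(Q,g)$ (inner product $\int_Q g\,u\bar v$) associated with the form $\int_Q[g(|\partial_1u|^2+|\partial_2u|^2)+g^{-1}|\partial_3u|^2]\mathrm{d}x$ on $H^1(Q)$ functions vanishing on $\Gamma$ (unitarily equivalent to the mixed Dirichlet–Neumann Laplacian on $Q_{\ell,\beta}$). *)

theory Defs
  imports "HOL-Analysis.Analysis"
begin

definition pd :: "(real^'n \<Rightarrow> 'b::real_normed_vector) \<Rightarrow> 'n \<Rightarrow> real^'n \<Rightarrow> 'b" where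
  "pd f i x = frechet_derivative f (at x) (axis i 1)"

definition C1fun :: "(real^'n \<Rightarrow> 'b::real_normed_vector) \<Rightarrow> bool" where
  "C1fun f \<longleftrightarrow> (\<forall>x. f differentiable (at x)) \<and> (\<forall>i. continuous_on UNIV (pd f i))"

definition supp_closure :: "(real^'n \<Rightarrow> 'b::zero) \<Rightarrow> (real^'n) set" where
  "supp_closure f = closure {x. f x \<noteq> 0}"

definition test_fun :: "(real^'n) set \<Rightarrow> (real^'n \<Rightarrow> real) \<Rightarrow> bool" where
  "test_fun \<Omega> \<phi> \<longleftrightarrow> C1fun \<phi> \<and> compact (supp_closure \<phi>) \<and> supp_closure \<phi> \<subseteq> \<Omega>"

definition L2w :: "(real^'n \<Rightarrow> real) \<Rightarrow> (real^'n) set \<Rightarrow> (real^'n \<Rightarrow> complex) \<Rightarrow> bool" where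
  "L2w \<rho> \<Omega> u \<longleftrightarrow> u \<in> borel_measurable (lebesgue_on \<Omega>) \<and>
     integrable (lebesgue_on \<Omega>) (\<lambda>x. \<rho> x * (cmod (u x))\<^sup>2)"

definition L2 :: "(real^'n) set \<Rightarrow> (real^'n \<Rightarrow> complex) \<Rightarrow> bool" where
  "L2 \<Omega> u \<longleftrightarrow> L2w (\<lambda>_. 1) \<Omega> u"

definition inner_w :: "(real^'n \<Rightarrow> real) \<Rightarrow> (real^'n) set \<Rightarrow> (real^'n \<Rightarrow> complex) \<Rightarrow> (real^'n \<Rightarrow> complex) \<Rightarrow> complex" where
  "inner_w \<rho> \<Omega> f v = (LINT x|lebesgue_on \<Omega>. complex_of_real (\<rho> x) * f x * cnj (v x))"

definition norm_w :: "(real^'n \<Rightarrow> real) \<Rightarrow> (real^'n) set \<Rightarrow> (real^'n \<Rightarrow> complex) \<Rightarrow> real" where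
  "norm_w \<rho> \<Omega> u = sqrt (LINT x|lebesgue_on \<Omega>. \<rho> x * (cmod (u x))\<^sup>2)"

definition weak_partial :: "(real^'n) set \<Rightarrow> (real^'n \<Rightarrow> complex) \<Rightarrow> 'n \<Rightarrow> (real^'n \<Rightarrow> complex) \<Rightarrow> bool" where
  "weak_partial \<Omega> u i v \<longleftrightarrow> (\<forall>\<phi>. test_fun \<Omega> \<phi> \<longrightarrow>
     (LINT x|lebesgue_on \<Omega>. u x * complex_of_real (pd \<phi> i x))
       = - (LINT x|lebesgue_on \<Omega>. v x * complex_of_real (\<phi> x)))"

definition H1 :: "(real^'n) set \<Rightarrow> (real^'n \<Rightarrow> complex) \<Rightarrow> bool" where
  "H1 \<Omega> u \<longleftrightarrow> L2 \<Omega> u \<and> (\<forall>i. \<exists>v. L2 \<Omega> v \<and> weak_partial \<Omega> u i v)"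

text \<open>The weak partial derivative (unique up to null sets).\<close>
definition wd :: "(real^'n) set \<Rightarrow> (real^'n \<Rightarrow> complex) \<Rightarrow> 'n \<Rightarrow> real^'n \<Rightarrow> complex" where
  "wd \<Omega> u i = (SOME v. L2 \<Omega> v \<and> weak_partial \<Omega> u i v)"

definition H1_norm_sq :: "(real^'n) set \<Rightarrow> (real^'n \<Rightarrow> complex) \<Rightarrow> real" where
  "H1_norm_sq \<Omega> u = (LINT x|lebesgue_on \<Omega>. (cmod (u x))\<^sup>2)
      + (\<Sum>i\<in>UNIV. LINT x|lebesgue_on \<Omega>. (cmod (wd \<Omega> u i x))\<^sup>2)"

text \<open>H^1 functions on \<Omega> vanishing on \<Gamma> \<subseteq> \<partial>\<Omega>: the closure in H^1(\<Omega>) of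
  (restrictions of) compactly supported C^1 functions on R^n vanishing in a
  neighbourhood of \<Gamma>.\<close>
definition H1_vanish :: "(real^'n) set \<Rightarrow> (real^'n) set \<Rightarrow> (real^'n \<Rightarrow> complex) set" where
  "H1_vanish \<Omega> \<Gamma> = {u. H1 \<Omega> u \<and>
     (\<forall>e>0. \<exists>\<phi>. C1fun \<phi> \<and> compact (supp_closure \<phi>) \<and>
        (\<exists>U. open U \<and> \<Gamma> \<subseteq> U \<and> (\<forall>x\<in>U. \<phi> x = 0)) \<and>
        H1_norm_sq \<Omega> (\<lambda>x. u x - \<phi> x) < e)}"

definition formw :: "('n \<Rightarrow> real^'n \<Rightarrow> real) \<Rightarrow> (real^'n) set \<Rightarrow> (real^'n \<Rightarrow> complex) \<Rightarrow> (real^'n \<Rightarrow> complex) \<Rightarrow> complex" where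
  "formw w \<Omega> u v = (\<Sum>i\<in>UNIV. LINT x|lebesgue_on \<Omega>.
       complex_of_real (w i x) * wd \<Omega> u i x * cnj (wd \<Omega> v i x))"

definition assoc_graph :: "('n \<Rightarrow> real^'n \<Rightarrow> real) \<Rightarrow> (real^'n \<Rightarrow> real) \<Rightarrow> (real^'n) set
     \<Rightarrow> (real^'n \<Rightarrow> complex) set \<Rightarrow> ((real^'n \<Rightarrow> complex) \<times> (real^'n \<Rightarrow> complex)) set" where
  "assoc_graph w \<rho> \<Omega> D = {(u, f). u \<in> D \<and> L2w \<rho> \<Omega> f \<and>
      (\<forall>v\<in>D. formw w \<Omega> u v = inner_w \<rho> \<Omega> f v)}"

text \<open>Resolvent set: T - z is a bijection of D(T) onto L^2 with bounded inverse.\<close>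
definition op_resolvent :: "(real^'n \<Rightarrow> real) \<Rightarrow> (real^'n) set
     \<Rightarrow> ((real^'n \<Rightarrow> complex) \<times> (real^'n \<Rightarrow> complex)) set \<Rightarrow> complex set" where
  "op_resolvent \<rho> \<Omega> G = {z.
      (\<forall>f. L2w \<rho> \<Omega> f \<longrightarrow> (\<exists>u. (u, \<lambda>x. f x + z * u x) \<in> G)) \<and>
      (\<exists>C. \<forall>u f. L2w \<rho> \<Omega> f \<and> (u, \<lambda>x. f x + z * u x) \<in> G
            \<longrightarrow> norm_w \<rho> \<Omega> u \<le> C * norm_w \<rho> \<Omega> f)}"

definition op_spectrum :: "(real^'n \<Rightarrow> real) \<Rightarrow> (real^'n) set
     \<Rightarrow> ((real^'n \<Rightarrow> complex) \<times> (real^'n \<Rightarrow> complex)) set \<Rightarrow> complex set" where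
  "op_spectrum \<rho> \<Omega> G = - op_resolvent \<rho> \<Omega> G"

definition C2_curve :: "(real \<Rightarrow> real^2) \<Rightarrow> bool" where
  "C2_curve h \<longleftrightarrow> (\<exists>h1 h2. (\<forall>s. (h has_vector_derivative h1 s) (at s)) \<and>
       (\<forall>s. (h1 has_vector_derivative h2 s) (at s)) \<and> continuous_on UNIV h2)"

definition no_cusp :: "real^2 \<Rightarrow> real^2 \<Rightarrow> bool" where
  "no_cusp a b \<longleftrightarrow> \<not> (\<exists>c>0. b = - (c *\<^sub>R a))"

definition pw_C2_jordan :: "(real \<Rightarrow> real^2) \<Rightarrow> bool" where
  "pw_C2_jordan c \<longleftrightarrow> simple_path c \<and> pathfinish c = pathstart c \<and>
     (\<exists>m::nat. \<exists>t::nat \<Rightarrow> real. \<exists>h::nat \<Rightarrow> real \<Rightarrow> real^2. m > 0 \<and> t 0 = 0 \<and> t m = 1 \<and>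
        (\<forall>k<m. t k < t (Suc k)) \<and>
        (\<forall>k<m. C2_curve (h k) \<and> (\<forall>s\<in>{t k..t (Suc k)}. h k s = c s \<and> vector_derivative (h k) (at s) \<noteq> 0)) \<and>
        (\<forall>k. 0 < k \<and> k < m \<longrightarrow> no_cusp (vector_derivative (h (k - 1)) (at (t k))) (vector_derivative (h k) (at (t k)))) \<and>
        no_cusp (vector_derivative (h (m - 1)) (at 1)) (vector_derivative (h 0) (at 0)))"

definition pw_C2_domain :: "(real^2) set \<Rightarrow> bool" where
  "pw_C2_domain \<omega> \<longleftrightarrow> open \<omega> \<and> connected \<omega> \<and> bounded \<omega> \<and> \<omega> \<noteq> {} \<and>
     (\<exists>N::nat. \<exists>c::nat \<Rightarrow> real \<Rightarrow> real^2. (\<forall>j<N. pw_C2_jordan (c j)) \<and>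
        (\<forall>i<N. \<forall>j<N. i \<noteq> j \<longrightarrow> path_image (c i) \<inter> path_image (c j) = {}) \<and>
        frontier \<omega> = (\<Union>j<N. path_image (c j)))"

definition dirichlet_part :: "(real^2) set \<Rightarrow> (real^2) set \<Rightarrow> bool" where
  "dirichlet_part \<omega> \<gamma> \<longleftrightarrow> (\<exists>N::nat. \<exists>p::nat \<Rightarrow> real \<Rightarrow> real^2.
      (\<forall>j<N. arc (p j) \<and> path_image (p j) \<subseteq> frontier \<omega>) \<and> \<gamma> = (\<Union>j<N. path_image (p j)))"

definition graph2 :: "(real^2) set \<Rightarrow> (real^2) set \<Rightarrow> ((real^2 \<Rightarrow> complex) \<times> (real^2 \<Rightarrow> complex)) set" where
  "graph2 \<omega> \<gamma> = assoc_graph (\<lambda>_ _. 1) (\<lambda>_. 1) \<omega> (H1_vanish \<omega> \<gamma>)"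

definition is_eigenvalue2 :: "(real^2) set \<Rightarrow> (real^2) set \<Rightarrow> real \<Rightarrow> bool" where
  "is_eigenvalue2 \<omega> \<gamma> \<mu> \<longleftrightarrow> (\<exists>\<psi>. (\<psi>, \<lambda>x. complex_of_real \<mu> * \<psi> x) \<in> graph2 \<omega> \<gamma> \<and>
       \<not> (AE x in lebesgue_on \<omega>. \<psi> x = 0))"

definition proj12 :: "real^3 \<Rightarrow> real^2" where
  "proj12 x = vector [x$1, x$2]"

definition cyl :: "(real^2) set \<Rightarrow> (real^3) set" where
  "cyl A = {x. proj12 x \<in> A}"

definition gfun :: "(real \<Rightarrow> real) \<Rightarrow> (real \<Rightarrow> real) \<Rightarrow> real^3 \<Rightarrow> real" where
  "gfun \<kappa> \<beta> x = 1 - (x$1 * cos (\<beta> (x$3)) + x$2 * sin (\<beta> (x$3))) * \<kappa> (x$3)"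

definition T_graph :: "(real^2) set \<Rightarrow> (real^2) set \<Rightarrow> (real \<Rightarrow> real) \<Rightarrow> (real \<Rightarrow> real)
     \<Rightarrow> ((real^3 \<Rightarrow> complex) \<times> (real^3 \<Rightarrow> complex)) set" where
  "T_graph \<omega> \<gamma> \<kappa> \<beta> = assoc_graph
      (\<lambda>i x. if i = 3 then 1 / gfun \<kappa> \<beta> x else gfun \<kappa> \<beta> x) (gfun \<kappa> \<beta>)
      (cyl \<omega>) (H1_vanish (cyl \<omega>) (cyl \<gamma>))"

definition T_spectrum :: "(real^2) set \<Rightarrow> (real^2) set \<Rightarrow> (real \<Rightarrow> real) \<Rightarrow> (real \<Rightarrow> real) \<Rightarrow> complex set" where
  "T_spectrum \<omega> \<gamma> \<kappa> \<beta> = op_spectrum (gfun \<kappa> \<beta>) (cyl \<omega>) (T_graph \<omega> \<gamma> \<kappa> \<beta>)"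

definition tube_map :: "(real \<Rightarrow> real^3) \<Rightarrow> (real \<Rightarrow> real^3) \<Rightarrow> (real \<Rightarrow> real^3) \<Rightarrow> (real \<Rightarrow> real) \<Rightarrow> real^3 \<Rightarrow> real^3" where
  "tube_map l n b \<beta> x = l (x$3)
      + (x$1) *\<^sub>R (cos (\<beta> (x$3)) *\<^sub>R n (x$3) - sin (\<beta> (x$3)) *\<^sub>R b (x$3))
      + (x$2) *\<^sub>R (sin (\<beta> (x$3)) *\<^sub>R n (x$3) + cos (\<beta> (x$3)) *\<^sub>R b (x$3))"

end

theory Submission
  imports Defs
begin

text \<open>
  On a cross-section, test the weak eigenvalue equation for \<open>\<psi>\<^sub>1\<close> with \<open>g \<phi>\<^sup>2 / (\<psi>\<^sub>1 + \<epsilon>)\<close>. Completing the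
  square gives
  \<open>\<lambda>\<^sub>1 \<integral> g \<phi>\<^sup>2 \<psi>\<^sub>1 / (\<psi>\<^sub>1 + \<epsilon>) \<le> \<integral> g \<bar>\<nabla>'\<phi>\<bar>\<^sup>2 + \<integral> (\<nabla>'g \<cdot> \<nabla>'\<psi>\<^sub>1) \<phi>\<^sup>2 / (\<psi>\<^sub>1 + \<epsilon>)\<close>,
  where the last term is nonpositive because \<open>\<nabla>'g = -\<kappa> (cos \<beta>, sin \<beta>)\<close>. Letting \<open>\<epsilon>\<close> tend to \<open>0\<close>, integrating
  over \<open>x\<^sub>3\<close> and adding \<open>g\<^sup>-\<^sup>1 \<bar>\<partial>\<^sub>3\<phi>\<bar>\<^sup>2 \<ge> 0\<close> bounds the quadratic form of \<open>T\<close> below by \<open>\<lambda>\<^sub>1\<close> on test functions, hence on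
  the form domain. A form bound is a spectral bound: for \<open>Re z < \<lambda>\<^sub>1\<close> the equation \<open>T u - z u = f\<close> is solved by
  a fixed point argument that only needs the Riesz representation theorem for a shifted form.
\<close>

text \<open>The ground state is positive and differentiable inside \<open>\<omega>\<close> and lies
  in H^1, but has no known lower bound up to the boundary; hence the \<epsilon> in the denominator.
  Even then the quotient is no C^1 test function and is reached as a limit: smooth approximants of
  the ground state enter a global C^1 extension of 1 / (\<epsilon> + s), and the factor \<phi>^2,
  zero near the Dirichlet part, keeps every approximating test function admissible. A second gap
  lies between two gradients: the sign condition speaks of classical derivatives, the weak equation
  of the chosen weak derivatives \<open>wd\<close>. Since g is affine in x', its transverse gradient
  is constant on each slice, and monotonicity along that fixed direction bridges the gap. The
  spectrum is a set of complex numbers, defined by solvability and a bound for the inverse, so both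
  are proved for every complex z to the left of \<lambda>1. Functions are not identified almost
  everywhere; limits and fixed points are therefore found only up to seminorm zero.\<close>

abbreviation rcp :: "nat \<Rightarrow> real" where "rcp n \<equiv> inverse (real (Suc n))"

lemmas Lint_cong = Bochner_Integration.integral_cong

subsection \<open>Square-integrable functions\<close>

text \<open>The value type is a general normed field, so that one theory serves the real ground
  state and its derivatives as well as the complex form domain.\<close>

definition sqint :: "'a measure \<Rightarrow> ('a \<Rightarrow> 'b::{real_normed_field,banach,second_countable_topology}) \<Rightarrow> bool" where
  "sqint M f \<longleftrightarrow> f \<in> borel_measurable M \<and> integrable M (\<lambda>x. (norm (f x))\<^sup>2)"

definition nrm2 :: "'a measure \<Rightarrow> ('a \<Rightarrow> 'b::{real_normed_field,banach,second_countable_topology}) \<Rightarrow> real" where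
  "nrm2 M f = sqrt (LINT x|M. (norm (f x))\<^sup>2)"

lemma sqint_measurable [measurable_dest]: "sqint M f \<Longrightarrow> f \<in> borel_measurable M"
  and sqint_integrable: "sqint M f \<Longrightarrow> integrable M (\<lambda>x. (norm (f x))\<^sup>2)"
  by (auto simp: sqint_def)

lemma nrm2_ge0 [simp]: "nrm2 M f \<ge> 0"
  by (simp add: nrm2_def)

lemma nrm2_sq: "(nrm2 M f)\<^sup>2 = (LINT x|M. (norm (f x))\<^sup>2)"
  by (simp add: nrm2_def)

lemma sqint_mono:
  assumes "f \<in> borel_measurable M" "integrable M h" "AE x in M. (norm (f x))\<^sup>2 \<le> h x"
  shows "sqint M f"
  unfolding sqint_def
proof (intro conjI Bochner_Integration.integrable_bound[OF assms(2)])
  show "AE x in M. norm ((norm (f x))\<^sup>2) \<le> norm (h x)"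
    using assms(3) by eventually_elim auto
qed (use assms(1) in measurable)

lemma nrm2_cong_AE:
  assumes "f \<in> borel_measurable M" "g \<in> borel_measurable M" "AE x in M. f x = g x"
  shows "nrm2 M f = nrm2 M g"
proof -
  have "(LINT x|M. (norm (f x))\<^sup>2) = (LINT x|M. (norm (g x))\<^sup>2)"
    by (rule integral_cong_AE) (use assms in \<open>auto elim: eventually_mono\<close>)
  then show ?thesis by (simp add: nrm2_def)
qed

lemma sqint_add:
  assumes "sqint M f" "sqint M g"
  shows "sqint M (\<lambda>x. f x + g x)"
proof (rule sqint_mono)
  show "(\<lambda>x. f x + g x) \<in> borel_measurable M"
    using assms by (auto simp: sqint_def)
  show "integrable M (\<lambda>x. 2 * (norm (f x))\<^sup>2 + 2 * (norm (g x))\<^sup>2)"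
    using assms by (auto simp: sqint_def)
  have "(norm (f x + g x))\<^sup>2 \<le> 2 * (norm (f x))\<^sup>2 + 2 * (norm (g x))\<^sup>2" for x
  proof -
    have "(norm (f x + g x))\<^sup>2 \<le> (norm (f x) + norm (g x))\<^sup>2"
      by (intro power_mono norm_triangle_ineq) auto
    also have "\<dots> \<le> 2 * (norm (f x))\<^sup>2 + 2 * (norm (g x))\<^sup>2"
      using sum_squares_bound[of "norm (f x)" "norm (g x)"] by (simp add: power2_sum)
    finally show ?thesis .
  qed
  then show "AE x in M. (norm (f x + g x))\<^sup>2 \<le> 2 * (norm (f x))\<^sup>2 + 2 * (norm (g x))\<^sup>2"
    by simp
qed

lemma sqint_mult_bounded:
  assumes f: "sqint M f" and w: "w \<in> borel_measurable M" and C: "AE x in M. norm (w x) \<le> C"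
  shows "sqint M (\<lambda>x. w x * f x)"
proof (rule sqint_mono)
  show "(\<lambda>x. w x * f x) \<in> borel_measurable M"
    using assms by (auto simp: sqint_def)
  show "integrable M (\<lambda>x. C\<^sup>2 * (norm (f x))\<^sup>2)"
    using assms by (auto simp: sqint_def)
  show "AE x in M. (norm (w x * f x))\<^sup>2 \<le> C\<^sup>2 * (norm (f x))\<^sup>2"
    using C
  proof eventually_elim
    case (elim x)
    show ?case
      unfolding norm_mult power_mult_distrib
      by (intro mult_right_mono power_mono elim) auto
  qed
qed

lemma sqint_cmult: "sqint M f \<Longrightarrow> sqint M (\<lambda>x. c * f x)"
  by (rule sqint_mult_bounded[where C = "norm c"]) auto

lemma sqint_minus: "sqint M f \<Longrightarrow> sqint M (\<lambda>x. - f x)"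
  using sqint_cmult[of M f "-1"] by simp

lemma sqint_diff: "sqint M f \<Longrightarrow> sqint M g \<Longrightarrow> sqint M (\<lambda>x. f x - g x)"
  using sqint_add[OF _ sqint_minus] by (simp del: add_uminus_conv_diff add: diff_conv_add_uminus)

lemma sqint_zero [simp]: "sqint M (\<lambda>x. 0)"
  by (simp add: sqint_def)

lemma sqint_mult_integrable:
  assumes "sqint M f" "sqint M g"
  shows "integrable M (\<lambda>x. f x * g x)"
proof (rule Bochner_Integration.integrable_bound)
  show "integrable M (\<lambda>x. (norm (f x))\<^sup>2 + (norm (g x))\<^sup>2)"
    using assms by (auto simp: sqint_def)
  show "(\<lambda>x. f x * g x) \<in> borel_measurable M"
    using assms by (auto simp: sqint_def)
  have "norm (f x * g x) \<le> norm ((norm (f x))\<^sup>2 + (norm (g x))\<^sup>2)" for x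
  proof -
    have "0 \<le> norm (f x) * norm (g x)" by simp
    moreover have "2 * (norm (f x) * norm (g x)) \<le> (norm (f x))\<^sup>2 + (norm (g x))\<^sup>2"
      using sum_squares_bound[of "norm (f x)" "norm (g x)"] by (simp add: mult.assoc)
    ultimately show ?thesis
      unfolding norm_mult real_norm_def abs_of_nonneg[OF add_nonneg_nonneg[OF zero_le_power2 zero_le_power2]]
      by linarith
  qed
  then show "AE x in M. norm (f x * g x) \<le> norm ((norm (f x))\<^sup>2 + (norm (g x))\<^sup>2)"
    by simp
qed

lemma sqint_norm: "sqint M f \<Longrightarrow> sqint M (\<lambda>x. norm (f x))"
  by (auto simp: sqint_def)

lemma sqint_cnj: "sqint M f \<Longrightarrow> sqint M (\<lambda>x. cnj (f x))"
  by (auto simp: sqint_def intro!: borel_measurable_continuous_on[of cnj] continuous_intros)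

lemma sqint_of_real: "sqint M f \<Longrightarrow> sqint M (\<lambda>x. complex_of_real (f x))"
  by (auto simp: sqint_def)

lemma sqint_Re: "sqint M f \<Longrightarrow> sqint M (\<lambda>x. Re (f x))"
  by (rule sqint_mono[where h = "\<lambda>x. (norm (f x))\<^sup>2"])
     (auto simp: sqint_def abs_Re_le_cmod abs_le_square_iff[symmetric])

lemma sqint_Im: "sqint M f \<Longrightarrow> sqint M (\<lambda>x. Im (f x))"
  by (rule sqint_mono[where h = "\<lambda>x. (norm (f x))\<^sup>2"])
     (auto simp: sqint_def abs_Im_le_cmod abs_le_square_iff[symmetric])

text \<open>The discriminant criterion. It yields Cauchy-Schwarz for integrals and for forms, and
  with a = 0 it forces b = 0, which is the vanishing of the first variation at a minimiser.\<close>

lemma square_le_of_quadratic_nonneg: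
  fixes a b c :: real
  assumes "\<And>t. 0 \<le> a + 2 * t * b + t\<^sup>2 * c" and "c \<ge> 0" and "a \<ge> 0"
  shows "b\<^sup>2 \<le> a * c"
proof (cases "c = 0")
  case True
  have "b = 0"
  proof (rule ccontr)
    assume "b \<noteq> 0"
    \<comment> \<open>With c = 0 this value of t turns the quadratic into a - (a + 1) = -1.\<close>
    with assms(1)[of "- (a + 1) / (2 * b)"] True assms(3) show False
      by (simp add: field_simps)
  qed
  then show ?thesis using True by simp
next
  case False
  then have "c > 0" using assms(2) by simp
  have "0 \<le> a + 2 * (- b / c) * b + (- b / c)\<^sup>2 * c" by (rule assms(1))
  also have "\<dots> = (a * c - b\<^sup>2) / c"
    using False by (simp add: power2_eq_square field_simps)
  finally show ?thesis using \<open>c > 0\<close> by (simp add: zero_le_divide_iff)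
qed

lemma Cauchy_Schwarz_integral:
  assumes f: "sqint M f" and g: "sqint M g"
  shows "(LINT x|M. norm (f x * g x)) \<le> nrm2 M f * nrm2 M g"
proof -
  let ?a = "LINT x|M. (norm (f x))\<^sup>2" and ?b = "LINT x|M. norm (f x) * norm (g x)"
    and ?c = "LINT x|M. (norm (g x))\<^sup>2"
  have i: "integrable M (\<lambda>x. norm (f x) * norm (g x))"
    using sqint_mult_integrable[OF sqint_norm[OF f] sqint_norm[OF g]] by simp
  have "0 \<le> ?a + 2 * t * ?b + t\<^sup>2 * ?c" for t
  proof -
    have "0 \<le> (LINT x|M. (norm (f x) + t * norm (g x))\<^sup>2)"
      by simp
    also have "\<dots> = (LINT x|M. (norm (f x))\<^sup>2 + 2 * t * (norm (f x) * norm (g x)) + t\<^sup>2 * (norm (g x))\<^sup>2)"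
      by (intro Lint_cong) (auto simp: power2_sum power_mult_distrib mult_ac)
    also have "\<dots> = ?a + 2 * t * ?b + t\<^sup>2 * ?c"
      using i f g by (simp add: sqint_def)
    finally show ?thesis .
  qed
  then have "?b\<^sup>2 \<le> ?a * ?c"
    by (rule square_le_of_quadratic_nonneg) auto
  then have "sqrt (?b\<^sup>2) \<le> sqrt (?a * ?c)"
    by (rule real_sqrt_le_mono)
  moreover have "?b \<ge> 0" by simp
  ultimately show ?thesis
    by (simp add: nrm2_def norm_mult real_sqrt_mult)
qed

lemma norm_integral_mult_le:
  assumes f: "sqint M f" and g: "sqint M g"
  shows "norm (LINT x|M. f x * g x) \<le> nrm2 M f * nrm2 M g"
  using Cauchy_Schwarz_integral[OF assms] integral_norm_bound[of M "\<lambda>x. f x * g x"] by linarith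

lemma nrm2_add_le:
  assumes f: "sqint M f" and g: "sqint M g"
  shows "nrm2 M (\<lambda>x. f x + g x) \<le> nrm2 M f + nrm2 M g"
proof (rule power2_le_imp_le)
  have i: "integrable M (\<lambda>x. norm (f x) * norm (g x))"
    using sqint_mult_integrable[OF sqint_norm[OF f] sqint_norm[OF g]] by simp
  have "(nrm2 M (\<lambda>x. f x + g x))\<^sup>2 \<le> (LINT x|M. (norm (f x))\<^sup>2 + 2 * (norm (f x) * norm (g x)) + (norm (g x))\<^sup>2)"
    unfolding nrm2_sq
  proof (rule integral_mono)
    show "integrable M (\<lambda>x. (norm (f x + g x))\<^sup>2)"
      by (rule sqint_integrable[OF sqint_add[OF f g]])
    show "integrable M (\<lambda>x. (norm (f x))\<^sup>2 + 2 * (norm (f x) * norm (g x)) + (norm (g x))\<^sup>2)"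
      using i f g by (simp add: sqint_def)
    show "(norm (f x + g x))\<^sup>2 \<le> (norm (f x))\<^sup>2 + 2 * (norm (f x) * norm (g x)) + (norm (g x))\<^sup>2" for x
      using power_mono[OF norm_triangle_ineq[of "f x" "g x"], of 2]
      by (simp add: power2_sum algebra_simps)
  qed
  also have "\<dots> = (nrm2 M f)\<^sup>2 + 2 * (LINT x|M. norm (f x * g x)) + (nrm2 M g)\<^sup>2"
    using i f g by (simp add: sqint_def nrm2_sq norm_mult)
  also have "\<dots> \<le> (nrm2 M f)\<^sup>2 + 2 * (nrm2 M f * nrm2 M g) + (nrm2 M g)\<^sup>2"
    using Cauchy_Schwarz_integral[OF f g] by simp
  also have "\<dots> = (nrm2 M f + nrm2 M g)\<^sup>2"
    by (simp add: power2_sum)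
  finally show "(nrm2 M (\<lambda>x. f x + g x))\<^sup>2 \<le> (nrm2 M f + nrm2 M g)\<^sup>2" .
qed simp

lemma nrm2_cmult: "nrm2 M (\<lambda>x. c * f x) = norm c * nrm2 M f"
  by (simp add: nrm2_def norm_mult power_mult_distrib real_sqrt_mult)

lemma nrm2_minus_commute: "nrm2 M (\<lambda>x. f x - g x) = nrm2 M (\<lambda>x. g x - f x)"
  by (simp add: nrm2_def norm_minus_commute)

lemma nrm2_diff_le:
  assumes f: "sqint M f" and g: "sqint M g"
  shows "nrm2 M f \<le> nrm2 M (\<lambda>x. f x - g x) + nrm2 M g"
  using nrm2_add_le[OF sqint_diff[OF f g] g] by simp

lemma nrm2_mult_bounded_le:
  assumes f: "sqint M f" and w: "w \<in> borel_measurable M" and C: "AE x in M. norm (w x) \<le> C" "C \<ge> 0"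
  shows "nrm2 M (\<lambda>x. w x * f x) \<le> C * nrm2 M f"
proof -
  have "(LINT x|M. (norm (w x * f x))\<^sup>2) \<le> (LINT x|M. C\<^sup>2 * (norm (f x))\<^sup>2)"
  proof (rule integral_mono_AE)
    show "integrable M (\<lambda>x. (norm (w x * f x))\<^sup>2)"
      using sqint_mult_bounded[OF f w C(1)] by (simp add: sqint_def)
    show "integrable M (\<lambda>x. C\<^sup>2 * (norm (f x))\<^sup>2)"
      using f by (simp add: sqint_def)
    show "AE x in M. (norm (w x * f x))\<^sup>2 \<le> C\<^sup>2 * (norm (f x))\<^sup>2"
      using C(1)
    proof eventually_elim
      case (elim x)
      show ?case
        unfolding norm_mult power_mult_distrib
        by (intro mult_right_mono power_mono elim) auto
    qed
  qed
  also have "\<dots> = C\<^sup>2 * (LINT x|M. (norm (f x))\<^sup>2)" by simp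
  finally have "nrm2 M (\<lambda>x. w x * f x) \<le> sqrt (C\<^sup>2 * (LINT x|M. (norm (f x))\<^sup>2))"
    unfolding nrm2_def by (rule real_sqrt_le_mono)
  then show ?thesis using C(2) by (simp add: nrm2_def real_sqrt_mult)
qed

lemma nrm2_mono:
  fixes f :: "'a \<Rightarrow> 'b::{real_normed_field,banach,second_countable_topology}"
    and g :: "'a \<Rightarrow> 'c::{real_normed_field,banach,second_countable_topology}"
  assumes g: "sqint M g" and f: "f \<in> borel_measurable M" and "AE x in M. norm (f x) \<le> norm (g x)"
  shows "nrm2 M f \<le> nrm2 M g"
  unfolding nrm2_def
proof (intro real_sqrt_le_mono integral_mono_AE)
  have *: "AE x in M. (norm (f x))\<^sup>2 \<le> (norm (g x))\<^sup>2"
    using assms(3) by eventually_elim (intro power_mono, auto)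
  then show "AE x in M. (norm (f x))\<^sup>2 \<le> (norm (g x))\<^sup>2" .
  show "integrable M (\<lambda>x. (norm (f x))\<^sup>2)"
    using sqint_mono[OF f sqint_integrable[OF g] *] by (rule sqint_integrable)
qed (use g in \<open>simp add: sqint_def\<close>)

lemma tendsto_nrm2:
  assumes f: "sqint M f" and s: "\<And>n. sqint M (s n)"
    and "(\<lambda>n. nrm2 M (\<lambda>x. s n x - f x)) \<longlonglongrightarrow> 0"
  shows "(\<lambda>n. nrm2 M (s n)) \<longlonglongrightarrow> nrm2 M f"
proof (rule Lim_null[THEN iffD2], rule Lim_null_comparison[OF _ assms(3)])
  have "\<bar>nrm2 M (s n) - nrm2 M f\<bar> \<le> nrm2 M (\<lambda>x. s n x - f x)" for n
    using nrm2_diff_le[OF s[of n] f] nrm2_diff_le[OF f s[of n]]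
    by (simp add: nrm2_minus_commute[of M f])
  then show "\<forall>\<^sub>F n in sequentially. norm (nrm2 M (s n) - nrm2 M f) \<le> nrm2 M (\<lambda>x. s n x - f x)"
    by simp
qed

lemma tendsto_integral_mult:
  assumes f: "sqint M f" and s: "\<And>n. sqint M (s n)"
    and "(\<lambda>n. nrm2 M (\<lambda>x. s n x - f x)) \<longlonglongrightarrow> 0" and g: "sqint M g"
  shows "(\<lambda>n. LINT x|M. s n x * g x) \<longlonglongrightarrow> (LINT x|M. f x * g x)"
proof (rule Lim_null[THEN iffD2], rule Lim_null_comparison)
  show "(\<lambda>n. nrm2 M (\<lambda>x. s n x - f x) * nrm2 M g) \<longlonglongrightarrow> 0"
    using tendsto_mult_left_zero[OF assms(3)] .
  have "norm ((LINT x|M. s n x * g x) - (LINT x|M. f x * g x)) \<le> nrm2 M (\<lambda>x. s n x - f x) * nrm2 M g" for n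
  proof -
    have "(LINT x|M. s n x * g x) - (LINT x|M. f x * g x) = (LINT x|M. (s n x - f x) * g x)"
      using sqint_mult_integrable[OF f g] sqint_mult_integrable[OF s g]
      by (simp add: algebra_simps)
    then show ?thesis
      using norm_integral_mult_le[OF sqint_diff[OF s f] g] by simp
  qed
  then show "\<forall>\<^sub>F n in sequentially. norm ((LINT x|M. s n x * g x) - (LINT x|M. f x * g x))
      \<le> nrm2 M (\<lambda>x. s n x - f x) * nrm2 M g" by simp
qed

text \<open>Weighting the squared increments of a fast subsequence with \<open>2 ^ k\<close>
  gives pointwise summability without Minkowski's inequality for infinite sums.\<close>

lemma L2_complete:
  fixes s :: "nat \<Rightarrow> 'a \<Rightarrow> 'b::{real_normed_field,banach,second_countable_topology}"
  assumes s: "\<And>n. sqint M (s n)"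
    and cauchy: "\<And>e. e > 0 \<Longrightarrow> \<exists>N. \<forall>m\<ge>N. \<forall>n\<ge>N. nrm2 M (\<lambda>x. s m x - s n x) < e"
  obtains f where "sqint M f" "(\<lambda>n. nrm2 M (\<lambda>x. s n x - f x)) \<longlonglongrightarrow> 0"
proof -
  have [measurable]: "s n \<in> borel_measurable M" for n
    using s[of n] by (rule sqint_measurable)
  have nn: "(\<integral>\<^sup>+x. ennreal ((norm (h x))\<^sup>2) \<partial>M) = ennreal ((nrm2 M h)\<^sup>2)" if "sqint M h" for h :: "'a \<Rightarrow> 'b"
    unfolding nrm2_sq by (rule nn_integral_eq_integral) (use that in \<open>auto simp: sqint_def\<close>)
  \<comment> \<open>Recursive choice of a strictly increasing index sequence; beyond
    \<open>r k\<close> all mutual distances are below 2^-k.\<close>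
  have "\<exists>N. \<forall>k. (\<forall>m\<ge>N k. \<forall>n\<ge>N k. nrm2 M (\<lambda>x. s m x - s n x) < (1/2)^k) \<and> N k < N (Suc k)"
  proof (rule dependent_nat_choice)
    show "\<exists>N. \<forall>m\<ge>N. \<forall>n\<ge>N. nrm2 M (\<lambda>x. s m x - s n x) < (1/2)^0"
      using cauchy[of 1] by simp
  next
    fix N :: nat and k
    obtain N' where N': "\<forall>m\<ge>N'. \<forall>n\<ge>N'. nrm2 M (\<lambda>x. s m x - s n x) < (1/2)^Suc k"
      using cauchy[of "(1/2)^Suc k"] by auto
    show "\<exists>y. (\<forall>m\<ge>y. \<forall>n\<ge>y. nrm2 M (\<lambda>x. s m x - s n x) < (1/2)^Suc k) \<and> N < y"
      by (rule exI[of _ "max N' (Suc N)"]) (use N' in auto)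
  qed
  then obtain r where r: "\<And>k m n. m \<ge> r k \<Longrightarrow> n \<ge> r k \<Longrightarrow> nrm2 M (\<lambda>x. s m x - s n x) < (1/2)^k"
    and rinc: "\<And>k. r k < r (Suc k)" by blast
  have rm: "strict_mono r" using rinc by (simp add: strict_mono_Suc_iff)
  define d where "d k x = s (r (Suc k)) x - s (r k) x" for k x
  have [measurable]: "d k \<in> borel_measurable M" for k
    unfolding d_def by measurable
  have dsq: "sqint M (d k)" for k
    unfolding d_def by (intro sqint_diff s)
  have dn: "nrm2 M (d k) \<le> (1/2)^k" for k
    using r[of k "r (Suc k)" "r k"] rinc[of k] unfolding d_def by force
  have "(\<integral>\<^sup>+x. (\<Sum>k. ennreal (2^k * (norm (d k x))\<^sup>2)) \<partial>M) = (\<Sum>k. \<integral>\<^sup>+x. ennreal (2^k * (norm (d k x))\<^sup>2) \<partial>M)"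
    by (rule nn_integral_suminf) measurable
  \<comment> \<open>Each squared increment integrates to at most 4^-k, so the weight 2^k still
    leaves the summable 2^-k.\<close>
  also have "\<dots> \<le> (\<Sum>k. ennreal ((1/2)^k))"
  proof (intro suminf_le)
    fix k
    have "(\<integral>\<^sup>+x. ennreal (2^k * (norm (d k x))\<^sup>2) \<partial>M) = ennreal (2^k) * ennreal ((nrm2 M (d k))\<^sup>2)"
      unfolding nn[OF dsq, symmetric] by (subst nn_integral_cmult[symmetric]) (auto simp: ennreal_mult)
    also have "\<dots> \<le> ennreal (2^k) * ennreal (((1/2)^k)\<^sup>2)"
      by (intro mult_left_mono ennreal_leI power_mono dn) auto
    also have "\<dots> = ennreal ((1/2)^k)"
      by (simp add: ennreal_mult[symmetric] power2_eq_square power_mult_distrib[symmetric])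
    finally show "(\<integral>\<^sup>+x. ennreal (2^k * (norm (d k x))\<^sup>2) \<partial>M) \<le> ennreal ((1/2)^k)" .
  qed auto
  also have "\<dots> < top"
    by (subst suminf_ennreal2) (auto intro: summable_geometric)
  finally have "(\<integral>\<^sup>+x. (\<Sum>k. ennreal (2^k * (norm (d k x))\<^sup>2)) \<partial>M) \<noteq> \<infinity>"
    unfolding infinity_ennreal_def by (rule less_imp_neq)
  then have "AE x in M. (\<Sum>k. ennreal (2^k * (norm (d k x))\<^sup>2)) \<noteq> \<infinity>"
    by (rule nn_integral_PInf_AE[rotated]) measurable
  then have "AE x in M. (\<Sum>k. ennreal (2^k * (norm (d k x))\<^sup>2)) \<noteq> top"
    unfolding infinity_ennreal_def .
  then have ae: "AE x in M. convergent (\<lambda>k. s (r k) x)"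
  proof eventually_elim
    case (elim x)
    have sm: "summable (\<lambda>k. 2^k * (norm (d k x))\<^sup>2)"
      by (rule summable_suminf_not_top[OF _ elim]) auto
    \<comment> \<open>With y = 2^k |d_k| this is y \<le> 1 + y^2 divided by 2^k: squares control
      first powers at the price of a geometric series.\<close>
    have le: "norm (d k x) \<le> (1/2)^k + 2^k * (norm (d k x))\<^sup>2" for k
    proof -
      have "norm (d k x) = (2^k * norm (d k x)) * (1/2)^k"
        by (simp add: power_mult_distrib[symmetric])
      also have "\<dots> \<le> (1 + (2^k * norm (d k x))\<^sup>2) * (1/2)^k"
      proof (rule mult_right_mono)
        define y where "y = 2^k * norm (d k x)"
        have "0 \<le> (y - 1/2)\<^sup>2 + 3/4" by (intro add_nonneg_nonneg) auto
        then have "y \<le> 1 + y\<^sup>2" by (simp add: power2_eq_square algebra_simps)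
        then show "2^k * norm (d k x) \<le> 1 + (2^k * norm (d k x))\<^sup>2" by (simp add: y_def)
      qed simp
      also have "\<dots> = (1/2)^k + 2^k * (norm (d k x))\<^sup>2"
        by (simp add: distrib_right power2_eq_square power_one_over add_divide_distrib)
      finally show ?thesis .
    qed
    have "summable (\<lambda>k. norm (d k x))"
      by (rule summable_comparison_test'[where N=0, OF summable_add[OF summable_geometric[of "1/2"] sm]])
        (use le in auto)
    then have "summable (\<lambda>k. d k x)" by (rule summable_norm_cancel)
    then have "convergent (\<lambda>n. \<Sum>k<n. d k x)" by (simp add: summable_iff_convergent)
    moreover have "(\<Sum>k<n. d k x) = s (r n) x - s (r 0) x" for n
      unfolding d_def by (rule sum_lessThan_telescope)
    ultimately have "convergent (\<lambda>n. s (r n) x - s (r 0) x)"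
      by simp
    then show ?case
      by (simp add: convergent_diff_const_right_iff)
  qed
  define f where "f x = lim (\<lambda>k. s (r k) x)" for x
  have [measurable]: "f \<in> borel_measurable M"
    unfolding f_def by measurable
  have lim: "AE x in M. (\<lambda>k. s (r k) x) \<longlonglongrightarrow> f x"
    using ae by eventually_elim (simp add: f_def convergent_LIMSEQ_iff)
  \<comment> \<open>Fatou is applied in the subsequence index j with m held fixed, so the estimate
    covers the whole sequence and not only the subsequence.\<close>
  have fatou: "(\<integral>\<^sup>+x. ennreal ((norm (s m x - f x))\<^sup>2) \<partial>M) \<le> ennreal (((1/2)^k)\<^sup>2)" if "m \<ge> r k" for m k
  proof -
    have "(\<integral>\<^sup>+x. ennreal ((norm (s m x - f x))\<^sup>2) \<partial>M)
        = (\<integral>\<^sup>+x. liminf (\<lambda>j. ennreal ((norm (s m x - s (r j) x))\<^sup>2)) \<partial>M)"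
    proof (rule nn_integral_cong_AE)
      show "AE x in M. ennreal ((norm (s m x - f x))\<^sup>2) = liminf (\<lambda>j. ennreal ((norm (s m x - s (r j) x))\<^sup>2))"
        using lim
      proof eventually_elim
        case (elim x)
        have "(\<lambda>j. ennreal ((norm (s m x - s (r j) x))\<^sup>2)) \<longlonglongrightarrow> ennreal ((norm (s m x - f x))\<^sup>2)"
          by (intro tendsto_ennrealI tendsto_intros elim)
        from lim_imp_Liminf[OF _ this] show ?case by (simp del: ennreal_power)
      qed
    qed
    also have "\<dots> \<le> liminf (\<lambda>j. \<integral>\<^sup>+x. ennreal ((norm (s m x - s (r j) x))\<^sup>2) \<partial>M)"
      by (rule nn_integral_liminf) measurable
    also have "\<dots> \<le> liminf (\<lambda>j. ennreal (((1/2)^k)\<^sup>2))"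
    proof (rule Liminf_mono)
      show "\<forall>\<^sub>F j in sequentially. (\<integral>\<^sup>+x. ennreal ((norm (s m x - s (r j) x))\<^sup>2) \<partial>M) \<le> ennreal (((1/2)^k)\<^sup>2)"
        using eventually_ge_at_top[of k]
      proof eventually_elim
        case (elim j)
        have "r k \<le> r j" using elim rm by (simp add: strict_mono_less_eq)
        then show ?case
          using r[of k m "r j"] that
          by (subst nn) (auto intro!: sqint_diff s ennreal_leI power_mono)
      qed
    qed
    also have "\<dots> = ennreal (((1/2)^k)\<^sup>2)"
      by (simp add: Liminf_const)
    finally show ?thesis .
  qed
  have sdf: "sqint M (\<lambda>x. s m x - f x)" if "m \<ge> r 0" for m
    unfolding sqint_def
  proof (intro conjI integrableI_bounded)
    show "(\<integral>\<^sup>+x. ennreal (norm ((norm (s m x - f x))\<^sup>2)) \<partial>M) < \<infinity>"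
      using fatou[OF that] by (simp add: order_le_less_trans ennreal_one_less_top)
  qed measurable
  have "sqint M (\<lambda>x. s (r 0) x - (s (r 0) x - f x))"
    by (intro sqint_diff s sdf) auto
  then have sf: "sqint M f" by simp
  have "(\<lambda>n. nrm2 M (\<lambda>x. s n x - f x)) \<longlonglongrightarrow> 0"
  proof (rule LIMSEQ_I)
    fix e :: real assume "e > 0"
    then obtain k where k: "(1/2::real)^k < e"
      using real_arch_pow_inv[of e "1/2"] by auto
    have "norm (nrm2 M (\<lambda>x. s n x - f x) - 0) < e" if "n \<ge> r k" for n
    proof -
      have "ennreal ((nrm2 M (\<lambda>x. s n x - f x))\<^sup>2) \<le> ennreal (((1/2)^k)\<^sup>2)"
        using fatou[OF that] by (subst (asm) nn) (auto intro!: sqint_diff s sf)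
      then have "(nrm2 M (\<lambda>x. s n x - f x))\<^sup>2 \<le> ((1/2)^k)\<^sup>2"
        by (simp add: ennreal_le_iff)
      then have "nrm2 M (\<lambda>x. s n x - f x) \<le> (1/2)^k"
        by (rule power2_le_imp_le) simp
      with k show ?thesis by simp
    qed
    then show "\<exists>no. \<forall>n\<ge>no. norm (nrm2 M (\<lambda>x. s n x - f x) - 0) < e" by blast
  qed
  with sf show ?thesis by (rule that)
qed

subsection \<open>Continuously differentiable functions\<close>

lemma pd_eq: "(f has_derivative f') (at x) \<Longrightarrow> pd f i x = f' (axis i 1)"
  unfolding pd_def using frechet_derivative_at by metis

lemma differentiable_has_derivative_pd:
  fixes f :: "real^'n \<Rightarrow> 'b::real_normed_vector"
  assumes "f differentiable (at x)"
  shows "(f has_derivative (\<lambda>h. \<Sum>i\<in>UNIV. h $ i *\<^sub>R pd f i x)) (at x)"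
proof -
  let ?D = "frechet_derivative f (at x)"
  have D: "(f has_derivative ?D) (at x)"
    using assms frechet_derivative_works by blast
  then interpret bounded_linear ?D by (rule has_derivative_bounded_linear)
  have "?D h = (\<Sum>i\<in>UNIV. h $ i *\<^sub>R pd f i x)" for h
  proof -
    have "?D h = ?D (\<Sum>i\<in>UNIV. h $ i *\<^sub>R axis i 1)"
      by (simp add: basis_expansion scalar_mult_eq_scaleR[symmetric])
    also have "\<dots> = (\<Sum>i\<in>UNIV. h $ i *\<^sub>R pd f i x)"
      by (simp add: sum scaleR pd_def)
    finally show ?thesis .
  qed
  then have "?D = (\<lambda>h. \<Sum>i\<in>UNIV. h $ i *\<^sub>R pd f i x)" by (rule ext)
  with D show ?thesis by simp
qed

lemma C1fun_has_derivative:
  "C1fun f \<Longrightarrow> (f has_derivative (\<lambda>h. \<Sum>i\<in>UNIV. h $ i *\<^sub>R pd f i x)) (at x)"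
  by (rule differentiable_has_derivative_pd) (simp add: C1fun_def)

lemma C1fun_differentiable: "C1fun f \<Longrightarrow> f differentiable (at x)"
  by (simp add: C1fun_def)

lemma C1fun_continuous_pd: "C1fun f \<Longrightarrow> continuous_on A (pd f i)"
  unfolding C1fun_def by (meson continuous_on_subset subset_UNIV)

lemma C1fun_continuous: "C1fun f \<Longrightarrow> continuous_on A f"
  by (metis C1fun_differentiable continuous_at_imp_continuous_on differentiable_imp_continuous_within)

lemma C1fun_measurable [measurable_dest]: "C1fun f \<Longrightarrow> f \<in> borel_measurable borel"
  by (rule borel_measurable_continuous_onI[OF C1fun_continuous])

lemma C1fun_measurable_pd: "C1fun f \<Longrightarrow> pd f i \<in> borel_measurable borel"
  by (rule borel_measurable_continuous_onI[OF C1fun_continuous_pd])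

lemma C1funI:
  assumes "\<And>x. (f has_derivative D x) (at x)" and "\<And>i. continuous_on UNIV (\<lambda>x. D x (axis i 1))"
  shows "C1fun f"
proof -
  have "pd f i = (\<lambda>x. D x (axis i 1))" for i
    by (rule ext, rule pd_eq[OF assms(1)])
  with assms show ?thesis by (auto simp: C1fun_def differentiable_def)
qed

lemma pd_const [simp]: "pd (\<lambda>x. c) i x = 0"
  by (rule pd_eq[OF has_derivative_const])

lemma C1fun_const [simp]: "C1fun (\<lambda>x. c)"
  by (rule C1funI[OF has_derivative_const]) simp

lemma pd_linear:
  assumes "bounded_linear F" "f differentiable (at x)"
  shows "pd (\<lambda>x. F (f x)) i x = F (pd f i x)"
  using pd_eq[OF bounded_linear.has_derivative[OF assms(1) assms(2)[unfolded frechet_derivative_works]]]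
  by (simp add: pd_def)

lemma pd_add:
  assumes "f differentiable (at x)" "g differentiable (at x)"
  shows "pd (\<lambda>x. f x + g x) i x = pd f i x + pd g i x"
  using pd_eq[OF has_derivative_add[OF assms[unfolded frechet_derivative_works]]]
  by (simp add: pd_def)

lemma pd_mult:
  fixes f g :: "real^'n \<Rightarrow> 'b::real_normed_algebra"
  assumes "f differentiable (at x)" "g differentiable (at x)"
  shows "pd (\<lambda>x. f x * g x) i x = f x * pd g i x + pd f i x * g x"
  using pd_eq[OF has_derivative_mult[OF assms[unfolded frechet_derivative_works]]]
  by (simp add: pd_def)

lemma pd_compose:
  fixes f :: "real^'n \<Rightarrow> real"
  assumes "f differentiable (at x)" "(F has_real_derivative F') (at (f x))"
  shows "pd (\<lambda>x. F (f x)) i x = F' * pd f i x"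
  using pd_eq[OF has_derivative_compose[OF assms(1)[unfolded frechet_derivative_works]
        assms(2)[unfolded has_field_derivative_def]]]
  by (simp add: pd_def)

lemma C1fun_add:
  assumes "C1fun f" "C1fun g" shows "C1fun (\<lambda>x. f x + g x)"
  unfolding C1fun_def
proof (intro allI conjI)
  show "(\<lambda>x. f x + g x) differentiable (at x)" for x
    using assms by (simp add: C1fun_def)
  have "pd (\<lambda>x. f x + g x) i = (\<lambda>x. pd f i x + pd g i x)" for i
    using assms by (intro ext pd_add) (auto simp: C1fun_def)
  then show "continuous_on UNIV (pd (\<lambda>x. f x + g x) i)" for i
    using assms by (simp add: C1fun_def continuous_on_add)
qed

lemma C1fun_mult:
  fixes f g :: "real^'n \<Rightarrow> 'b::real_normed_algebra"
  assumes "C1fun f" "C1fun g" shows "C1fun (\<lambda>x. f x * g x)"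
  unfolding C1fun_def
proof (intro allI conjI)
  show "(\<lambda>x. f x * g x) differentiable (at x)" for x
    using assms by (simp add: C1fun_def)
  have "pd (\<lambda>x. f x * g x) i = (\<lambda>x. f x * pd g i x + pd f i x * g x)" for i
    using assms by (intro ext pd_mult) (auto simp: C1fun_def)
  then show "continuous_on UNIV (pd (\<lambda>x. f x * g x) i)" for i
    using assms C1fun_continuous[OF assms(1)] C1fun_continuous[OF assms(2)]
    by (simp add: C1fun_def continuous_on_add continuous_on_mult)
qed

lemma C1fun_linear:
  assumes "bounded_linear F" "C1fun f" shows "C1fun (\<lambda>x. F (f x))"
  unfolding C1fun_def
proof (intro allI conjI)
  show "(\<lambda>x. F (f x)) differentiable (at x)" for x
    using assms bounded_linear.has_derivative unfolding C1fun_def differentiable_def by blast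
  have "pd (\<lambda>x. F (f x)) i = (\<lambda>x. F (pd f i x))" for i
    using assms by (intro ext pd_linear) (auto simp: C1fun_def)
  then show "continuous_on UNIV (pd (\<lambda>x. F (f x)) i)" for i
    using assms by (simp add: C1fun_def bounded_linear.continuous_on)
qed

lemma C1fun_compose:
  fixes f :: "real^'n \<Rightarrow> real"
  assumes "C1fun f" "\<And>t. (F has_real_derivative F' t) (at t)" "continuous_on UNIV F'"
  shows "C1fun (\<lambda>x. F (f x))"
  unfolding C1fun_def
proof (intro allI conjI)
  show "(\<lambda>x. F (f x)) differentiable (at x)" for x
    using assms(1,2) has_derivative_compose unfolding C1fun_def differentiable_def has_field_derivative_def by blast
  have "pd (\<lambda>x. F (f x)) i = (\<lambda>x. F' (f x) * pd f i x)" for i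
    using assms by (intro ext pd_compose) (auto simp: C1fun_def)
  moreover have "continuous_on UNIV (\<lambda>x. F' (f x))"
    by (rule continuous_on_compose2[OF assms(3) C1fun_continuous[OF assms(1)]]) auto
  ultimately show "continuous_on UNIV (pd (\<lambda>x. F (f x)) i)" for i
    using assms(1) by (simp add: C1fun_def continuous_on_mult)
qed

lemma C1fun_sum: "(\<And>a. a \<in> A \<Longrightarrow> C1fun (f a)) \<Longrightarrow> C1fun (\<lambda>x. \<Sum>a\<in>A. f a x)"
  by (induction A rule: infinite_finite_induct) (auto intro: C1fun_add)

lemma pd_zero_open:
  assumes "open U" "\<And>y. y \<in> U \<Longrightarrow> f y = 0" "x \<in> U"
  shows "pd f i x = 0"
  using pd_eq[OF has_derivative_transform_within_open[OF has_derivative_const[of 0] assms(1,3)], of f] assms(2)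
  by simp

subsection \<open>Compactly supported functions\<close>

text \<open>The support is compact in the whole space and may cross the boundary of the domain. Test
  functions add a support condition to this, approximants in \<open>H1_vanish\<close> add
  \<open>near_zero\<close>.\<close>

definition C1c :: "(real^'n \<Rightarrow> 'b::real_normed_vector) \<Rightarrow> bool" where
  "C1c f \<longleftrightarrow> C1fun f \<and> compact (supp_closure f)"

lemma C1c_C1fun: "C1c f \<Longrightarrow> C1fun f"
  by (simp add: C1c_def)

lemma supp_closure_zero: "x \<notin> supp_closure f \<Longrightarrow> f x = 0"
  using closure_subset[of "{x. f x \<noteq> 0}"] by (auto simp: supp_closure_def)

lemma pd_supp_closure_zero: "x \<notin> supp_closure f \<Longrightarrow> pd f i x = 0"
  by (rule pd_zero_open[of "- supp_closure f"])
    (simp_all add: supp_closure_zero, simp add: supp_closure_def open_Compl)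

lemma supp_closure_subset:
  "closed K \<Longrightarrow> (\<And>x. x \<notin> K \<Longrightarrow> f x = 0) \<Longrightarrow> supp_closure f \<subseteq> K"
  unfolding supp_closure_def by (rule closure_minimal) auto

lemma C1cI:
  assumes "C1fun f" "compact K" "\<And>x. x \<notin> K \<Longrightarrow> f x = 0"
  shows "C1c f"
proof -
  have "supp_closure f \<subseteq> K"
    by (rule supp_closure_subset) (use assms compact_imp_closed in auto)
  then have "compact (supp_closure f)"
    using compact_Int_closed[OF assms(2), of "supp_closure f"] by (simp add: supp_closure_def Int_absorb1)
  with assms(1) show ?thesis by (simp add: C1c_def)
qed

lemma test_fun_C1c: "test_fun S \<phi> \<Longrightarrow> C1c \<phi>"
  by (simp add: test_fun_def C1c_def)

lemma C1c_mult_left: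
  fixes f g :: "real^'n \<Rightarrow> 'b::real_normed_algebra"
  assumes "C1c f" "C1fun g" shows "C1c (\<lambda>x. g x * f x)"
  by (rule C1cI[where K="supp_closure f"])
    (use assms in \<open>auto simp: C1c_def supp_closure_zero intro: C1fun_mult\<close>)

lemma C1c_linear: 
  assumes "bounded_linear F" "C1c f" shows "C1c (\<lambda>x. F (f x))"
  by (rule C1cI[where K="supp_closure f"])
    (use assms in \<open>auto simp: C1c_def supp_closure_zero bounded_linear.linear linear_0 intro: C1fun_linear\<close>)

lemma C1c_add:
  assumes "C1c f" "C1c g" shows "C1c (\<lambda>x. f x + g x)"
  by (rule C1cI[where K="supp_closure f \<union> supp_closure g"])
    (use assms in \<open>auto simp: C1c_def supp_closure_zero intro: C1fun_add compact_Un\<close>)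

lemma continuous_compact_support_bounded:
  fixes f :: "'a::t2_space \<Rightarrow> 'b::real_normed_vector"
  assumes "continuous_on UNIV f" "compact K" "\<And>x. x \<notin> K \<Longrightarrow> f x = 0"
  obtains M where "M \<ge> 0" "\<And>x. norm (f x) \<le> M"
proof -
  have "bounded (f ` K)"
    by (intro compact_imp_bounded compact_continuous_image continuous_on_subset[OF assms(1)] assms) auto
  then obtain M where M: "\<And>x. x \<in> K \<Longrightarrow> norm (f x) \<le> M"
    unfolding bounded_iff by auto
  have "norm (f x) \<le> max M 0" for x
    using M[of x] assms(3)[of x] by (cases "x \<in> K") auto
  then show ?thesis using that[of "max M 0"] by auto
qed

lemma C1c_bounded:
  assumes "C1c f" obtains M where "M \<ge> 0" "\<And>x. norm (f x) \<le> M"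
  using continuous_compact_support_bounded[OF C1fun_continuous, of f "supp_closure f"] assms
  by (auto simp: C1c_def supp_closure_zero)

lemma C1c_pd_bounded:
  assumes "C1c f" obtains M where "M \<ge> 0" "\<And>x. norm (pd f i x) \<le> M"
  using continuous_compact_support_bounded[OF C1fun_continuous_pd, of f "supp_closure f" i] assms
  by (auto simp: C1c_def pd_supp_closure_zero)

text \<open>Supplies a majorant of the difference quotients that does not depend on the step
  size.\<close>

lemma C1c_lipschitz:
  fixes f :: "real^'n \<Rightarrow> 'b::real_normed_vector"
  assumes "C1c f" obtains L where "L \<ge> 0" "\<And>x y. norm (f x - f y) \<le> L * norm (x - y)"
proof -
  have "\<exists>M. \<forall>x. norm (pd f i x) \<le> M" for i
    using C1c_pd_bounded[OF assms] by metis
  then obtain M where M: "\<And>i x. norm (pd f i x) \<le> M i" by metis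
  have M0: "M i \<ge> 0" for i using M[of i 0] norm_ge_zero[of "pd f i 0"] by linarith
  have "norm (f x - f y) \<le> (\<Sum>i\<in>UNIV. M i) * norm (x - y)" for x y
  proof (rule differentiable_bound[of UNIV f "\<lambda>x h. \<Sum>i\<in>UNIV. h $ i *\<^sub>R pd f i x"])
    show "(f has_derivative (\<lambda>h. \<Sum>i\<in>UNIV. h $ i *\<^sub>R pd f i x)) (at x within UNIV)" for x
      using C1fun_has_derivative[OF C1c_C1fun[OF assms]] by simp
    show "onorm (\<lambda>h. \<Sum>i\<in>UNIV. h $ i *\<^sub>R pd f i x) \<le> (\<Sum>i\<in>UNIV. M i)" for x
    proof (rule onorm_le)
      fix h :: "real^'n"
      have "norm (\<Sum>i\<in>UNIV. h $ i *\<^sub>R pd f i x) \<le> (\<Sum>i\<in>UNIV. norm (h $ i *\<^sub>R pd f i x))"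
        by (rule norm_sum)
      also have "\<dots> \<le> (\<Sum>i\<in>UNIV. norm h * M i)"
        unfolding norm_scaleR
        by (intro sum_mono mult_mono M) (auto simp: component_le_norm_cart)
      finally show "norm (\<Sum>i\<in>UNIV. h $ i *\<^sub>R pd f i x) \<le> (\<Sum>i\<in>UNIV. M i) * norm h"
        by (simp only: sum_distrib_left mult.commute[of _ "norm h"])
    qed
  qed auto
  moreover have "(\<Sum>i\<in>UNIV. M i) \<ge> 0" by (intro sum_nonneg M0)
  ultimately show ?thesis by (rule that[rotated])
qed

lemma integrable_continuous_compact_support:
  fixes f :: "'a::euclidean_space \<Rightarrow> 'b::{banach,second_countable_topology}"
  assumes "continuous_on UNIV f" "compact K" "\<And>x. x \<notin> K \<Longrightarrow> f x = 0"
  shows "integrable lborel f"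
proof -
  have "(\<lambda>x. indicator K x *\<^sub>R f x) = f"
    using assms(3) by (auto simp: indicator_def)
  with borel_integrable_compact[OF assms(2) continuous_on_subset[OF assms(1)]] show ?thesis by auto
qed

section \<open>Translation invariance and difference quotients\<close>

lemma lborel_integral_translate:
  fixes f :: "'a::euclidean_space \<Rightarrow> 'b::{banach,second_countable_topology}"
  assumes "f \<in> borel_measurable borel"
  shows "(LINT x|lborel. f (c + x)) = (LINT x|lborel. f x)"
  by (subst (2) lborel_distr_plus[symmetric, of c], subst integral_distr) (use assms in auto)

lemma lborel_integrable_translate:
  fixes f :: "'a::euclidean_space \<Rightarrow> 'b::{banach,second_countable_topology}"
  assumes "f \<in> borel_measurable borel" "integrable lborel f"
  shows "integrable lborel (\<lambda>x. f (c + x))"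
  using assms(2)
  by (subst (asm) lborel_distr_plus[symmetric, of c], subst (asm) integrable_distr_eq) (use assms(1) in auto)

lemma difference_quotient_tendsto:
  assumes "(f has_derivative f') (at x)"
  shows "(\<lambda>n. real (Suc n) *\<^sub>R (f (x + rcp n *\<^sub>R v) - f x)) \<longlonglongrightarrow> f' v"
\<comment> \<open>For v = 0 the points \<open>y n\<close> all equal x and do not converge along the
  punctured filter \<open>at x\<close>.\<close>
proof (cases "v = 0")
  case True
  then show ?thesis
    using linear_0[OF bounded_linear.linear[OF has_derivative_bounded_linear[OF assms]]] by simp
next
  case False
  interpret bounded_linear f' using assms by (rule has_derivative_bounded_linear)
  define y where "y n = x + rcp n *\<^sub>R v" for n
  have "((\<lambda>y. norm ((f y - f x) - f' (y - x)) / norm (y - x)) \<longlongrightarrow> 0) (at x)"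
    using assms by (simp add: has_derivative_iff_norm)
  moreover have "filterlim y (at x) sequentially"
  proof -
    have "y \<longlonglongrightarrow> x + 0 *\<^sub>R v"
      unfolding y_def by (intro tendsto_intros LIMSEQ_inverse_real_of_nat)
    then show ?thesis
      using False by (auto simp: filterlim_at y_def simp del: of_nat_Suc)
  qed
  ultimately have "(\<lambda>n. norm ((f (y n) - f x) - f' (y n - x)) / norm (y n - x)) \<longlonglongrightarrow> 0"
    by (rule filterlim_compose)
  then have "(\<lambda>n. norm v * (norm ((f (y n) - f x) - f' (y n - x)) / norm (y n - x))) \<longlonglongrightarrow> 0"
    using tendsto_mult_right_zero by blast
  moreover have "norm v * (norm ((f (y n) - f x) - f' (y n - x)) / norm (y n - x))
      = norm (real (Suc n) *\<^sub>R (f (y n) - f x) - f' v)" for n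
  proof -
    have "real (Suc n) *\<^sub>R (f (y n) - f x) - f' v = real (Suc n) *\<^sub>R ((f (y n) - f x) - f' (y n - x))"
      by (simp add: y_def scaleR scaleR_diff_right del: of_nat_Suc)
    then show ?thesis using False
      by (simp add: y_def divide_inverse del: of_nat_Suc)
  qed
  ultimately have "(\<lambda>n. norm (real (Suc n) *\<^sub>R (f (y n) - f x) - f' v)) \<longlonglongrightarrow> 0"
    by simp
  then have "(\<lambda>n. real (Suc n) *\<^sub>R (f (y n) - f x) - f' v) \<longlonglongrightarrow> 0"
    by (simp add: tendsto_norm_zero_iff)
  then show ?thesis unfolding y_def by (rule Lim_null[THEN iffD2])
qed

text \<open>Dominated convergence with the Lipschitz constant of f as majorant. The weight 1 gives
  integration by parts; the ground state extended by zero as weight gives the monotonicity argument,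
  where the derivative must stay on the test function.\<close>

lemma tendsto_integral_difference_quotient:
  fixes f :: "real^'n \<Rightarrow> 'b::{banach,second_countable_topology}" and w :: "real^'n \<Rightarrow> real"
  assumes f: "C1c f" and w[measurable]: "w \<in> borel_measurable borel"
    and wi: "\<And>R. integrable lborel (\<lambda>x. indicat_real (cball 0 R) x * w x)"
  shows "(\<lambda>n. LINT x|lborel. w x *\<^sub>R (real (Suc n) *\<^sub>R (f (x + rcp n *\<^sub>R v) - f x)))
     \<longlonglongrightarrow> (LINT x|lborel. w x *\<^sub>R (\<Sum>i\<in>UNIV. v $ i *\<^sub>R pd f i x))"
proof -
  have [measurable]: "f \<in> borel_measurable borel" "pd f i \<in> borel_measurable borel" for i
    using C1fun_measurable[OF C1c_C1fun[OF f]] C1fun_measurable_pd[OF C1c_C1fun[OF f]] by auto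
  obtain L where L: "L \<ge> 0" "\<And>x y. norm (f x - f y) \<le> L * norm (x - y)"
    using C1c_lipschitz[OF f] by blast
  have "bounded (supp_closure f)" using f by (auto simp: C1c_def compact_imp_bounded)
  then obtain R where R: "\<And>x. x \<in> supp_closure f \<Longrightarrow> norm x \<le> R" unfolding bounded_iff by auto
  have z: "f x = 0" if "norm x > R" for x
    using R[of x] that supp_closure_zero[of x f] by force
  \<comment> \<open>The steps \<open>rcp n\<close> are at most 1, so beyond radius R + |v| neither x
    nor its translate meets the support.\<close>
  have bound: "norm (real (Suc n) *\<^sub>R (f (x + rcp n *\<^sub>R v) - f x))
     \<le> indicat_real (cball 0 (R + norm v)) x * (L * norm v)" for x n
  proof (cases "norm x \<le> R + norm v")
    case True
    have "norm (real (Suc n) *\<^sub>R (f (x + rcp n *\<^sub>R v) - f x))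
       \<le> real (Suc n) * (L * norm (rcp n *\<^sub>R v))"
      using L(2)[of "x + rcp n *\<^sub>R v" x]
      by (simp del: of_nat_Suc norm_scaleR add: mult_left_mono norm_scaleR[of "real (Suc n)"])
    also have "\<dots> = L * norm v" by (simp del: of_nat_Suc)
    finally show ?thesis using True by simp
  next
    case False
    have "norm x - norm v \<le> norm (x + rcp n *\<^sub>R v)"
    proof -
      have "norm (rcp n *\<^sub>R v) \<le> 1 * norm v"
        unfolding norm_scaleR by (rule mult_right_mono) (auto simp: inverse_le_1_iff)
      then show ?thesis
        using norm_diff_ineq[of x "rcp n *\<^sub>R v"] by linarith
    qed
    moreover have "norm v \<ge> 0" by simp
    ultimately have "f (x + rcp n *\<^sub>R v) = 0" "f x = 0"
      using False by (auto intro!: z simp del: of_nat_Suc norm_ge_zero)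
    then show ?thesis using L(1) by (simp del: of_nat_Suc)
  qed
  show ?thesis
  proof (rule integral_dominated_convergence[where w = "\<lambda>x. norm (indicat_real (cball 0 (R + norm v)) x * w x) * (L * norm v)"])
    show "integrable lborel (\<lambda>x. norm (indicat_real (cball 0 (R + norm v)) x * w x) * (L * norm v))"
      by (intro integrable_mult_left integrable_norm wi)
    show "AE x in lborel. (\<lambda>n. w x *\<^sub>R (real (Suc n) *\<^sub>R (f (x + rcp n *\<^sub>R v) - f x)))
        \<longlonglongrightarrow> w x *\<^sub>R (\<Sum>i\<in>UNIV. v $ i *\<^sub>R pd f i x)"
      by (intro AE_I2 tendsto_scaleR tendsto_const
          difference_quotient_tendsto[OF C1fun_has_derivative[OF C1c_C1fun[OF f]]])
    show "AE x in lborel. norm (w x *\<^sub>R (real (Suc n) *\<^sub>R (f (x + rcp n *\<^sub>R v) - f x)))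
         \<le> norm (indicat_real (cball 0 (R + norm v)) x * w x) * (L * norm v)" for n
    proof (rule AE_I2)
      fix x
      show "norm (w x *\<^sub>R (real (Suc n) *\<^sub>R (f (x + rcp n *\<^sub>R v) - f x)))
         \<le> norm (indicat_real (cball 0 (R + norm v)) x * w x) * (L * norm v)"
        using mult_left_mono[OF bound[of n x], of "\<bar>w x\<bar>"]
        by (simp del: of_nat_Suc add: abs_mult norm_scaleR[of "w x"] mult_ac)
    qed
  qed measurable
qed

text \<open>By translation invariance every difference quotient already has integral zero, so the
  limit has too; no iterated integration is involved.\<close>

lemma integral_pd_C1c:
  fixes f :: "real^'n \<Rightarrow> 'b::{banach,second_countable_topology}"
  assumes f: "C1c f"
  shows "(LINT x|lborel. pd f i x) = 0"
proof -
  have fm: "f \<in> borel_measurable borel"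
    using C1fun_measurable[OF C1c_C1fun[OF f]] .
  have fi: "integrable lborel f"
    by (rule integrable_continuous_compact_support[OF C1fun_continuous[OF C1c_C1fun[OF f]], of "supp_closure f"])
      (use f in \<open>auto simp: C1c_def supp_closure_zero\<close>)
  have "(\<lambda>n. LINT x|lborel. 1 *\<^sub>R (real (Suc n) *\<^sub>R (f (x + rcp n *\<^sub>R axis i 1) - f x)))
     \<longlonglongrightarrow> (LINT x|lborel. 1 *\<^sub>R (\<Sum>j\<in>UNIV. axis i 1 $ j *\<^sub>R pd f j x))"
  proof (rule tendsto_integral_difference_quotient[OF f])
    show "integrable lborel (\<lambda>x::real^'n. indicat_real (cball 0 R) x * 1)" for R
      using borel_integrable_compact[of "cball 0 R" "\<lambda>x::real^'n. 1::real"] by simp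
  qed simp
  moreover have "(LINT x|lborel. 1 *\<^sub>R (real (Suc n) *\<^sub>R (f (x + rcp n *\<^sub>R axis i 1) - f x))) = 0" for n
    using lborel_integral_translate[OF fm, of "rcp n *\<^sub>R axis i 1"]
      lborel_integrable_translate[OF fm fi, of "rcp n *\<^sub>R axis i 1"] fi
    by (simp del: of_nat_Suc add: add.commute[of _ "inverse _ *\<^sub>R _"])
  moreover have "(\<Sum>j\<in>UNIV. axis i 1 $ j *\<^sub>R pd f j x) = pd f i x" for x
    by (simp add: axis_def if_distrib[of "\<lambda>c. c *\<^sub>R _"] cong: if_cong)
  ultimately have "(\<lambda>n::nat. 0) \<longlonglongrightarrow> (LINT x|lborel. pd f i x)" by simp
  then show ?thesis by (simp add: LIMSEQ_const_iff)
qed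

subsection \<open>Bump functions and the fundamental lemma of the calculus of variations\<close>

text \<open>Squaring removes the corner of the positive part. The square is C^1, which is all the
  regularity that \<open>test_fun\<close> demands, so bumps can be piecewise polynomial.\<close>

lemma DERIV_max0_square: "((\<lambda>t. (max 0 t)\<^sup>2) has_real_derivative 2 * max 0 t) (at t)"
proof (cases t "0::real" rule: linorder_cases)
  case less
  have "((\<lambda>t. 0) has_real_derivative 0) (at t)" by simp
  then have "((\<lambda>t. (max 0 t)\<^sup>2) has_real_derivative 0) (at t)"
    by (rule has_field_derivative_transform_within_open[where S="{..<0}"]) (use less in auto)
  then show ?thesis using less by simp
next
  case greater
  have "((\<lambda>t. t\<^sup>2) has_real_derivative 2 * t) (at t)" by (auto intro!: derivative_eq_intros)
  then have "((\<lambda>t. (max 0 t)\<^sup>2) has_real_derivative 2 * t) (at t)"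
    by (rule has_field_derivative_transform_within_open[where S="{0<..}"]) (use greater in auto)
  then show ?thesis using greater by simp
next
  case equal
  have "((\<lambda>h. \<bar>h\<bar>) \<longlongrightarrow> 0) (at (0::real))"
    using tendsto_rabs[of "\<lambda>h. h" 0 "at (0::real)"] by simp
  then have "((\<lambda>h. (max 0 h)\<^sup>2 / h) \<longlongrightarrow> 0) (at (0::real))"
    by (rule Lim_null_comparison[rotated]) (auto simp: max_def power2_eq_square)
  then show ?thesis using equal by (simp add: DERIV_def)
qed

lemma C1fun_norm_square: "C1fun (\<lambda>x::real^'n. (norm (x - a))\<^sup>2)"
proof -
  have "((\<lambda>x. (norm (x - a))\<^sup>2) has_derivative (\<lambda>h. 2 * ((x - a) \<bullet> h))) (at x)" for x :: "real^'n"
    unfolding power2_norm_eq_inner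
    by (auto intro!: derivative_eq_intros simp: inner_commute)
  then show ?thesis by (rule C1funI) (intro continuous_intros)
qed

lemma C1fun_diff_const:
  fixes f :: "real^'n \<Rightarrow> real"
  shows "C1fun f \<Longrightarrow> C1fun (\<lambda>x. c - d * f x)"
  by (rule C1fun_compose[where F="\<lambda>t. c - d * t" and F'="\<lambda>t. - d"]) (auto intro!: derivative_eq_intros)

lemma C1fun_max0_square:
  fixes f :: "real^'n \<Rightarrow> real"
  shows "C1fun f \<Longrightarrow> C1fun (\<lambda>x. (max 0 (f x))\<^sup>2)"
  by (rule C1fun_compose[OF _ DERIV_max0_square]) (auto intro!: continuous_intros)

lemma test_funI:
  assumes "C1fun \<phi>" "compact K" "K \<subseteq> S" "\<And>x. x \<notin> K \<Longrightarrow> \<phi> x = 0"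
  shows "test_fun S \<phi>"
  using C1cI[OF assms(1,2,4)] supp_closure_subset[OF compact_imp_closed[OF assms(2)], of \<phi>] assms(3,4)
  by (auto simp: test_fun_def C1c_def)

text \<open>Finitely many ball-shaped bumps inside U have a sum that is bounded below on K by
  compactness; a C^1 cap at that bound flattens the sum to 1 there.\<close>

lemma C1_Urysohn:
  fixes K :: "(real^'n) set"
  assumes K: "compact K" and U: "open U" and KU: "K \<subseteq> U"
  obtains \<phi> where "test_fun U \<phi>" "\<And>x. 0 \<le> \<phi> x \<and> \<phi> x \<le> 1" "\<And>x. x \<in> K \<Longrightarrow> \<phi> x = 1"
proof (cases "K = {}")
  case True
  have "test_fun U (\<lambda>x. 0)" by (rule test_funI[where K="{}"]) auto
  then show ?thesis by (rule that) (use True in auto)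
next
  case False
  have "\<forall>x\<in>K. \<exists>r>0. cball x r \<subseteq> U"
    using open_contains_cball U KU by blast
  then obtain r where r: "\<And>x. x \<in> K \<Longrightarrow> r x > 0" "\<And>x. x \<in> K \<Longrightarrow> cball x (r x) \<subseteq> U" by metis
  have "K \<subseteq> (\<Union>x\<in>K. ball x (r x))" using r(1) by auto
  then obtain D where D: "D \<subseteq> K" "finite D" "K \<subseteq> (\<Union>x\<in>D. ball x (r x))"
    using compactE_image[OF K, of K "\<lambda>x. ball x (r x)"] by (metis open_ball)
  \<comment> \<open>The factor 1 matches the shape \<open>c - d * f x\<close> of
    \<open>C1fun_diff_const\<close>; it recurs in the definition of \<phi>.\<close>
  define b where "b a x = (max 0 ((r a)\<^sup>2 - 1 * (norm (x - a))\<^sup>2))\<^sup>2" for a x :: "real^'n"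
  define s where "s x = (\<Sum>a\<in>D. b a x)" for x
  have b0: "b a x \<ge> 0" for a x by (simp add: b_def)
  have bpos: "b a x > 0" if "x \<in> ball a (r a)" for a x
  proof -
    have "(norm (x - a))\<^sup>2 < (r a)\<^sup>2"
      using that by (intro power_strict_mono) (auto simp: dist_norm norm_minus_commute)
    then show ?thesis by (simp add: b_def)
  qed
  have bz: "b a x = 0" if "x \<notin> cball a (r a)" "a \<in> D" for a x
  proof -
    have "(r a)\<^sup>2 \<le> (norm (x - a))\<^sup>2"
      using that r(1)[of a] D(1) by (intro power_mono) (auto simp: dist_norm norm_minus_commute)
    then show ?thesis by (simp add: b_def)
  qed
  have C1s: "C1fun s"
    unfolding s_def b_def
    by (intro C1fun_sum C1fun_max0_square C1fun_diff_const C1fun_norm_square)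
  have spos: "s x > 0" if "x \<in> K" for x
  proof -
    from \<open>x \<in> K\<close> D(3) have "x \<in> (\<Union>a\<in>D. ball a (r a))" by (rule rev_subsetD)
    then obtain a where a: "a \<in> D" "x \<in> ball a (r a)" by blast
    show ?thesis unfolding s_def using bpos[OF a(2)] a(1) D(2) b0 by (intro sum_pos2[of D a]) auto
  qed
  obtain x0 where x0: "x0 \<in> K" "\<And>y. y \<in> K \<Longrightarrow> s x0 \<le> s y"
    using continuous_attains_inf[OF K False C1fun_continuous[OF C1s]] by auto
  define m where "m = s x0"
  have m: "m > 0" unfolding m_def using spos x0 by auto
  \<comment> \<open>This cap sends s = 0 to 0 and everything from the minimum m upwards to 1, with
    vanishing slope at s = m.\<close>
  define \<phi> where "\<phi> x = 1 - 1 * (max 0 (1 - (1/m) * s x))\<^sup>2" for x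
  have s0: "s x \<ge> 0" for x unfolding s_def by (intro sum_nonneg b0)
  show ?thesis
  proof (rule that)
    show "test_fun U \<phi>"
    proof (rule test_funI[where K="\<Union>a\<in>D. cball a (r a)"])
      show "C1fun \<phi>"
        unfolding \<phi>_def by (intro C1fun_max0_square C1fun_diff_const C1s)
      show "compact (\<Union>a\<in>D. cball a (r a))" using D(2) by auto
      show "(\<Union>a\<in>D. cball a (r a)) \<subseteq> U" using r(2) D(1) by auto
      fix x assume "x \<notin> (\<Union>a\<in>D. cball a (r a))"
      then have "s x = 0" unfolding s_def using bz by (intro sum.neutral) auto
      then show "\<phi> x = 0" by (simp add: \<phi>_def)
    qed
    show "0 \<le> \<phi> x \<and> \<phi> x \<le> 1" for x
      unfolding \<phi>_def using s0[of x] m by (auto simp: max_def power_le_one)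
    show "\<phi> x = 1" if "x \<in> K" for x
      unfolding \<phi>_def using x0(2)[OF that] m by (simp add: m_def[symmetric] max_def)
  qed
qed

section \<open>Integrals over \<open>lebesgue_on S\<close> of Borel functions\<close>

lemma measurable_lebesgue_on_borel:
  "f \<in> borel_measurable borel \<Longrightarrow> f \<in> borel_measurable (lebesgue_on S)"
  by (intro measurable_restrict_space1 measurable_completion) simp

text \<open>Moves a Borel integrand to \<open>lborel\<close>, where translation invariance and the
  product structure are at hand.\<close>

lemma integrable_lebesgue_on_borel:
  fixes f :: "'a::euclidean_space \<Rightarrow> 'b::{banach,second_countable_topology}"
  assumes "S \<in> sets borel" "f \<in> borel_measurable borel"
  shows "integrable (lebesgue_on S) f \<longleftrightarrow> integrable lborel (\<lambda>x. indicat_real S x *\<^sub>R f x)"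
proof -
  have m: "(\<lambda>x. indicat_real S x *\<^sub>R f x) \<in> borel_measurable lborel"
    using assms by measurable
  show ?thesis
    using assms integrable_completion[OF m] by (subst integrable_restrict_space) auto
qed

lemma integral_lebesgue_on_borel:
  fixes f :: "'a::euclidean_space \<Rightarrow> 'b::{banach,second_countable_topology}"
  assumes "S \<in> sets borel" "f \<in> borel_measurable borel"
  shows "(LINT x|lebesgue_on S. f x) = (LINT x|lborel. indicat_real S x *\<^sub>R f x)"
proof -
  have m: "(\<lambda>x. indicat_real S x *\<^sub>R f x) \<in> borel_measurable lborel"
    using assms by measurable
  show ?thesis
    using assms integral_completion[OF m] by (subst integral_restrict_space) auto
qed

lemma integrable_lebesgue_on_continuous_compact_support:
  fixes f :: "'a::euclidean_space \<Rightarrow> 'b::{banach,second_countable_topology}"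
  assumes "continuous_on UNIV f" "compact K" "\<And>x. x \<notin> K \<Longrightarrow> f x = 0" "S \<in> sets borel"
  shows "integrable (lebesgue_on S) f"
  using integrable_continuous_compact_support[OF assms(1-3)] borel_measurable_continuous_onI[OF assms(1)] assms(4)
  by (subst integrable_lebesgue_on_borel) (auto intro: integrable_mult_indicator)

lemma sqint_continuous_compact_support:
  assumes "continuous_on UNIV f" "compact K" "\<And>x. x \<notin> K \<Longrightarrow> f x = 0" "S \<in> sets borel"
  shows "sqint (lebesgue_on S) f"
  unfolding sqint_def
proof (intro conjI integrable_lebesgue_on_continuous_compact_support[where K=K])
  show "f \<in> borel_measurable (lebesgue_on S)"
    by (intro measurable_lebesgue_on_borel borel_measurable_continuous_onI assms)
qed (use assms in \<open>auto intro!: continuous_intros\<close>)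

lemma C1c_sqint: "C1c f \<Longrightarrow> S \<in> sets borel \<Longrightarrow> sqint (lebesgue_on S) f"
  by (rule sqint_continuous_compact_support[where K="supp_closure f"])
    (auto simp: C1c_def supp_closure_zero C1fun_continuous)

lemma C1c_sqint_pd: "C1c f \<Longrightarrow> S \<in> sets borel \<Longrightarrow> sqint (lebesgue_on S) (pd f i)"
  by (rule sqint_continuous_compact_support[where K="supp_closure f"])
    (auto simp: C1c_def pd_supp_closure_zero C1fun_continuous_pd)

text \<open>Urysohn functions of shrinking neighbourhoods converge to the indicator of K. In the
  limit the integral of w over K is nonnegative although w is negative on K, so K is null.\<close>

lemma fundamental_lemma_compact:
  fixes w :: "real^'n \<Rightarrow> real"
  assumes S: "open S" and w: "sqint (lebesgue_on S) w"
    and pos: "\<And>\<phi>. test_fun S \<phi> \<Longrightarrow> (\<And>x. \<phi> x \<ge> 0) \<Longrightarrow> 0 \<le> (LINT x|lebesgue_on S. w x * \<phi> x)"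
    and K: "compact K" "K \<subseteq> S" and neg: "\<And>x. x \<in> K \<Longrightarrow> w x < 0"
  shows "K \<in> null_sets lebesgue"
proof (cases "K = {}")
  case False
  let ?M = "lebesgue_on S"
  have Sb [measurable]: "S \<in> sets borel" using S by simp
  have Kb [measurable]: "K \<in> sets borel" using K(1) by (simp add: borel_compact)
  \<comment> \<open>Intersecting with S makes functions supported in \<open>U n\<close> test
    functions on S; since K is closed, a point outside K eventually leaves every
    \<open>U n\<close>.\<close>
  define U where "U n = S \<inter> {x. infdist x K < rcp n}" for n
  have Uo: "open (U n)" for n
    unfolding U_def by (intro open_Int S open_Collect_less continuous_intros)
  have KU: "K \<subseteq> U n" for n
    unfolding U_def using K(2) by (auto simp: infdist_zero)
  have "\<exists>\<phi>. test_fun (U n) \<phi> \<and> (\<forall>x. 0 \<le> \<phi> x \<and> \<phi> x \<le> 1) \<and> (\<forall>x\<in>K. \<phi> x = 1)" for n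
    using C1_Urysohn[OF K(1) Uo KU] by metis
  then obtain \<phi> where \<phi>: "\<And>n. test_fun (U n) (\<phi> n)" "\<And>n x. 0 \<le> \<phi> n x \<and> \<phi> n x \<le> 1"
    "\<And>n x. x \<in> K \<Longrightarrow> \<phi> n x = 1" by metis
  have \<phi>z: "\<phi> n x = 0" if "x \<notin> U n" for n x
    using \<phi>(1)[of n] that supp_closure_zero[of x "\<phi> n"] by (auto simp: test_fun_def)
  obtain R where R: "\<And>x. x \<in> K \<Longrightarrow> norm x \<le> R"
    using compact_imp_bounded[OF K(1)] unfolding bounded_iff by auto
  have UR: "U n \<subseteq> cball 0 (R + 1)" for n
  proof
    fix x assume "x \<in> U n"
    then have "infdist x K < 1"
      unfolding U_def using inverse_le_1_iff[of "real (Suc n)"] by force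
    moreover obtain y where "y \<in> K" "infdist x K = dist x y"
      using infdist_attains_inf[OF compact_imp_closed[OF K(1)] False] by blast
    ultimately show "x \<in> cball 0 (R + 1)"
      using R[of y] norm_triangle_ineq[of y "x - y"] by (auto simp: dist_norm)
  qed
  have \<phi>m [measurable]: "\<phi> n \<in> borel_measurable ?M" for n
    using C1fun_measurable[of "\<phi> n"] \<phi>(1)[of n] by (auto simp: test_fun_def intro: measurable_lebesgue_on_borel)
  have wm [measurable]: "w \<in> borel_measurable ?M" using w by (rule sqint_measurable)
  have im [measurable]: "indicat_real A \<in> borel_measurable ?M" if "A \<in> sets borel" for A
    by (rule measurable_lebesgue_on_borel) (use that in measurable)
  \<comment> \<open>On an unbounded S the square-integrable w may fail to be integrable. All
    supports lie in one ball, and w times its indicator is an integrable majorant.\<close>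
  have ind: "sqint ?M (indicat_real (cball 0 (R+1)))"
    unfolding sqint_def
  proof
    show "indicat_real (cball 0 (R + 1)) \<in> borel_measurable ?M" by (rule im) simp
    have "integrable lborel (\<lambda>x. indicat_real S x *\<^sub>R (indicat_real (cball 0 (R + 1)) x *\<^sub>R (1::real)))"
      by (intro integrable_mult_indicator borel_integrable_compact) auto
    then have i: "integrable ?M (indicat_real (cball 0 (R + 1)))"
      by (subst integrable_lebesgue_on_borel[OF Sb]) (auto intro: borel_measurable_indicator)
    have eq: "(\<lambda>x. (norm (indicat_real (cball 0 (R + 1)) x))\<^sup>2) = indicat_real (cball 0 (R + 1) :: (real^'n) set)"
      by (auto simp: indicator_def)
    show "integrable ?M (\<lambda>x. (norm (indicat_real (cball 0 (R + 1)) x))\<^sup>2)"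
      unfolding eq by (rule i)
  qed
  have dom: "integrable ?M (\<lambda>x. norm (w x * indicat_real (cball 0 (R+1)) x))"
    by (intro integrable_norm sqint_mult_integrable w ind)
  have le: "norm (w x * c) \<le> norm (w x * indicat_real (cball 0 (R+1)) x)"
    if "0 \<le> c \<and> c \<le> 1" "x \<notin> cball 0 (R+1) \<Longrightarrow> c = 0" for x c
    using that by (auto simp: abs_mult indicator_def intro: mult_left_le)
  have "(\<lambda>n. LINT x|?M. w x * \<phi> n x) \<longlonglongrightarrow> (LINT x|?M. w x * indicat_real K x)"
  proof (rule integral_dominated_convergence[OF _ _ dom])
    show "AE x in ?M. (\<lambda>n. w x * \<phi> n x) \<longlonglongrightarrow> w x * indicat_real K x"
    proof (rule AE_I2)
      fix x
      have "(\<lambda>n. \<phi> n x) \<longlonglongrightarrow> indicat_real K x"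
      proof (cases "x \<in> K")
        case True
        then show ?thesis using \<phi>(3) by simp
      next
        case xK: False
        then have "infdist x K > 0"
          using infdist_pos_not_in_closed[OF compact_imp_closed[OF K(1)] False] by blast
        then obtain N where N: "rcp N < infdist x K"
          using reals_Archimedean by blast
        have "\<phi> n x = 0" if "n \<ge> N" for n
        proof (rule \<phi>z)
          have "rcp n \<le> rcp N"
            using that by (intro le_imp_inverse_le) auto
          then have "\<not> infdist x K < rcp n" using N by linarith
          then show "x \<notin> U n" unfolding U_def by blast
        qed
        then have "eventually (\<lambda>n. \<phi> n x = 0) sequentially"
          using eventually_sequentially by blast
        then show ?thesis using xK by (simp add: tendsto_eventually)
      qed
      then show "(\<lambda>n. w x * \<phi> n x) \<longlonglongrightarrow> w x * indicat_real K x"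
        by (intro tendsto_intros)
    qed
    show "AE x in ?M. norm (w x * \<phi> n x) \<le> norm (w x * indicat_real (cball 0 (R+1)) x)" for n
    proof (intro AE_I2 le \<phi>(2))
      fix x :: "real^'n" assume "x \<notin> cball 0 (R+1)"
      then show "\<phi> n x = 0" using UR[of n] by (intro \<phi>z) blast
    qed
  qed (auto intro!: borel_measurable_times im)
  moreover have "0 \<le> (LINT x|?M. w x * \<phi> n x)" for n
  proof (rule pos)
    show "test_fun S (\<phi> n)" using \<phi>(1)[of n] by (auto simp: test_fun_def U_def)
  qed (use \<phi>(2) in auto)
  ultimately have ge: "0 \<le> (LINT x|?M. w x * indicat_real K x)"
    by (intro LIMSEQ_le_const) auto
  have int: "integrable ?M (\<lambda>x. - (w x * indicat_real K x))"
  proof (rule Bochner_Integration.integrable_bound[OF dom])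
    show "(\<lambda>x. - (w x * indicat_real K x)) \<in> borel_measurable ?M"
      using im[OF Kb] by measurable
    have "norm (w x * indicat_real K x) \<le> norm (w x * indicat_real (cball 0 (R+1)) x)" for x
      using R[of x] by (intro le) (auto simp: indicator_def)
    then show "AE x in ?M. norm (- (w x * indicat_real K x)) \<le> norm (norm (w x * indicat_real (cball 0 (R+1)) x))"
      by simp
  qed
  have "AE x in ?M. - (w x * indicat_real K x) = 0"
  proof (subst integral_nonneg_eq_0_iff_AE[symmetric, OF int])
    show "AE x in ?M. 0 \<le> - (w x * indicat_real K x)"
      using neg by (auto simp: indicator_def less_imp_le)
    then have "0 \<le> (LINT x|?M. - (w x * indicat_real K x))" by (rule integral_nonneg_AE)
    then show "(LINT x|?M. - (w x * indicat_real K x)) = 0" using ge by simp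
  qed
  then have "AE x in ?M. x \<notin> K"
    by eventually_elim (use neg in force)
  then have "AE x in lebesgue. x \<in> S \<longrightarrow> x \<notin> K"
    by (subst (asm) AE_restrict_space_iff) auto
  then have "AE x in lebesgue. x \<notin> K" using K(2) by (auto elim: eventually_mono)
  moreover have "K \<in> sets lebesgue" using Kb by simp
  ultimately show ?thesis
    by (simp only: AE_iff_null_sets)
qed simp

text \<open>Inner regularity reduces the set where w is negative to closed, then to compact subsets.
  The one-sided form is the one that a monotonicity statement can feed.\<close>

lemma fundamental_lemma_nonneg:
  fixes w :: "real^'n \<Rightarrow> real"
  assumes S: "open S" and w: "sqint (lebesgue_on S) w"
    and pos: "\<And>\<phi>. test_fun S \<phi> \<Longrightarrow> (\<And>x. \<phi> x \<ge> 0) \<Longrightarrow> 0 \<le> (LINT x|lebesgue_on S. w x * \<phi> x)"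
  shows "AE x in lebesgue_on S. w x \<ge> 0"
proof -
  have wm [measurable]: "w \<in> borel_measurable (lebesgue_on S)" using w by (rule sqint_measurable)
  have Sb: "S \<in> sets lebesgue" using S by simp
  define A where "A = {x\<in>space (lebesgue_on S). w x < 0}"
  have "A \<in> sets (lebesgue_on S)" unfolding A_def by measurable
  then have AL: "A \<in> sets lebesgue" using Sb by (simp add: sets_restrict_space_iff)
  have AS: "A \<subseteq> S" "\<And>x. x \<in> A \<Longrightarrow> w x < 0" unfolding A_def by auto
  have small: "emeasure lebesgue A \<le> ennreal e" if e: "e > 0" for e
  proof -
    \<comment> \<open>T is a countable union of compact null sets, so removing it keeps the measure
      of A, which is thereby below every e.\<close>
    obtain T where T: "closed T" "T \<subseteq> A" "A - T \<in> lmeasurable" "emeasure lebesgue (A - T) < ennreal e"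
      using sets_lebesgue_inner_closed[OF AL e] by metis
    have "(\<Union>m::nat. T \<inter> cball 0 (real m)) \<in> null_sets lebesgue"
    proof (rule null_sets_UN)
      fix m :: nat
      show "T \<inter> cball 0 (real m) \<in> null_sets lebesgue"
        by (rule fundamental_lemma_compact[OF S w pos])
          (use T AS in \<open>auto intro: closed_Int_compact\<close>)
    qed
    moreover have "(\<Union>m::nat. T \<inter> cball 0 (real m)) = T"
      using real_arch_simple by auto
    ultimately have "T \<in> null_sets lebesgue" by simp
    then have "emeasure lebesgue (A - T) = emeasure lebesgue A"
      by (rule emeasure_Diff_null_set) (rule AL)
    with T(4) show ?thesis by simp
  qed
  have "emeasure lebesgue A = 0"
  proof (rule ccontr)
    assume ne: "emeasure lebesgue A \<noteq> 0"
    have "emeasure lebesgue A \<le> 0 + ennreal e" if "e > 0" for e :: real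
      using small[OF that] by simp
    then have "emeasure lebesgue A \<le> 0" by (rule ennreal_le_epsilon)
    with ne show False by simp
  qed
  then have "A \<in> null_sets lebesgue" using AL by auto
  then have "AE x in lebesgue. x \<notin> A" by (rule AE_not_in)
  then show ?thesis
    using Sb by (subst AE_restrict_space_iff) (auto simp: A_def elim!: eventually_mono)
qed

lemma fundamental_lemma:
  fixes w :: "real^'n \<Rightarrow> complex"
  assumes S: "open S" and w: "sqint (lebesgue_on S) w"
    and z: "\<And>\<phi>. test_fun S \<phi> \<Longrightarrow> (LINT x|lebesgue_on S. w x * complex_of_real (\<phi> x)) = 0"
  shows "AE x in lebesgue_on S. w x = 0"
proof -
  have Sb: "S \<in> sets borel" using S by simp
  have int: "integrable (lebesgue_on S) (\<lambda>x. w x * complex_of_real (\<phi> x))" if "test_fun S \<phi>" for \<phi>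
    by (intro sqint_mult_integrable w sqint_of_real C1c_sqint[OF test_fun_C1c[OF that] Sb])
  have re: "(LINT x|lebesgue_on S. Re (w x) * \<phi> x) = 0" if "test_fun S \<phi>" for \<phi>
    using integral_Re[OF int[OF that]] z[OF that] by simp
  have im: "(LINT x|lebesgue_on S. Im (w x) * \<phi> x) = 0" if "test_fun S \<phi>" for \<phi>
    using integral_Im[OF int[OF that]] z[OF that] by simp
  have "AE x in lebesgue_on S. Re (w x) \<ge> 0" "AE x in lebesgue_on S. - Re (w x) \<ge> 0"
       "AE x in lebesgue_on S. Im (w x) \<ge> 0" "AE x in lebesgue_on S. - Im (w x) \<ge> 0"
    by (rule fundamental_lemma_nonneg[OF S];
        (intro sqint_Re sqint_Im sqint_minus w)?; simp add: re im)+
  then show ?thesis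
    by eventually_elim (auto simp: complex_eq_iff)
qed

subsection \<open>Weak derivatives and Sobolev spaces\<close>

lemma L2_iff_sqint: "L2 S u \<longleftrightarrow> sqint (lebesgue_on S) u"
  by (simp add: L2_def L2w_def sqint_def)

lemma test_fun_sqint:
  assumes "test_fun S \<phi>" "open S"
  shows "sqint (lebesgue_on S) (\<lambda>x. complex_of_real (\<phi> x))"
    and "sqint (lebesgue_on S) (\<lambda>x. complex_of_real (pd \<phi> i x))"
  using assms by (auto intro!: sqint_of_real C1c_sqint C1c_sqint_pd test_fun_C1c)

lemma weak_partial_lincomb:
  assumes S: "open S" and s: "sqint (lebesgue_on S) u" "sqint (lebesgue_on S) v"
      "sqint (lebesgue_on S) u'" "sqint (lebesgue_on S) v'"
    and "weak_partial S u i u'" "weak_partial S v i v'"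
  shows "weak_partial S (\<lambda>x. u x + c * v x) i (\<lambda>x. u' x + c * v' x)"
  unfolding weak_partial_def
proof (intro allI impI)
  fix \<phi> assume t: "test_fun S \<phi>"
  note ts = test_fun_sqint[OF t S]
  have lin: "(LINT x|lebesgue_on S. (a x + c * b x) * d x)
     = (LINT x|lebesgue_on S. a x * d x) + c * (LINT x|lebesgue_on S. b x * d x)"
    if "sqint (lebesgue_on S) a" "sqint (lebesgue_on S) b" "sqint (lebesgue_on S) d" for a b d
    using sqint_mult_integrable[OF that(1,3)] sqint_mult_integrable[OF that(2,3)]
    by (simp add: distrib_right mult.assoc)
  show "(LINT x|lebesgue_on S. (u x + c * v x) * complex_of_real (pd \<phi> i x)) =
         - (LINT x|lebesgue_on S. (u' x + c * v' x) * complex_of_real (\<phi> x))"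
    using assms(6,7) t unfolding weak_partial_def
    by (simp add: lin s ts)
qed

lemma weak_partial_unique:
  assumes S: "open S" and s: "sqint (lebesgue_on S) u'" "sqint (lebesgue_on S) v'"
    and "weak_partial S u i u'" "weak_partial S u i v'"
  shows "AE x in lebesgue_on S. u' x = v' x"
proof -
  have "AE x in lebesgue_on S. u' x - v' x = 0"
  proof (rule fundamental_lemma[OF S sqint_diff[OF s]])
    fix \<phi> assume t: "test_fun S \<phi>"
    note ts = test_fun_sqint[OF t S]
    show "(LINT x|lebesgue_on S. (u' x - v' x) * complex_of_real (\<phi> x)) = 0"
      using sqint_mult_integrable[OF s(1) ts(1)] sqint_mult_integrable[OF s(2) ts(1)] assms(4,5) t
      unfolding weak_partial_def by (simp add: left_diff_distrib)
  qed
  then show ?thesis by eventually_elim simp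
qed

lemma weak_partial_limit:
  assumes S: "open S" and s: "\<And>n. sqint (lebesgue_on S) (s n)" "\<And>n. sqint (lebesgue_on S) (s' n)"
      "sqint (lebesgue_on S) u" "sqint (lebesgue_on S) u'"
    and w: "\<And>n. weak_partial S (s n) i (s' n)"
    and l: "(\<lambda>n. nrm2 (lebesgue_on S) (\<lambda>x. s n x - u x)) \<longlonglongrightarrow> 0"
      "(\<lambda>n. nrm2 (lebesgue_on S) (\<lambda>x. s' n x - u' x)) \<longlonglongrightarrow> 0"
  shows "weak_partial S u i u'"
  unfolding weak_partial_def
proof (intro allI impI)
  fix \<phi> assume t: "test_fun S \<phi>"
  note ts = test_fun_sqint[OF t S]
  have "(\<lambda>n. LINT x|lebesgue_on S. s n x * complex_of_real (pd \<phi> i x))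
      \<longlonglongrightarrow> (LINT x|lebesgue_on S. u x * complex_of_real (pd \<phi> i x))"
    by (rule tendsto_integral_mult[OF s(3,1) l(1) ts(2)])
  moreover have "(\<lambda>n. - (LINT x|lebesgue_on S. s' n x * complex_of_real (\<phi> x)))
      \<longlonglongrightarrow> - (LINT x|lebesgue_on S. u' x * complex_of_real (\<phi> x))"
    by (intro tendsto_minus tendsto_integral_mult[OF s(4,2) l(2) ts(1)])
  moreover have "(LINT x|lebesgue_on S. s n x * complex_of_real (pd \<phi> i x))
      = - (LINT x|lebesgue_on S. s' n x * complex_of_real (\<phi> x))" for n
    using w[of n] t unfolding weak_partial_def by blast
  ultimately show "(LINT x|lebesgue_on S. u x * complex_of_real (pd \<phi> i x))
      = - (LINT x|lebesgue_on S. u' x * complex_of_real (\<phi> x))"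
    using LIMSEQ_unique by force
qed

text \<open>The product with a test function has compact support inside S, so its derivative
  integrates to zero over the whole space and the product rule gives the identity. Values of f at
  the boundary of S never enter.\<close>

lemma weak_partial_C1fun:
  fixes f :: "real^'n \<Rightarrow> complex"
  assumes S: "open S" and f: "C1fun f"
  shows "weak_partial S f i (pd f i)"
  unfolding weak_partial_def
proof (intro allI impI)
  fix \<phi> assume t: "test_fun S \<phi>"
  define \<eta> where "\<eta> x = complex_of_real (\<phi> x)" for x
  have \<phi>1: "C1c \<phi>" using t by (rule test_fun_C1c)
  have \<eta>1: "C1c \<eta>" unfolding \<eta>_def by (rule C1c_linear[OF bounded_linear_of_real \<phi>1])
  have pd\<eta>: "pd \<eta> i x = complex_of_real (pd \<phi> i x)" for x
    unfolding \<eta>_def by (rule pd_linear[OF bounded_linear_of_real C1fun_differentiable[OF C1c_C1fun[OF \<phi>1]]])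
  note c = C1fun_continuous[OF f] C1fun_continuous_pd[OF f]
    C1fun_continuous[OF C1c_C1fun[OF \<eta>1]] C1fun_continuous_pd[OF C1c_C1fun[OF \<eta>1]]
  let ?K = "supp_closure \<eta>"
  have K: "compact ?K" using \<eta>1 by (simp add: C1c_def)
  have "?K \<subseteq> S"
    using t by (auto simp: test_fun_def supp_closure_def \<eta>_def)
  then have z: "\<eta> x = 0" "pd \<eta> i x = 0" if "x \<notin> S" for x
    using that by (auto intro!: supp_closure_zero pd_supp_closure_zero)
  have int: "integrable lborel (\<lambda>x. f x * pd \<eta> i x)" "integrable lborel (\<lambda>x. pd f i x * \<eta> x)"
    by (rule integrable_continuous_compact_support[OF _ K]; 
        auto intro!: continuous_on_mult c simp: supp_closure_zero pd_supp_closure_zero)+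
  have p: "pd (\<lambda>x. f x * \<eta> x) i x = f x * pd \<eta> i x + pd f i x * \<eta> x" for x
    by (intro pd_mult C1fun_differentiable f C1c_C1fun \<eta>1)
  have "(LINT x|lborel. f x * pd \<eta> i x) + (LINT x|lborel. pd f i x * \<eta> x) = 0"
    using integral_pd_C1c[OF C1c_mult_left[OF \<eta>1 f], of i] int by (simp add: p)
  moreover have "(LINT x|lebesgue_on S. f x * pd \<eta> i x) = (LINT x|lborel. f x * pd \<eta> i x)"
    "(LINT x|lebesgue_on S. pd f i x * \<eta> x) = (LINT x|lborel. pd f i x * \<eta> x)"
    by (subst integral_lebesgue_on_borel; use int S in \<open>auto intro!: Lint_cong simp: z indicator_def\<close>)+
  ultimately show "(LINT x|lebesgue_on S. f x * complex_of_real (pd \<phi> i x)) =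
         - (LINT x|lebesgue_on S. pd f i x * complex_of_real (\<phi> x))"
    by (simp add: pd\<eta> \<eta>_def add_eq_0_iff2)
qed

lemma H1_sqint: "H1 S u \<Longrightarrow> sqint (lebesgue_on S) u"
  by (simp add: H1_def L2_iff_sqint)

lemma
  assumes "H1 S u"
  shows H1_sqint_wd: "sqint (lebesgue_on S) (wd S u i)" and H1_weak_partial_wd: "weak_partial S u i (wd S u i)"
proof -
  have "\<exists>v. L2 S v \<and> weak_partial S u i v" using assms by (simp add: H1_def)
  from someI_ex[OF this]
  show "sqint (lebesgue_on S) (wd S u i)" "weak_partial S u i (wd S u i)"
    unfolding wd_def L2_iff_sqint by auto
qed

text \<open>\<open>wd\<close> is picked by \<open>SOME\<close>, so nothing about it can be computed
  pointwise; every later identity for it is obtained almost everywhere through this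
  uniqueness.\<close>

lemma wd_unique:
  assumes "open S" "H1 S u" "sqint (lebesgue_on S) v" "weak_partial S u i v"
  shows "AE x in lebesgue_on S. wd S u i x = v x"
  by (rule weak_partial_unique[OF assms(1) H1_sqint_wd[OF assms(2)] assms(3) H1_weak_partial_wd[OF assms(2)] assms(4)])

lemma H1I:
  assumes "sqint (lebesgue_on S) u" "\<And>i. sqint (lebesgue_on S) (v i)" "\<And>i. weak_partial S u i (v i)"
  shows "H1 S u"
  using assms by (auto simp: H1_def L2_iff_sqint)

lemma
  assumes S: "open S" and u: "H1 S u" and v: "H1 S v"
  shows H1_lincomb: "H1 S (\<lambda>x. u x + c * v x)"
    and wd_lincomb: "AE x in lebesgue_on S. wd S (\<lambda>x. u x + c * v x) i x = wd S u i x + c * wd S v i x"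
proof -
  have s: "sqint (lebesgue_on S) (\<lambda>x. wd S u i x + c * wd S v i x)" for i
    by (intro sqint_add sqint_cmult H1_sqint_wd u v)
  have w: "weak_partial S (\<lambda>x. u x + c * v x) i (\<lambda>x. wd S u i x + c * wd S v i x)" for i
    by (intro weak_partial_lincomb S H1_sqint H1_sqint_wd H1_weak_partial_wd u v)
  show *: "H1 S (\<lambda>x. u x + c * v x)"
    by (rule H1I[OF _ s w]) (intro sqint_add sqint_cmult H1_sqint u v)
  show "AE x in lebesgue_on S. wd S (\<lambda>x. u x + c * v x) i x = wd S u i x + c * wd S v i x"
    by (rule wd_unique[OF S * s w])
qed

lemma
  assumes S: "open S" and u: "H1 S u" and v: "H1 S v"
  shows H1_diff: "H1 S (\<lambda>x. u x - v x)"
    and wd_diff: "AE x in lebesgue_on S. wd S (\<lambda>x. u x - v x) i x = wd S u i x - wd S v i x"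
  using H1_lincomb[OF assms, of "-1"] wd_lincomb[OF assms, of "-1" i] by auto

lemma
  fixes f :: "real^'n \<Rightarrow> complex"
  assumes S: "open S" and f: "C1c f"
  shows C1c_H1: "H1 S f" and wd_C1c: "AE x in lebesgue_on S. wd S f i x = pd f i x"
proof -
  have Sb: "S \<in> sets borel" using S by simp
  show *: "H1 S f"
    by (rule H1I[OF C1c_sqint[OF f Sb] C1c_sqint_pd[OF f Sb] weak_partial_C1fun[OF S C1c_C1fun[OF f]]])
  show "AE x in lebesgue_on S. wd S f i x = pd f i x"
    by (rule wd_unique[OF S * C1c_sqint_pd[OF f Sb] weak_partial_C1fun[OF S C1c_C1fun[OF f]]])
qed

section \<open>The squared H^1 norm\<close>

lemma H1_norm_sq_nrm2:
  "H1_norm_sq S u = (nrm2 (lebesgue_on S) u)\<^sup>2 + (\<Sum>i\<in>UNIV. (nrm2 (lebesgue_on S) (wd S u i))\<^sup>2)"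
  by (simp add: H1_norm_sq_def nrm2_sq)

lemma H1_norm_sq_ge0: "H1_norm_sq S u \<ge> 0"
  by (simp add: H1_norm_sq_nrm2 sum_nonneg)

lemma nrm2_le_H1_norm: "(nrm2 (lebesgue_on S) u)\<^sup>2 \<le> H1_norm_sq S u"
  by (simp add: H1_norm_sq_nrm2 sum_nonneg)

lemma nrm2_wd_le_H1_norm: "(nrm2 (lebesgue_on S) (wd S u i))\<^sup>2 \<le> H1_norm_sq S u"
proof -
  have "(nrm2 (lebesgue_on S) (wd S u i))\<^sup>2 \<le> (\<Sum>i\<in>UNIV. (nrm2 (lebesgue_on S) (wd S u i))\<^sup>2)"
    by (rule member_le_sum) auto
  then show ?thesis by (simp add: H1_norm_sq_nrm2 add_increasing)
qed

text \<open>From (a + b)^2 \<le> 2 a^2 + 2 b^2 in each component. The constant 2 is harmless in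
  approximation arguments and spares taking roots of the squared norm.\<close>

lemma H1_norm_sq_lincomb_le:
  fixes u :: "real^'n \<Rightarrow> complex"
  assumes S: "open S" and u: "H1 S u" and v: "H1 S v"
  shows "H1_norm_sq S (\<lambda>x. u x + c * v x) \<le> 2 * H1_norm_sq S u + 2 * (cmod c)\<^sup>2 * H1_norm_sq S v"
proof -
  let ?N = "nrm2 (lebesgue_on S)"
  have *: "(?N (\<lambda>x. a x + c * b x))\<^sup>2 \<le> 2 * (?N a)\<^sup>2 + 2 * (cmod c)\<^sup>2 * (?N b)\<^sup>2"
    if "sqint (lebesgue_on S) a" "sqint (lebesgue_on S) b" for a b
  proof -
    have "?N (\<lambda>x. a x + c * b x) \<le> ?N a + cmod c * ?N b"
      using nrm2_add_le[OF that(1) sqint_cmult[OF that(2)], of c] by (simp add: nrm2_cmult)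
    then have "(?N (\<lambda>x. a x + c * b x))\<^sup>2 \<le> (?N a + cmod c * ?N b)\<^sup>2"
      by (intro power_mono) auto
    also have "\<dots> \<le> 2 * (?N a)\<^sup>2 + 2 * (cmod c)\<^sup>2 * (?N b)\<^sup>2"
      using sum_squares_bound[of "?N a" "cmod c * ?N b"] by (simp add: power2_sum power_mult_distrib)
    finally show ?thesis .
  qed
  have wdeq: "?N (wd S (\<lambda>x. u x + c * v x) i) = ?N (\<lambda>x. wd S u i x + c * wd S v i x)" for i
    by (rule nrm2_cong_AE[OF _ _ wd_lincomb[OF assms]])
      (intro sqint_measurable sqint_add sqint_cmult H1_sqint_wd H1_lincomb assms)+
  have "H1_norm_sq S (\<lambda>x. u x + c * v x) \<le> (2 * (?N u)\<^sup>2 + 2 * (cmod c)\<^sup>2 * (?N v)\<^sup>2)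
    + (\<Sum>i\<in>UNIV. 2 * (?N (wd S u i))\<^sup>2 + 2 * (cmod c)\<^sup>2 * (?N (wd S v i))\<^sup>2)"
    unfolding H1_norm_sq_nrm2 wdeq
    by (intro add_mono sum_mono * H1_sqint H1_sqint_wd u v)
  also have "\<dots> = 2 * H1_norm_sq S u + 2 * (cmod c)\<^sup>2 * H1_norm_sq S v"
    by (simp add: H1_norm_sq_nrm2 sum.distrib sum_distrib_left algebra_simps)
  finally show ?thesis .
qed

lemma H1_norm_sq_triangle:
  fixes u :: "real^'n \<Rightarrow> complex"
  assumes S: "open S" and "H1 S u" "H1 S v" "H1 S w"
  shows "H1_norm_sq S (\<lambda>x. u x - w x) \<le> 2 * H1_norm_sq S (\<lambda>x. u x - v x) + 2 * H1_norm_sq S (\<lambda>x. v x - w x)"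
  using H1_norm_sq_lincomb_le[OF S H1_diff[OF S assms(2,3)] H1_diff[OF S assms(3,4)], of 1] by simp

lemma H1_norm_sq_zero: assumes "open S" shows "H1_norm_sq S (\<lambda>x. 0) = 0"
proof -
  have c: "C1c (\<lambda>x::real^'a. 0::complex)" by (rule C1cI[where K="{}"]) auto
  have "nrm2 (lebesgue_on S) (wd S (\<lambda>x. 0) i) = nrm2 (lebesgue_on S) (\<lambda>x. 0::complex)" for i
    by (rule nrm2_cong_AE) (use wd_C1c[OF assms c, of i] H1_sqint_wd[OF C1c_H1[OF assms c], of i] in \<open>auto dest: sqint_measurable\<close>)
  then show ?thesis by (simp add: H1_norm_sq_nrm2) (simp add: nrm2_def)
qed

section \<open>The form domain and its completeness\<close>

definition near_zero :: "(real^'n) set \<Rightarrow> (real^'n \<Rightarrow> 'b::zero) \<Rightarrow> bool" where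
  "near_zero \<Gamma> \<phi> \<longleftrightarrow> (\<exists>U. open U \<and> \<Gamma> \<subseteq> U \<and> (\<forall>x\<in>U. \<phi> x = 0))"

lemma H1_vanish_iff:
  "u \<in> H1_vanish S \<Gamma> \<longleftrightarrow> H1 S u \<and> (\<forall>e>0. \<exists>\<phi>. C1c \<phi> \<and> near_zero \<Gamma> \<phi> \<and> H1_norm_sq S (\<lambda>x. u x - \<phi> x) < e)"
  by (simp add: H1_vanish_def C1c_def near_zero_def conj_assoc)

lemma H1_vanish_H1: "u \<in> H1_vanish S \<Gamma> \<Longrightarrow> H1 S u"
  by (simp add: H1_vanish_iff)

lemma C1c_H1_vanish:
  assumes "open S" "C1c \<phi>" "near_zero \<Gamma> \<phi>" shows "\<phi> \<in> H1_vanish S \<Gamma>"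
  unfolding H1_vanish_iff
proof (intro conjI allI impI C1c_H1 assms)
  fix e :: real assume "e > 0"
  then show "\<exists>\<phi>'. C1c \<phi>' \<and> near_zero \<Gamma> \<phi>' \<and> H1_norm_sq S (\<lambda>x. \<phi> x - \<phi>' x) < e"
    by (intro exI[of _ \<phi>]) (simp add: assms H1_norm_sq_zero)
qed

lemma H1_vanish_zero: "open S \<Longrightarrow> (\<lambda>x. 0) \<in> H1_vanish S \<Gamma>"
  by (rule C1c_H1_vanish) (auto simp: near_zero_def intro!: C1cI[where K="{}"] exI[of _ UNIV])

lemma near_zero_lincomb:
  fixes \<phi> \<phi>' :: "real^'n \<Rightarrow> complex"
  assumes "near_zero \<Gamma> \<phi>" "near_zero \<Gamma> \<phi>'" shows "near_zero \<Gamma> (\<lambda>x. \<phi> x + c * \<phi>' x)"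
proof -
  obtain U V where "open U" "\<Gamma> \<subseteq> U" "\<forall>x\<in>U. \<phi> x = 0" "open V" "\<Gamma> \<subseteq> V" "\<forall>x\<in>V. \<phi>' x = 0"
    using assms by (auto simp: near_zero_def)
  then show ?thesis unfolding near_zero_def by (intro exI[of _ "U \<inter> V"]) auto
qed

lemma C1c_lincomb:
  fixes \<phi> \<phi>' :: "real^'n \<Rightarrow> complex"
  assumes "C1c \<phi>" "C1c \<phi>'" shows "C1c (\<lambda>x. \<phi> x + c * \<phi>' x)"
  by (intro C1c_add C1c_mult_left assms) simp

lemma H1_vanish_lincomb:
  assumes S: "open S" and u: "u \<in> H1_vanish S \<Gamma>" and v: "v \<in> H1_vanish S \<Gamma>"
  shows "(\<lambda>x. u x + c * v x) \<in> H1_vanish S \<Gamma>"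
  unfolding H1_vanish_iff
proof (intro conjI allI impI)
  note H = u[THEN H1_vanish_H1] v[THEN H1_vanish_H1]
  show "H1 S (\<lambda>x. u x + c * v x)" by (rule H1_lincomb[OF S H])
  fix e :: real assume e: "e > 0"
  then obtain \<phi> where \<phi>: "C1c \<phi>" "near_zero \<Gamma> \<phi>" "H1_norm_sq S (\<lambda>x. u x - \<phi> x) < e / 4"
    using u unfolding H1_vanish_iff by (meson zero_less_divide_iff zero_less_numeral)
  \<comment> \<open>The summand 1 keeps the tolerance meaningful for c = 0; after the factor 2 (cmod
    c)^2 less than e / 2 remains.\<close>
  have "e / (4 * ((cmod c)\<^sup>2 + 1)) > 0" using e by (simp add: add_nonneg_pos)
  then obtain \<phi>' where \<phi>': "C1c \<phi>'" "near_zero \<Gamma> \<phi>'" "H1_norm_sq S (\<lambda>x. v x - \<phi>' x) < e / (4 * ((cmod c)\<^sup>2 + 1))"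
    using v unfolding H1_vanish_iff by meson
  have "H1_norm_sq S (\<lambda>x. (u x + c * v x) - (\<phi> x + c * \<phi>' x))
      = H1_norm_sq S (\<lambda>x. (u x - \<phi> x) + c * (v x - \<phi>' x))"
    by (simp add: algebra_simps)
  also have "\<dots> \<le> 2 * H1_norm_sq S (\<lambda>x. u x - \<phi> x) + 2 * (cmod c)\<^sup>2 * H1_norm_sq S (\<lambda>x. v x - \<phi>' x)"
    by (intro H1_norm_sq_lincomb_le S H1_diff H C1c_H1 \<phi> \<phi>')
  also have "\<dots> < e"
  proof -
    have "2 * (cmod c)\<^sup>2 * H1_norm_sq S (\<lambda>x. v x - \<phi>' x) \<le> 2 * ((cmod c)\<^sup>2 + 1) * H1_norm_sq S (\<lambda>x. v x - \<phi>' x)"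
      by (intro mult_right_mono H1_norm_sq_ge0) auto
    also have "\<dots> < e / 2"
    proof -
      have p: "(cmod c)\<^sup>2 + 1 > 0" by (simp add: add_nonneg_pos)
      show ?thesis using \<phi>'(3) p by (simp add: field_simps)
    qed
    finally show ?thesis using \<phi>(3) by simp
  qed
  finally show "\<exists>\<phi>. C1c \<phi> \<and> near_zero \<Gamma> \<phi> \<and> H1_norm_sq S (\<lambda>x. u x + c * v x - \<phi> x) < e"
    using C1c_lincomb[OF \<phi>(1) \<phi>'(1)] near_zero_lincomb[OF \<phi>(2) \<phi>'(2)] by blast
qed

lemma H1_vanish_closed:
  assumes S: "open S" and u: "H1 S u" and a: "\<And>e. e > 0 \<Longrightarrow> \<exists>w\<in>H1_vanish S \<Gamma>. H1_norm_sq S (\<lambda>x. u x - w x) < e"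
  shows "u \<in> H1_vanish S \<Gamma>"
  unfolding H1_vanish_iff
proof (intro conjI allI impI u)
  fix e :: real assume e: "e > 0"
  then obtain w where w: "w \<in> H1_vanish S \<Gamma>" "H1_norm_sq S (\<lambda>x. u x - w x) < e / 4"
    using a[of "e/4"] by auto
  moreover obtain \<phi> where \<phi>: "C1c \<phi>" "near_zero \<Gamma> \<phi>" "H1_norm_sq S (\<lambda>x. w x - \<phi> x) < e / 4"
    using w(1) e unfolding H1_vanish_iff by (meson zero_less_divide_iff zero_less_numeral)
  ultimately show "\<exists>\<phi>. C1c \<phi> \<and> near_zero \<Gamma> \<phi> \<and> H1_norm_sq S (\<lambda>x. u x - \<phi> x) < e"
    using H1_norm_sq_triangle[OF S u H1_vanish_H1[OF w(1)] C1c_H1[OF S \<phi>(1)]]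
    by (intro exI[of _ \<phi>]) auto
qed

text \<open>The functions and each of their weak derivatives converge separately in L^2; passing to
  the limit in the test identity shows that the limits belong together. Closedness then preserves
  the boundary condition.\<close>

lemma H1_vanish_complete:
  fixes s :: "nat \<Rightarrow> real^'n \<Rightarrow> complex"
  assumes S: "open S" and s: "\<And>n. s n \<in> H1_vanish S \<Gamma>"
    and c: "\<And>e. e > 0 \<Longrightarrow> \<exists>N. \<forall>m\<ge>N. \<forall>n\<ge>N. H1_norm_sq S (\<lambda>x. s m x - s n x) < e"
  obtains u where "u \<in> H1_vanish S \<Gamma>" "(\<lambda>n. H1_norm_sq S (\<lambda>x. s n x - u x)) \<longlonglongrightarrow> 0"
proof -
  let ?M = "lebesgue_on S"
  note H = s[THEN H1_vanish_H1]
  have wdd: "nrm2 ?M (wd S (\<lambda>x. f x - g x) i) = nrm2 ?M (\<lambda>x. wd S f i x - wd S g i x)"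
    if "H1 S f" "H1 S g" for f g i
    by (rule nrm2_cong_AE[OF _ _ wd_diff[OF S that]])
      (intro sqint_measurable sqint_diff H1_sqint_wd H1_diff S that)+
  have c1: "\<exists>N. \<forall>m\<ge>N. \<forall>n\<ge>N. nrm2 ?M (\<lambda>x. s m x - s n x) < e" if "e > 0" for e
  proof -
    obtain N where N: "\<forall>m\<ge>N. \<forall>n\<ge>N. H1_norm_sq S (\<lambda>x. s m x - s n x) < e\<^sup>2"
      using c[OF zero_less_power[OF \<open>e > 0\<close>]] by blast
    have "nrm2 ?M (\<lambda>x. s m x - s n x) < e" if "m \<ge> N" "n \<ge> N" for m n
      by (rule power_less_imp_less_base[of _ 2])
        (rule le_less_trans[OF nrm2_le_H1_norm], use N that \<open>e > 0\<close> in auto)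
    then show ?thesis by blast
  qed
  have c2: "\<exists>N. \<forall>m\<ge>N. \<forall>n\<ge>N. nrm2 ?M (\<lambda>x. wd S (s m) i x - wd S (s n) i x) < e" if "e > 0" for e i
  proof -
    obtain N where N: "\<forall>m\<ge>N. \<forall>n\<ge>N. H1_norm_sq S (\<lambda>x. s m x - s n x) < e\<^sup>2"
      using c[OF zero_less_power[OF \<open>e > 0\<close>]] by blast
    have "nrm2 ?M (\<lambda>x. wd S (s m) i x - wd S (s n) i x) < e" if "m \<ge> N" "n \<ge> N" for m n
      unfolding wdd[OF H H, symmetric]
      by (rule power_less_imp_less_base[of _ 2])
        (rule le_less_trans[OF nrm2_wd_le_H1_norm], use N that \<open>e > 0\<close> in auto)
    then show ?thesis by blast
  qed
  obtain u where u: "sqint ?M u" "(\<lambda>n. nrm2 ?M (\<lambda>x. s n x - u x)) \<longlonglongrightarrow> 0"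
    by (rule L2_complete[OF H1_sqint[OF H] c1])
  have "\<exists>v. sqint ?M v \<and> (\<lambda>n. nrm2 ?M (\<lambda>x. wd S (s n) i x - v x)) \<longlonglongrightarrow> 0" for i
    by (rule L2_complete[of ?M "\<lambda>n. wd S (s n) i", OF H1_sqint_wd[OF H] c2], assumption) (intro exI conjI)
  then have "\<forall>i. \<exists>v. sqint ?M v \<and> (\<lambda>n. nrm2 ?M (\<lambda>x. wd S (s n) i x - v x)) \<longlonglongrightarrow> 0" by (rule allI)
  from choice[OF this] obtain v where
    v: "\<And>i. sqint ?M (v i)" "\<And>i. (\<lambda>n. nrm2 ?M (\<lambda>x. wd S (s n) i x - v i x)) \<longlonglongrightarrow> 0"
    by blast
  have wp: "weak_partial S u i (v i)" for i
    by (rule weak_partial_limit[OF S H1_sqint[OF H] H1_sqint_wd[OF H] u(1) v(1) H1_weak_partial_wd[OF H] u(2) v(2)])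
  have uH: "H1 S u" by (rule H1I[OF u(1) v(1) wp])
  have "nrm2 ?M (wd S (\<lambda>x. s n x - u x) i) = nrm2 ?M (\<lambda>x. wd S (s n) i x - v i x)" for n i
  proof (rule nrm2_cong_AE)
    show "AE x in ?M. wd S (\<lambda>x. s n x - u x) i x = wd S (s n) i x - v i x"
      using wd_diff[OF S H[of n] uH, of i] wd_unique[OF S uH v(1)[of i] wp[of i]]
      by eventually_elim simp
  qed (intro sqint_measurable sqint_diff H1_sqint_wd H1_diff S H uH v)+
  then have "H1_norm_sq S (\<lambda>x. s n x - u x) = (nrm2 ?M (\<lambda>x. s n x - u x))\<^sup>2
     + (\<Sum>i\<in>UNIV. (nrm2 ?M (\<lambda>x. wd S (s n) i x - v i x))\<^sup>2)" for n
    by (simp add: H1_norm_sq_nrm2)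
  moreover have "(\<lambda>n. (nrm2 ?M (\<lambda>x. s n x - u x))\<^sup>2
     + (\<Sum>i\<in>UNIV. (nrm2 ?M (\<lambda>x. wd S (s n) i x - v i x))\<^sup>2)) \<longlonglongrightarrow> 0\<^sup>2 + (\<Sum>i\<in>(UNIV::'n set). 0\<^sup>2)"
    by (intro tendsto_intros u v)
  ultimately have lim: "(\<lambda>n. H1_norm_sq S (\<lambda>x. s n x - u x)) \<longlonglongrightarrow> 0" by simp
  have "u \<in> H1_vanish S \<Gamma>"
  proof (rule H1_vanish_closed[OF S uH])
    fix e :: real assume e: "e > 0"
    then obtain n where n: "H1_norm_sq S (\<lambda>x. s n x - u x) < e / 2"
      using order_tendstoD(2)[OF lim, of "e/2"] by (auto simp: eventually_sequentially)
    \<comment> \<open>Swapping the two functions is treated as a linear combination with coefficient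
      -1, which costs the factor 2 provided for by e / 2.\<close>
    have "H1_norm_sq S (\<lambda>x. u x - s n x) = H1_norm_sq S (\<lambda>x. 0 + (-1) * (s n x - u x))"
      by simp
    also have "\<dots> \<le> 2 * H1_norm_sq S (\<lambda>x. 0) + 2 * (cmod (-1))\<^sup>2 * H1_norm_sq S (\<lambda>x. s n x - u x)"
      by (intro H1_norm_sq_lincomb_le S H1_diff H uH H1_vanish_H1[OF H1_vanish_zero])
    finally show "\<exists>w\<in>H1_vanish S \<Gamma>. H1_norm_sq S (\<lambda>x. u x - w x) < e"
      using s n by (intro bexI[of _ "s n"]) (auto simp: H1_norm_sq_zero[OF S])
  qed
  then show ?thesis using lim by (rule that)
qed

text \<open>Replaces the weak derivatives of the approximants, hidden in the H^1 norm as choices, by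
  classical ones, so that pointwise calculus applies to them.\<close>

lemma H1_vanish_approximation:
  assumes S: "open S" and u: "u \<in> H1_vanish S \<Gamma>"
  obtains q where "\<forall>n. C1c (q n) \<and> near_zero \<Gamma> (q n)"
    and "(\<lambda>n. nrm2 (lebesgue_on S) (\<lambda>x. q n x - u x)) \<longlonglongrightarrow> 0"
    and "\<forall>i. (\<lambda>n. nrm2 (lebesgue_on S) (\<lambda>x. pd (q n) i x - wd S u i x)) \<longlonglongrightarrow> 0"
proof -
  let ?M = "lebesgue_on S"
  have Sb: "S \<in> sets borel" using S by simp
  note uH = H1_vanish_H1[OF u]
  have "\<forall>n. \<exists>\<phi>. C1c \<phi> \<and> near_zero \<Gamma> \<phi> \<and> H1_norm_sq S (\<lambda>x. u x - \<phi> x) < rcp n"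
  proof
    fix n
    have "0 < rcp n" by simp
    with u show "\<exists>\<phi>. C1c \<phi> \<and> near_zero \<Gamma> \<phi> \<and> H1_norm_sq S (\<lambda>x. u x - \<phi> x) < rcp n"
      unfolding H1_vanish_iff by blast
  qed
  from choice[OF this] obtain q where q: "\<And>n. C1c (q n)" "\<And>n. near_zero \<Gamma> (q n)"
    "\<And>n. H1_norm_sq S (\<lambda>x. u x - q n x) < rcp n" by blast
  note qH = C1c_H1[OF S q(1)]
  have sqlim: "(\<lambda>n. sqrt (rcp n)) \<longlonglongrightarrow> 0"
    using tendsto_real_sqrt[OF LIMSEQ_inverse_real_of_nat] by simp
  have l0: "(\<lambda>n. nrm2 ?M (\<lambda>x. q n x - u x)) \<longlonglongrightarrow> 0"
  proof (rule Lim_null_comparison[OF always_eventually sqlim], rule allI)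
    show "norm (nrm2 ?M (\<lambda>x. q n x - u x)) \<le> sqrt (rcp n)" for n
      unfolding nrm2_minus_commute[of ?M "q n" u] real_norm_def abs_of_nonneg[OF nrm2_ge0]
      using nrm2_le_H1_norm[of S "\<lambda>x. u x - q n x"] q(3)[of n] by (intro real_le_rsqrt) linarith
  qed
  have l1: "(\<lambda>n. nrm2 ?M (\<lambda>x. pd (q n) i x - wd S u i x)) \<longlonglongrightarrow> 0" for i
  proof (rule Lim_null_comparison[OF always_eventually sqlim], rule allI)
    fix n
    have eq: "nrm2 ?M (\<lambda>x. wd S u i x - pd (q n) i x) = nrm2 ?M (wd S (\<lambda>x. u x - q n x) i)"
    proof (rule nrm2_cong_AE)
      show "AE x in ?M. wd S u i x - pd (q n) i x = wd S (\<lambda>x. u x - q n x) i x"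
        using wd_diff[OF S uH qH[of n], of i] wd_C1c[OF S q(1)[of n], of i] by eventually_elim simp
    qed (intro sqint_measurable sqint_diff H1_sqint_wd H1_diff uH qH C1c_sqint_pd q S Sb)+
    show "norm (nrm2 ?M (\<lambda>x. pd (q n) i x - wd S u i x)) \<le> sqrt (rcp n)"
      unfolding nrm2_minus_commute[of ?M "pd (q n) i"] eq real_norm_def abs_of_nonneg[OF nrm2_ge0]
      using nrm2_wd_le_H1_norm[of S "\<lambda>x. u x - q n x" i] q(3)[of n] by (intro real_le_rsqrt) linarith
  qed
  from q(1,2) l0 l1 show ?thesis by (intro that[of q]) auto
qed

subsection \<open>Riesz representation and a fixed point theorem\<close>

text \<open>An abstract real Hilbert space up to null vectors: B stands for the real part of a
  shifted sesquilinear form and is only semidefinite on functions. Real linearity of B is enough for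
  minimisation, while D is closed under complex scalars so that later a test function can be
  multiplied by i.\<close>

locale form_space =
  fixes D :: "('x \<Rightarrow> complex) set" and B :: "('x \<Rightarrow> complex) \<Rightarrow> ('x \<Rightarrow> complex) \<Rightarrow> real"
  assumes D_zero: "(\<lambda>x. 0) \<in> D"
    and D_lin: "u \<in> D \<Longrightarrow> v \<in> D \<Longrightarrow> (\<lambda>x. u x + c * v x) \<in> D"
    and B_sym: "u \<in> D \<Longrightarrow> v \<in> D \<Longrightarrow> B u v = B v u"
    and B_lin: "u \<in> D \<Longrightarrow> v \<in> D \<Longrightarrow> w \<in> D \<Longrightarrow>
        B (\<lambda>x. u x + complex_of_real r * v x) w = B u w + r * B v w"
    and B_nonneg: "u \<in> D \<Longrightarrow> B u u \<ge> 0"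
    and B_complete: "(\<And>n. s n \<in> D) \<Longrightarrow>
        (\<And>e. e > 0 \<Longrightarrow> \<exists>N. \<forall>m\<ge>N. \<forall>n\<ge>N. B (\<lambda>x. s m x - s n x) (\<lambda>x. s m x - s n x) < e) \<Longrightarrow>
        \<exists>u\<in>D. (\<lambda>n. B (\<lambda>x. s n x - u x) (\<lambda>x. s n x - u x)) \<longlonglongrightarrow> 0"
begin

definition fnorm :: "('x \<Rightarrow> complex) \<Rightarrow> real" where "fnorm u = sqrt (B u u)"

lemma D_diff: "u \<in> D \<Longrightarrow> v \<in> D \<Longrightarrow> (\<lambda>x. u x - v x) \<in> D"
  using D_lin[of u v "-1"] by simp

lemma D_add: "u \<in> D \<Longrightarrow> v \<in> D \<Longrightarrow> (\<lambda>x. u x + v x) \<in> D"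
  using D_lin[of u v 1] by simp

lemma B_diff: "u \<in> D \<Longrightarrow> v \<in> D \<Longrightarrow> w \<in> D \<Longrightarrow> B (\<lambda>x. u x - v x) w = B u w - B v w"
  using B_lin[of u v w "-1"] by simp

lemma B_lin_right: "u \<in> D \<Longrightarrow> v \<in> D \<Longrightarrow> w \<in> D \<Longrightarrow>
    B w (\<lambda>x. u x + complex_of_real r * v x) = B w u + r * B w v"
  by (simp add: B_sym[of w] B_lin D_lin)

lemma B_expand:
  assumes "u \<in> D" "v \<in> D"
  shows "B (\<lambda>x. u x + complex_of_real r * v x) (\<lambda>x. u x + complex_of_real r * v x)
    = B u u + 2 * r * B u v + r\<^sup>2 * B v v"
  using assms B_sym[of u v]
  by (simp add: B_lin B_lin_right D_lin power2_eq_square algebra_simps)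

lemma fnorm_ge0: "u \<in> D \<Longrightarrow> fnorm u \<ge> 0"
  by (simp add: fnorm_def B_nonneg)

lemma fnorm_sq: "u \<in> D \<Longrightarrow> (fnorm u)\<^sup>2 = B u u"
  by (simp add: fnorm_def B_nonneg)

lemma Cauchy_Schwarz:
  assumes "u \<in> D" "v \<in> D" shows "\<bar>B u v\<bar> \<le> fnorm u * fnorm v"
proof -
  have "(B u v)\<^sup>2 \<le> B u u * B v v"
  proof (rule square_le_of_quadratic_nonneg)
    show "0 \<le> B u u + 2 * t * B u v + t\<^sup>2 * B v v" for t
      using B_nonneg[OF D_lin[OF assms]] unfolding B_expand[OF assms, symmetric] .
  qed (use assms B_nonneg in auto)
  then have "sqrt ((B u v)\<^sup>2) \<le> sqrt (B u u * B v v)" by (rule real_sqrt_le_mono)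
  then show ?thesis by (simp add: fnorm_def real_sqrt_mult)
qed

lemma fnorm_triangle:
  assumes "u \<in> D" "v \<in> D" shows "fnorm (\<lambda>x. u x + v x) \<le> fnorm u + fnorm v"
proof (rule power2_le_imp_le)
  have "(fnorm (\<lambda>x. u x + v x))\<^sup>2 = B u u + 2 * B u v + B v v"
    using B_expand[OF assms, of 1] fnorm_sq[OF D_add[OF assms]] by simp
  also have "\<dots> \<le> (fnorm u)\<^sup>2 + 2 * (fnorm u * fnorm v) + (fnorm v)\<^sup>2"
    using Cauchy_Schwarz[OF assms] fnorm_sq[OF assms(1)] fnorm_sq[OF assms(2)] by linarith
  also have "\<dots> = (fnorm u + fnorm v)\<^sup>2" by (simp add: power2_sum)
  finally show "(fnorm (\<lambda>x. u x + v x))\<^sup>2 \<le> (fnorm u + fnorm v)\<^sup>2" .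
qed (use assms fnorm_ge0 in auto)

lemma fnorm_diff_triangle:
  assumes "u \<in> D" "v \<in> D" "w \<in> D"
  shows "fnorm (\<lambda>x. u x - w x) \<le> fnorm (\<lambda>x. u x - v x) + fnorm (\<lambda>x. v x - w x)"
  using fnorm_triangle[OF D_diff[OF assms(1,2)] D_diff[OF assms(2,3)]] by simp

lemma fnorm_diff_commute:
  assumes "u \<in> D" "v \<in> D" shows "fnorm (\<lambda>x. u x - v x) = fnorm (\<lambda>x. v x - u x)"
proof -
  have "B (\<lambda>x. u x - v x) (\<lambda>x. u x - v x) = B (\<lambda>x. v x - u x) (\<lambda>x. v x - u x)"
    using B_expand[OF assms, of "-1"] B_expand[OF assms(2,1), of "-1"] B_sym[OF assms] by simp
  then show ?thesis by (simp add: fnorm_def)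
qed

text \<open>The representing element minimises \<open>B u u - 2 * L u\<close>. The parallelogram
  identity makes a minimising sequence Cauchy, and at the minimum the first variation
  \<open>B u v - L v\<close> must vanish.\<close>

lemma Riesz_representation:
  assumes L_lin: "\<And>u v r. u \<in> D \<Longrightarrow> v \<in> D \<Longrightarrow> L (\<lambda>x. u x + complex_of_real r * v x) = L u + r * L v"
    and L_bdd: "\<And>u. u \<in> D \<Longrightarrow> \<bar>L u\<bar> \<le> C * fnorm u"
  shows "\<exists>u\<in>D. \<forall>v\<in>D. B u v = L v"
proof -
  define J where "J u = B u u - 2 * L u" for u
  have J_expand: "J (\<lambda>x. u x + complex_of_real r * v x) = J u + 2 * r * (B u v - L v) + r\<^sup>2 * B v v"
    if "u \<in> D" "v \<in> D" for u v r
    using that by (simp add: J_def B_expand L_lin algebra_simps)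
  have J_ge: "J u \<ge> - C\<^sup>2" if "u \<in> D" for u
  proof -
    have "0 \<le> (fnorm u - C)\<^sup>2" by simp
    then show ?thesis using L_bdd[OF that] fnorm_sq[OF that]
      by (simp add: J_def power2_diff mult.commute)
  qed
  define m where "m = Inf (J ` D)"
  have bdd: "bdd_below (J ` D)" using J_ge by (auto simp: bdd_below_def)
  have m_le: "m \<le> J u" if "u \<in> D" for u
    unfolding m_def using that bdd by (intro cInf_lower) auto
  have "\<exists>u\<in>D. J u < m + rcp n" for n
    using cInf_lessD[of "J ` D" "m + rcp n"] D_zero by (auto simp: m_def[symmetric])
  then obtain s where s: "\<And>n. s n \<in> D" "\<And>n. J (s n) < m + rcp n" by metis
  \<comment> \<open>J at the midpoint equals the mean of J u and J v minus a quarter of B (v - u) (v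
    - u); it is at least m, which bounds the last term.\<close>
  have para: "B (\<lambda>x. u x - v x) (\<lambda>x. u x - v x) \<le> 2 * (J u - m) + 2 * (J v - m)"
    if "u \<in> D" "v \<in> D" for u v
  proof -
    have d: "(\<lambda>x. v x - u x) \<in> D" by (intro D_diff that)
    have mid: "J (\<lambda>x. u x + complex_of_real (1/2) * (v x - u x)) \<ge> m"
      by (intro m_le D_lin that d)
    have v: "J v = J u + 2 * (B u (\<lambda>x. v x - u x) - L (\<lambda>x. v x - u x)) + B (\<lambda>x. v x - u x) (\<lambda>x. v x - u x)"
      using J_expand[OF that(1) d, of 1] by simp
    have "B (\<lambda>x. u x - v x) (\<lambda>x. u x - v x) = B (\<lambda>x. v x - u x) (\<lambda>x. v x - u x)"
      using fnorm_diff_commute[OF that] fnorm_sq[OF D_diff[OF that]] fnorm_sq[OF d] by simp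
    then show ?thesis using mid v J_expand[OF that(1) d, of "1/2"]
      by (simp add: power2_eq_square)
  qed
  have "\<exists>u\<in>D. (\<lambda>n. B (\<lambda>x. s n x - u x) (\<lambda>x. s n x - u x)) \<longlonglongrightarrow> 0"
  proof (rule B_complete[OF s(1)])
    fix e :: real assume "e > 0"
    then obtain N where N: "rcp N < e / 4"
      using reals_Archimedean[of "e/4"] by auto
    have J_less: "J (s n) - m < e / 4" if "n \<ge> N" for n
    proof -
      have "rcp n \<le> rcp N"
        using that by (intro le_imp_inverse_le) auto
      with N s(2)[of n] show ?thesis by linarith
    qed
    have "B (\<lambda>x. s j x - s n x) (\<lambda>x. s j x - s n x) < e" if "j \<ge> N" "n \<ge> N" for j n
    proof -
      have "B (\<lambda>x. s j x - s n x) (\<lambda>x. s j x - s n x) \<le> 2 * (J (s j) - m) + 2 * (J (s n) - m)"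
        by (rule para[OF s(1) s(1)])
      also have "\<dots> < 2 * (e / 4) + 2 * (e / 4)"
        by (intro add_strict_mono mult_strict_left_mono J_less that) auto
      finally show ?thesis by simp
    qed
    then show "\<exists>N. \<forall>m\<ge>N. \<forall>n\<ge>N. B (\<lambda>x. s m x - s n x) (\<lambda>x. s m x - s n x) < e" by blast
  qed
  then obtain u where u: "u \<in> D" "(\<lambda>n. B (\<lambda>x. s n x - u x) (\<lambda>x. s n x - u x)) \<longlonglongrightarrow> 0" by blast
  have plim: "(\<lambda>n. fnorm (\<lambda>x. s n x - u x)) \<longlonglongrightarrow> 0"
    using tendsto_real_sqrt[OF u(2)] by (simp add: fnorm_def)
  \<comment> \<open>J u differs from J (s n) by terms linear in s n - u, small by Cauchy-Schwarz and
    the bound on L, and by the term - B d d, which has the favourable sign.\<close>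
  have Ju: "J u \<le> m"
  proof (rule LIMSEQ_le)
    have "(\<lambda>n. m + rcp n + 2 * (fnorm u * fnorm (\<lambda>x. s n x - u x)) + 2 * (C * fnorm (\<lambda>x. s n x - u x)))
      \<longlonglongrightarrow> m + 0 + 2 * (fnorm u * 0) + 2 * (C * 0)"
      by (intro tendsto_intros plim LIMSEQ_inverse_real_of_nat)
    then show "(\<lambda>n. m + rcp n + 2 * (fnorm u * fnorm (\<lambda>x. s n x - u x)) + 2 * (C * fnorm (\<lambda>x. s n x - u x)))
      \<longlonglongrightarrow> m" by simp
    show "(\<lambda>n. J u) \<longlonglongrightarrow> J u" by simp
    have "J u \<le> m + rcp n + 2 * (fnorm u * fnorm (\<lambda>x. s n x - u x)) + 2 * (C * fnorm (\<lambda>x. s n x - u x))" for n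
    proof -
      define d where "d = (\<lambda>x. s n x - u x)"
      have d: "d \<in> D" unfolding d_def by (intro D_diff s u)
      have "J (s n) = J u + 2 * (B u d - L d) + B d d"
        using J_expand[OF u(1) d, of 1] by (simp add: d_def)
      then show ?thesis
        using s(2)[of n] Cauchy_Schwarz[OF u(1) d] L_bdd[OF d] B_nonneg[OF d]
        unfolding d_def[symmetric] right_diff_distrib by linarith
    qed
    then show "\<exists>N. \<forall>n\<ge>N. J u \<le> m + rcp n + 2 * (fnorm u * fnorm (\<lambda>x. s n x - u x)) + 2 * (C * fnorm (\<lambda>x. s n x - u x))"
      by blast
  qed
  have "B u v = L v" if v: "v \<in> D" for v
  proof -
    \<comment> \<open>The increment of J along v is a nonnegative quadratic in t with constant term
      zero, so its linear coefficient vanishes.\<close>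
    have "0 \<le> 0 + 2 * t * (B u v - L v) + t\<^sup>2 * B v v" for t
      using J_expand[OF u(1) v, of t] m_le[OF D_lin[OF u(1) v], of "complex_of_real t"] Ju by simp
    from square_le_of_quadratic_nonneg[OF this B_nonneg[OF v]] show ?thesis by simp
  qed
  then show ?thesis using u(1) by blast
qed

text \<open>Banach iteration for a seminorm. As functions at distance zero may differ, the
  conclusion is distance zero between u and its image rather than equality.\<close>

lemma contraction_fixed_point:
  assumes \<Phi>: "\<And>u. u \<in> D \<Longrightarrow> \<Phi> u \<in> D"
    and r: "0 \<le> r" "r < 1"
    and contr: "\<And>u v. u \<in> D \<Longrightarrow> v \<in> D \<Longrightarrow> fnorm (\<lambda>x. \<Phi> u x - \<Phi> v x) \<le> r * fnorm (\<lambda>x. u x - v x)"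
  shows "\<exists>u\<in>D. fnorm (\<lambda>x. \<Phi> u x - u x) = 0"
proof -
  define s where "s n = (\<Phi> ^^ n) (\<lambda>x. 0)" for n
  have sS: "s (Suc n) = \<Phi> (s n)" for n by (simp add: s_def)
  have sD: "s n \<in> D" for n
    by (induction n) (auto simp: sS \<Phi>, simp add: s_def D_zero)
  \<comment> \<open>The sum of the geometric series of steps: it bounds the distance of every
    iterate from the starting point.\<close>
  define c where "c = fnorm (\<lambda>x. s 1 x - s 0 x) / (1 - r)"
  have c0: "c \<ge> 0" unfolding c_def using r fnorm_ge0[OF D_diff[OF sD sD]] by auto
  have c1: "fnorm (\<lambda>x. s k x - s 0 x) \<le> c" for k
  proof (induction k)
    case 0
    have "fnorm (\<lambda>x. s 0 x - s 0 x) = 0"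
      using B_diff[OF sD[of 0] sD[of 0] D_zero] by (simp add: fnorm_def)
    then show ?case using c0 by simp
  next
    case (Suc k)
    have "fnorm (\<lambda>x. s (Suc k) x - s 0 x) \<le> fnorm (\<lambda>x. s (Suc k) x - s 1 x) + fnorm (\<lambda>x. s 1 x - s 0 x)"
      by (intro fnorm_diff_triangle sD)
    also have "fnorm (\<lambda>x. s (Suc k) x - s 1 x) \<le> r * fnorm (\<lambda>x. s k x - s 0 x)"
      using contr[OF sD[of k] sD[of 0]] by (simp add: sS)
    also have "\<dots> \<le> r * c" using Suc r by (intro mult_left_mono) auto
    also have "r * c + fnorm (\<lambda>x. s 1 x - s 0 x) = c"
      using r by (simp add: c_def field_simps)
    finally show ?case by simp
  qed
  have c2: "fnorm (\<lambda>x. s (n + k) x - s n x) \<le> r ^ n * c" for n k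
  proof (induction n)
    case (Suc n)
    have "fnorm (\<lambda>x. s (Suc n + k) x - s (Suc n) x) \<le> r * fnorm (\<lambda>x. s (n + k) x - s n x)"
      using contr[OF sD[of "n+k"] sD[of n]] by (simp add: sS)
    also have "\<dots> \<le> r * (r ^ n * c)" using Suc r by (intro mult_left_mono) auto
    finally show ?case by (simp add: mult.assoc)
  qed (use c1 in simp)
  have rc: "(\<lambda>n. r ^ n * c) \<longlonglongrightarrow> 0"
    using r by (intro tendsto_mult_left_zero LIMSEQ_power_zero) auto
  have "\<exists>u\<in>D. (\<lambda>n. B (\<lambda>x. s n x - u x) (\<lambda>x. s n x - u x)) \<longlonglongrightarrow> 0"
  proof (rule B_complete[OF sD])
    fix e :: real assume e: "e > 0"
    then have "eventually (\<lambda>n. r ^ n * c < sqrt e / 2) sequentially"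
      using order_tendstoD(2)[OF rc, of "sqrt e / 2"] by simp
    then obtain N where N: "r ^ N * c < sqrt e / 2" by (auto simp: eventually_sequentially)
    have "B (\<lambda>x. s m x - s n x) (\<lambda>x. s m x - s n x) < e" if "m \<ge> N" "n \<ge> N" for m n
    proof -
      have "fnorm (\<lambda>x. s m x - s n x) \<le> fnorm (\<lambda>x. s m x - s N x) + fnorm (\<lambda>x. s N x - s n x)"
        by (intro fnorm_diff_triangle sD)
      also have "\<dots> < sqrt e / 2 + sqrt e / 2"
        using c2[of N "m - N"] c2[of N "n - N"] that N fnorm_diff_commute[OF sD[of N] sD[of n]] by simp
      finally have "fnorm (\<lambda>x. s m x - s n x) < sqrt e" by simp
      then show ?thesis by (simp add: fnorm_def)
    qed
    then show "\<exists>N. \<forall>m\<ge>N. \<forall>n\<ge>N. B (\<lambda>x. s m x - s n x) (\<lambda>x. s m x - s n x) < e" by blast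
  qed
  then obtain u where u: "u \<in> D" "(\<lambda>n. B (\<lambda>x. s n x - u x) (\<lambda>x. s n x - u x)) \<longlonglongrightarrow> 0" by blast
  have plim: "(\<lambda>n. fnorm (\<lambda>x. s n x - u x)) \<longlonglongrightarrow> 0"
    using tendsto_real_sqrt[OF u(2)] by (simp add: fnorm_def)
  have "fnorm (\<lambda>x. \<Phi> u x - u x) \<le> 0"
  proof (rule LIMSEQ_le_const)
    have "(\<lambda>n. r * fnorm (\<lambda>x. s n x - u x) + fnorm (\<lambda>x. s (Suc n) x - u x)) \<longlonglongrightarrow> r * 0 + 0"
      by (intro tendsto_intros plim LIMSEQ_Suc[OF plim])
    then show "(\<lambda>n. r * fnorm (\<lambda>x. s n x - u x) + fnorm (\<lambda>x. s (Suc n) x - u x)) \<longlonglongrightarrow> 0" by simp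
    have "fnorm (\<lambda>x. \<Phi> u x - u x) \<le> r * fnorm (\<lambda>x. s n x - u x) + fnorm (\<lambda>x. s (Suc n) x - u x)" for n
      using fnorm_diff_triangle[OF \<Phi>[OF u(1)] sD[of "Suc n"] u(1)] contr[OF u(1) sD[of n]]
        fnorm_diff_commute[OF u(1) sD[of n]] by (simp add: sS)
    then show "\<exists>N. \<forall>n\<ge>N. fnorm (\<lambda>x. \<Phi> u x - u x) \<le> r * fnorm (\<lambda>x. s n x - u x) + fnorm (\<lambda>x. s (Suc n) x - u x)"
      by blast
  qed
  then show ?thesis using u(1) fnorm_ge0[OF D_diff[OF \<Phi>[OF u(1)] u(1)]] by force
qed

text \<open>Riesz turns each functional \<open>L u\<close> into an element of D, and the Lipschitz
  condition on L makes this map a contraction. The dependence on u enters only through that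
  condition, so an inhomogeneous term is allowed.\<close>

lemma contractive_equation_solvable:
  assumes L_lin: "\<And>u v w r. u \<in> D \<Longrightarrow> v \<in> D \<Longrightarrow> w \<in> D \<Longrightarrow>
        L u (\<lambda>x. v x + complex_of_real r * w x) = L u v + r * L u w"
    and L_bdd: "\<And>u. u \<in> D \<Longrightarrow> \<exists>C. \<forall>v\<in>D. \<bar>L u v\<bar> \<le> C * fnorm v"
    and r: "0 \<le> r" "r < 1"
    and contr: "\<And>u u' v. u \<in> D \<Longrightarrow> u' \<in> D \<Longrightarrow> v \<in> D \<Longrightarrow> L u v - L u' v \<le> r * fnorm (\<lambda>x. u x - u' x) * fnorm v"
  shows "\<exists>u\<in>D. \<forall>v\<in>D. B u v = L u v"
proof -
  have "\<exists>w\<in>D. \<forall>v\<in>D. B w v = L u v" if "u \<in> D" for u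
  proof -
    obtain C where "\<forall>v\<in>D. \<bar>L u v\<bar> \<le> C * fnorm v" using L_bdd[OF \<open>u \<in> D\<close>] by blast
    then show ?thesis using L_lin[OF \<open>u \<in> D\<close>] by (intro Riesz_representation[of "L u" C]) auto
  qed
  then obtain \<Phi> where \<Phi>: "\<And>u. u \<in> D \<Longrightarrow> \<Phi> u \<in> D" "\<And>u v. u \<in> D \<Longrightarrow> v \<in> D \<Longrightarrow> B (\<Phi> u) v = L u v"
    by metis
  have "\<exists>u\<in>D. fnorm (\<lambda>x. \<Phi> u x - u x) = 0"
  proof (rule contraction_fixed_point[OF \<Phi>(1) r])
    fix u v assume uv: "u \<in> D" "v \<in> D"
    let ?d = "\<lambda>x. \<Phi> u x - \<Phi> v x"
    have d: "?d \<in> D" by (intro D_diff \<Phi>(1) uv)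
    have "fnorm ?d * fnorm ?d = B (\<Phi> u) ?d - B (\<Phi> v) ?d"
      using fnorm_sq[OF d] B_diff[OF \<Phi>(1)[OF uv(1)] \<Phi>(1)[OF uv(2)] d] by (simp add: power2_eq_square)
    also have "\<dots> \<le> r * fnorm (\<lambda>x. u x - v x) * fnorm ?d"
      using contr[OF uv d] by (simp add: \<Phi>(2) uv d)
    finally have *: "fnorm ?d * fnorm ?d \<le> r * fnorm (\<lambda>x. u x - v x) * fnorm ?d" .
    show "fnorm ?d \<le> r * fnorm (\<lambda>x. u x - v x)"
    proof (cases "fnorm ?d = 0")
      case True
      then show ?thesis using r fnorm_ge0[OF D_diff[OF uv]] by simp
    next
      case False
      then have "fnorm ?d > 0" using fnorm_ge0[OF d] by simp
      with * show ?thesis by simp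
    qed
  qed
  then obtain u where u: "u \<in> D" "fnorm (\<lambda>x. \<Phi> u x - u x) = 0" by blast
  \<comment> \<open>A difference of seminorm zero is invisible to B by Cauchy-Schwarz, so the
    approximate fixed point solves the equation exactly.\<close>
  have "B u v = L u v" if v: "v \<in> D" for v
    using Cauchy_Schwarz[OF D_diff[OF \<Phi>(1)[OF u(1)] u(1)] v] u(2)
      B_diff[OF \<Phi>(1)[OF u(1)] u(1) v] \<Phi>(2)[OF u(1) v] by simp
  then show ?thesis using u(1) by blast
qed

end

subsection \<open>Form bounds and the spectrum\<close>

text \<open>Here w weights the derivatives and \<rho> the scalar product. Common positive bounds c
  and C make every weighted norm equivalent to the plain one, so the form domain is the same H^1
  space.\<close>

locale weighted_form =
  fixes S \<Gamma> :: "(real^'n) set" and w :: "'n \<Rightarrow> real^'n \<Rightarrow> real" and \<rho> :: "real^'n \<Rightarrow> real" and c C :: real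
  assumes S: "open S" and c: "c > 0"
    and w_meas: "\<And>i. w i \<in> borel_measurable (lebesgue_on S)"
    and \<rho>_meas: "\<rho> \<in> borel_measurable (lebesgue_on S)"
    and w_bound: "\<And>i x. x \<in> S \<Longrightarrow> c \<le> w i x \<and> w i x \<le> C"
    and \<rho>_bound: "\<And>x. x \<in> S \<Longrightarrow> c \<le> \<rho> x \<and> \<rho> x \<le> C"
begin

abbreviation "M \<equiv> lebesgue_on S"
abbreviation "D \<equiv> H1_vanish S \<Gamma>"
abbreviation "ener u v \<equiv> formw w S u v"

section \<open>Weighted inner products\<close>

definition weight :: "(real^'n \<Rightarrow> real) \<Rightarrow> bool" where
  "weight \<sigma> \<longleftrightarrow> \<sigma> \<in> borel_measurable M \<and> (\<forall>x\<in>S. c \<le> \<sigma> x \<and> \<sigma> x \<le> C)"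

lemma weight_w: "weight (w i)" and weight_\<rho>: "weight \<rho>"
  using w_meas \<rho>_meas w_bound \<rho>_bound by (auto simp: weight_def)

lemma sqrt_weight:
  assumes "weight \<sigma>"
  shows "(\<lambda>x. complex_of_real (sqrt (\<sigma> x))) \<in> borel_measurable M"
    and "AE x in M. norm (complex_of_real (sqrt (\<sigma> x))) \<le> sqrt C"
proof -
  have [measurable]: "\<sigma> \<in> borel_measurable M" using assms by (simp add: weight_def)
  show "(\<lambda>x. complex_of_real (sqrt (\<sigma> x))) \<in> borel_measurable M" by measurable
  show "AE x in M. norm (complex_of_real (sqrt (\<sigma> x))) \<le> sqrt C"
    using assms c by (intro AE_I2) (auto simp: weight_def)
qed

lemma sqint_sqrt_weight:
  assumes "weight \<sigma>" "sqint M u" shows "sqint M (\<lambda>x. complex_of_real (sqrt (\<sigma> x)) * u x)"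
  by (rule sqint_mult_bounded[OF assms(2) sqrt_weight[OF assms(1)]])

text \<open>Multiplication by the root of the weight is an isometry onto the unweighted space;
  Cauchy-Schwarz and convergence of norms are transported along it.\<close>

lemma norm_w_nrm2:
  assumes "weight \<sigma>" shows "norm_w \<sigma> S u = nrm2 M (\<lambda>x. complex_of_real (sqrt (\<sigma> x)) * u x)"
  unfolding norm_w_def nrm2_def
  by (rule arg_cong[where f=sqrt], rule Lint_cong)
    (use assms c in \<open>auto simp: weight_def norm_mult power_mult_distrib\<close>)

lemma inner_w_sqrt:
  assumes "weight \<sigma>"
  shows "inner_w \<sigma> S u v = (LINT x|M. (complex_of_real (sqrt (\<sigma> x)) * u x) * cnj (complex_of_real (sqrt (\<sigma> x)) * v x))"
  unfolding inner_w_def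
proof (rule Lint_cong)
  fix x assume "x \<in> space M"
  then have "\<sigma> x \<ge> 0" using assms c by (force simp: weight_def)
  then have "complex_of_real (\<sigma> x) = complex_of_real (sqrt (\<sigma> x)) * complex_of_real (sqrt (\<sigma> x))"
    unfolding of_real_mult[symmetric] by simp
  then show "complex_of_real (\<sigma> x) * u x * cnj (v x)
     = (complex_of_real (sqrt (\<sigma> x)) * u x) * cnj (complex_of_real (sqrt (\<sigma> x)) * v x)"
    by (simp add: mult_ac)
qed simp

lemma inner_w_integrable:
  assumes "weight \<sigma>" "sqint M u" "sqint M v"
  shows "integrable M (\<lambda>x. complex_of_real (\<sigma> x) * u x * cnj (v x))"
proof (rule sqint_mult_integrable[OF sqint_mult_bounded[OF assms(2)] sqint_cnj[OF assms(3)]])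
  have [measurable]: "\<sigma> \<in> borel_measurable M" using assms(1) by (simp add: weight_def)
  show "(\<lambda>x. complex_of_real (\<sigma> x)) \<in> borel_measurable M" by measurable
  show "AE x in M. norm (complex_of_real (\<sigma> x)) \<le> C" using assms(1) c by (intro AE_I2) (force simp: weight_def)
qed

lemma inner_w_lincomb:
  assumes "weight \<sigma>" "sqint M u" "sqint M u'" "sqint M v"
  shows "inner_w \<sigma> S (\<lambda>x. u x + a * u' x) v = inner_w \<sigma> S u v + a * inner_w \<sigma> S u' v"
  using inner_w_integrable[OF assms(1,2,4)] inner_w_integrable[OF assms(1,3,4)]
  unfolding inner_w_def by (simp add: algebra_simps)

lemma inner_w_commute:
  "inner_w \<sigma> S v u = cnj (inner_w \<sigma> S u v)"
proof -
  have "cnj (inner_w \<sigma> S u v) = (LINT x|M. cnj (complex_of_real (\<sigma> x) * u x * cnj (v x)))"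
    unfolding inner_w_def by (rule Bochner_Integration.integral_cnj[of "M" "\<lambda>x. complex_of_real (\<sigma> x) * u x * cnj (v x)", symmetric])
  also have "\<dots> = inner_w \<sigma> S v u"
    unfolding inner_w_def by (rule Lint_cong) (auto simp: mult_ac)
  finally show ?thesis by simp
qed

lemma inner_w_cong_AE:
  assumes "weight \<sigma>" "sqint M u" "sqint M u'" "sqint M v" "AE x in M. u x = u' x"
  shows "inner_w \<sigma> S u v = inner_w \<sigma> S u' v"
  unfolding inner_w_def
  by (rule integral_cong_AE)
    (use assms(5) inner_w_integrable[OF assms(1,2,4)] inner_w_integrable[OF assms(1,3,4)] in
      \<open>auto intro: borel_measurable_integrable\<close>)

lemma norm_w_power2:
  assumes "weight \<sigma>" shows "(norm_w \<sigma> S u)\<^sup>2 = (LINT x|M. \<sigma> x * (cmod (u x))\<^sup>2)"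
proof -
  have "0 \<le> (LINT x|M. \<sigma> x * (cmod (u x))\<^sup>2)"
    using assms c by (intro integral_nonneg_AE AE_I2) (force simp: weight_def)
  then show ?thesis by (simp add: norm_w_def)
qed

lemma norm_w_sq:
  assumes "weight \<sigma>" shows "inner_w \<sigma> S u u = complex_of_real ((norm_w \<sigma> S u)\<^sup>2)"
proof -
  have "inner_w \<sigma> S u u = (LINT x|M. complex_of_real (\<sigma> x * (cmod (u x))\<^sup>2))"
    unfolding inner_w_def
    by (rule Lint_cong) (simp_all only: of_real_mult complex_norm_square mult.assoc)
  also have "\<dots> = complex_of_real (LINT x|M. \<sigma> x * (cmod (u x))\<^sup>2)"
    by (rule integral_complex_of_real)
  finally show ?thesis by (simp only: norm_w_power2[OF assms])
qed

lemma integrable_weight: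
  assumes "weight \<sigma>" "sqint M u" shows "integrable M (\<lambda>x. \<sigma> x * (cmod (u x))\<^sup>2)"
  using sqint_integrable[OF sqint_sqrt_weight[OF assms]]
  by (subst Bochner_Integration.integrable_cong[OF refl, where g="\<lambda>x. (norm (complex_of_real (sqrt (\<sigma> x)) * u x))\<^sup>2"])
    (use assms(1) c in \<open>auto simp: weight_def norm_mult power_mult_distrib\<close>)

lemma norm_w_ge0: "weight \<sigma> \<Longrightarrow> norm_w \<sigma> S u \<ge> 0"
  by (simp add: norm_w_nrm2)

lemma inner_w_Cauchy_Schwarz:
  assumes "weight \<sigma>" "sqint M u" "sqint M v"
  shows "cmod (inner_w \<sigma> S u v) \<le> norm_w \<sigma> S u * norm_w \<sigma> S v"
proof -
  have "nrm2 M (\<lambda>x. cnj (complex_of_real (sqrt (\<sigma> x)) * v x)) = nrm2 M (\<lambda>x. complex_of_real (sqrt (\<sigma> x)) * v x)"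
    by (simp add: nrm2_def norm_mult)
  then show ?thesis
    using norm_integral_mult_le[OF sqint_sqrt_weight[OF assms(1,2)] sqint_cnj[OF sqint_sqrt_weight[OF assms(1,3)]]]
    unfolding inner_w_sqrt[OF assms(1)] norm_w_nrm2[OF assms(1)] by simp
qed

lemma norm_w_bounds:
  assumes "weight \<sigma>" "sqint M u"
  shows "c * (nrm2 M u)\<^sup>2 \<le> (norm_w \<sigma> S u)\<^sup>2" and "(norm_w \<sigma> S u)\<^sup>2 \<le> C * (nrm2 M u)\<^sup>2"
proof -
  note i = integrable_weight[OF assms]
  note n = norm_w_power2[OF assms(1)]
  have j: "integrable M (\<lambda>x. k * (cmod (u x))\<^sup>2)" for k using sqint_integrable[OF assms(2)] by simp
  have "(LINT x|M. c * (cmod (u x))\<^sup>2) \<le> (LINT x|M. \<sigma> x * (cmod (u x))\<^sup>2)"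
    by (rule integral_mono[OF j i]) (use assms(1) in \<open>auto simp: weight_def intro: mult_right_mono\<close>)
  then show "c * (nrm2 M u)\<^sup>2 \<le> (norm_w \<sigma> S u)\<^sup>2" by (simp add: n nrm2_sq)
  have "(LINT x|M. \<sigma> x * (cmod (u x))\<^sup>2) \<le> (LINT x|M. C * (cmod (u x))\<^sup>2)"
    by (rule integral_mono[OF i j]) (use assms(1) in \<open>auto simp: weight_def intro: mult_right_mono\<close>)
  then show "(norm_w \<sigma> S u)\<^sup>2 \<le> C * (nrm2 M u)\<^sup>2" by (simp add: n nrm2_sq)
qed

lemma L2w_iff_sqint:
  assumes "weight \<sigma>" shows "L2w \<sigma> S u \<longleftrightarrow> sqint M u"
proof
  assume u: "L2w \<sigma> S u"
  show "sqint M u"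
  proof (rule sqint_mono)
    show "u \<in> borel_measurable M" using u by (simp add: L2w_def)
    show "integrable M (\<lambda>x. (1/c) * (\<sigma> x * (cmod (u x))\<^sup>2))" using u by (simp add: L2w_def)
    show "AE x in M. (cmod (u x))\<^sup>2 \<le> (1/c) * (\<sigma> x * (cmod (u x))\<^sup>2)"
    proof (rule AE_I2)
      fix x assume "x \<in> space M"
      then have "c * (cmod (u x))\<^sup>2 \<le> \<sigma> x * (cmod (u x))\<^sup>2"
        using assms by (intro mult_right_mono) (auto simp: weight_def)
      then show "(cmod (u x))\<^sup>2 \<le> (1/c) * (\<sigma> x * (cmod (u x))\<^sup>2)"
        using c by (simp add: field_simps)
    qed
  qed
next
  assume u: "sqint M u"
  then show "L2w \<sigma> S u"
    by (auto simp: L2w_def integrable_weight[OF assms] dest: sqint_measurable)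
qed

section \<open>The weighted energy form\<close>

lemma ener_eq: "ener u v = (\<Sum>i\<in>UNIV. inner_w (w i) S (wd S u i) (wd S v i))"
  by (simp add: formw_def inner_w_def)

lemma ener_commute: "ener v u = cnj (ener u v)"
  unfolding ener_eq cnj_sum by (rule sum.cong[OF refl]) (rule inner_w_commute)

lemma ener_lincomb:
  assumes "H1 S u" "H1 S u'" "H1 S v"
  shows "ener (\<lambda>x. u x + a * u' x) v = ener u v + a * ener u' v"
proof -
  have "inner_w (w i) S (wd S (\<lambda>x. u x + a * u' x) i) (wd S v i)
      = inner_w (w i) S (wd S u i) (wd S v i) + a * inner_w (w i) S (wd S u' i) (wd S v i)" for i
    unfolding inner_w_lincomb[OF weight_w H1_sqint_wd[OF assms(1)] H1_sqint_wd[OF assms(2)] H1_sqint_wd[OF assms(3)], symmetric]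
    by (rule inner_w_cong_AE[OF weight_w _ _ _ wd_lincomb[OF S assms(1,2)]])
      (intro H1_sqint_wd sqint_add sqint_cmult H1_lincomb S assms)+
  then show ?thesis by (simp add: ener_eq sum.distrib sum_distrib_left)
qed

lemma ener_self: "ener u u = complex_of_real (\<Sum>i\<in>UNIV. (norm_w (w i) S (wd S u i))\<^sup>2)"
  by (simp add: ener_eq norm_w_sq[OF weight_w])

text \<open>Norm equivalence for the shifted form. The lower bound makes form-Cauchy sequences
  H^1-Cauchy, and the upper bound carries the H^1 limit back to the form; s \<ge> 1 keeps c as lower
  constant and lets s * C dominate the unshifted terms too.\<close>

lemma ener_bounds:
  assumes "H1 S u" "s \<ge> 1"
  shows "c * H1_norm_sq S u \<le> Re (ener u u) + s * (norm_w \<rho> S u)\<^sup>2"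
    and "Re (ener u u) + s * (norm_w \<rho> S u)\<^sup>2 \<le> s * C * H1_norm_sq S u"
proof -
  note b = norm_w_bounds[OF weight_\<rho> H1_sqint[OF assms(1)]]
  note bw = norm_w_bounds[OF weight_w H1_sqint_wd[OF assms(1)]]
  have "c * (nrm2 M u)\<^sup>2 \<le> s * (norm_w \<rho> S u)\<^sup>2"
    using b(1) mult_right_mono[OF assms(2), of "(norm_w \<rho> S u)\<^sup>2"] by simp
  moreover have "(\<Sum>i\<in>UNIV. c * (nrm2 M (wd S u i))\<^sup>2) \<le> Re (ener u u)"
    unfolding ener_self Re_complex_of_real by (intro sum_mono bw(1))
  ultimately show "c * H1_norm_sq S u \<le> Re (ener u u) + s * (norm_w \<rho> S u)\<^sup>2"
    by (simp add: H1_norm_sq_nrm2 distrib_left sum_distrib_left)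
  have "Re (ener u u) \<le> (\<Sum>i\<in>UNIV. s * (C * (nrm2 M (wd S u i))\<^sup>2))"
    unfolding ener_self Re_complex_of_real
  proof (intro sum_mono)
    fix i
    have "0 \<le> C * (nrm2 M (wd S u i))\<^sup>2" using bw(2)[of i i] zero_le_power2 order_trans by blast
    then show "(norm_w (w i) S (wd S u i))\<^sup>2 \<le> s * (C * (nrm2 M (wd S u i))\<^sup>2)"
      using bw(2)[of i i] mult_right_mono[OF assms(2)] by fastforce
  qed
  moreover have "s * (norm_w \<rho> S u)\<^sup>2 \<le> s * (C * (nrm2 M u)\<^sup>2)"
    using b(2) assms(2) by (intro mult_left_mono) auto
  ultimately show "Re (ener u u) + s * (norm_w \<rho> S u)\<^sup>2 \<le> s * C * H1_norm_sq S u"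
    by (simp add: H1_norm_sq_nrm2 distrib_left sum_distrib_left mult.assoc)
qed

lemma form_space_ener:
  assumes s: "s \<ge> 1"
  shows "form_space D (\<lambda>u v. Re (ener u v) + s * Re (inner_w \<rho> S u v))" (is "form_space D ?B")
proof
  have self: "?B u u = Re (ener u u) + s * (norm_w \<rho> S u)\<^sup>2" for u
    by (simp add: norm_w_sq[OF weight_\<rho>])
  show "(\<lambda>x. 0) \<in> D" by (rule H1_vanish_zero[OF S])
  show "(\<lambda>x. u x + a * v x) \<in> D" if "u \<in> D" "v \<in> D" for u v a
    by (rule H1_vanish_lincomb[OF S that])
  show "?B u v = ?B v u" for u v
    using ener_commute[of u v] inner_w_commute[of \<rho> u v] by simp
  show "?B (\<lambda>x. u x + complex_of_real r * v x) z = ?B u z + r * ?B v z" if "u \<in> D" "v \<in> D" "z \<in> D" for u v z r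
    using that[THEN H1_vanish_H1]
    by (simp add: ener_lincomb inner_w_lincomb[OF weight_\<rho>] H1_sqint algebra_simps)
  show "0 \<le> ?B u u" if "u \<in> D" for u
    using order_trans[OF mult_nonneg_nonneg[OF less_imp_le[OF c] H1_norm_sq_ge0] ener_bounds(1)[OF H1_vanish_H1[OF that] s]]
    by (simp only: self)
  fix q :: "nat \<Rightarrow> real^'n \<Rightarrow> complex"
  assume q: "\<And>n. q n \<in> D"
    and cau: "\<And>e. e > 0 \<Longrightarrow> \<exists>N. \<forall>m\<ge>N. \<forall>n\<ge>N. ?B (\<lambda>x. q m x - q n x) (\<lambda>x. q m x - q n x) < e"
  note qH = q[THEN H1_vanish_H1]
  have "\<exists>N. \<forall>m\<ge>N. \<forall>n\<ge>N. H1_norm_sq S (\<lambda>x. q m x - q n x) < e" if "e > 0" for e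
  proof -
    obtain N where N: "\<And>m n. m \<ge> N \<Longrightarrow> n \<ge> N \<Longrightarrow> ?B (\<lambda>x. q m x - q n x) (\<lambda>x. q m x - q n x) < c * e"
      using cau[OF mult_pos_pos[OF c \<open>e > 0\<close>]] by blast
    have "H1_norm_sq S (\<lambda>x. q m x - q n x) < e" if "m \<ge> N" "n \<ge> N" for m n
    proof -
      have "c * H1_norm_sq S (\<lambda>x. q m x - q n x) < c * e"
        using ener_bounds(1)[OF H1_diff[OF S qH[of m] qH[of n]] s] N[OF that] unfolding self by linarith
      then show ?thesis using c by simp
    qed
    then show ?thesis by blast
  qed
  from H1_vanish_complete[OF S q this] obtain u where
    u: "u \<in> D" "(\<lambda>n. H1_norm_sq S (\<lambda>x. q n x - u x)) \<longlonglongrightarrow> 0" by blast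
  have "(\<lambda>n. ?B (\<lambda>x. q n x - u x) (\<lambda>x. q n x - u x)) \<longlonglongrightarrow> 0"
  proof (rule Lim_null_comparison[OF always_eventually tendsto_mult_right_zero[OF u(2), of "s * C"]], rule allI)
    fix n
    note H = H1_diff[OF S qH[of n] H1_vanish_H1[OF u(1)]]
    have "0 \<le> Re (ener (\<lambda>x. q n x - u x) (\<lambda>x. q n x - u x)) + s * (norm_w \<rho> S (\<lambda>x. q n x - u x))\<^sup>2"
      using order_trans[OF mult_nonneg_nonneg[OF less_imp_le[OF c] H1_norm_sq_ge0] ener_bounds(1)[OF H s]] .
    then show "norm (?B (\<lambda>x. q n x - u x) (\<lambda>x. q n x - u x)) \<le> s * C * H1_norm_sq S (\<lambda>x. q n x - u x)"
      using ener_bounds(2)[OF H s] unfolding self by simp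
  qed
  with u(1) show "\<exists>u\<in>D. (\<lambda>n. ?B (\<lambda>x. q n x - u x) (\<lambda>x. q n x - u x)) \<longlonglongrightarrow> 0" by blast
qed

text \<open>For a large shift \<open>s\<close> the equation \<open>T u - z u = f\<close> reads
  \<open>u = (T + s)\<^sup>-\<^sup>1 (f + (s + z) u)\<close>, a contraction because \<open>\<bar>s + z\<bar> < s + \<lambda>\<close>.\<close>

theorem spectrum_lower_bound:
  assumes key: "\<And>u. u \<in> D \<Longrightarrow> lam * (norm_w \<rho> S u)\<^sup>2 \<le> Re (ener u u)"
    and z: "z \<in> op_spectrum \<rho> S (assoc_graph w \<rho> S D)"
  shows "lam \<le> Re z"
proof (rule ccontr)
  assume "\<not> lam \<le> Re z"
  then have less: "Re z < lam" by simp
  \<comment> \<open>The three entries give s \<ge> 1 for the norm equivalence, s + lam > 0, and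
    |z|^2 < 2 s (lam - Re z). The last one is what remains of |s + z|^2 < (s + lam)^2 after
    expanding and dropping lam^2.\<close>
  define s where "s = max 1 (max (\<bar>lam\<bar> + 1) ((cmod z)\<^sup>2 / (2 * (lam - Re z)) + 1))"
  have s1: "s \<ge> 1" and s2: "s + lam > 0" by (auto simp: s_def max_def split: if_splits)
  have s3: "cmod (s + z) < s + lam"
  proof (rule power_less_imp_less_base[of _ 2])
    have "(cmod z)\<^sup>2 / (2 * (lam - Re z)) < s" by (auto simp: s_def max_def split: if_splits)
    then have "(cmod z)\<^sup>2 < s * (2 * (lam - Re z))" using less by (simp add: pos_divide_less_eq)
    moreover have "(cmod (s + z))\<^sup>2 = s\<^sup>2 + 2 * s * Re z + (cmod z)\<^sup>2"
      unfolding cmod_power2 by (simp add: power2_sum algebra_simps)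
    ultimately show "(cmod (s + z))\<^sup>2 < (s + lam)\<^sup>2"
      by (simp add: power2_sum algebra_simps add_pos_nonneg) (smt (verit) zero_le_power2)
  qed (use s2 in simp)
  interpret fs: form_space D "\<lambda>u v. Re (ener u v) + s * Re (inner_w \<rho> S u v)"
    by (rule form_space_ener[OF s1])
  let ?N = "norm_w \<rho> S"
  have N0: "?N u \<ge> 0" for u by (rule norm_w_ge0[OF weight_\<rho>])
  have psq: "(fs.fnorm u)\<^sup>2 = Re (ener u u) + s * (?N u)\<^sup>2" if "u \<in> D" for u
    using fs.fnorm_sq[OF that] by (simp add: norm_w_sq[OF weight_\<rho>])
  \<comment> \<open>The form bound measures the L^2 norm against the form norm with the shifted
    constant s + lam; this is where the lower bound produces the contraction.\<close>
  have Np: "sqrt (s + lam) * ?N u \<le> fs.fnorm u" if "u \<in> D" for u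
  proof (rule power2_le_imp_le[OF _ fs.fnorm_ge0[OF that]])
    show "(sqrt (s + lam) * ?N u)\<^sup>2 \<le> (fs.fnorm u)\<^sup>2"
      using key[OF that] s2 unfolding psq[OF that] power_mult_distrib by (simp add: algebra_simps)
  qed
  have "z \<in> op_resolvent \<rho> S (assoc_graph w \<rho> S D)"
    unfolding op_resolvent_def
  proof (intro CollectI conjI allI impI)
    fix f assume "L2w \<rho> S f"
    then have f: "sqint M f" by (simp add: L2w_iff_sqint[OF weight_\<rho>])
    have sq: "sqint M u" if "u \<in> D" for u by (rule H1_sqint[OF H1_vanish_H1[OF that]])
    have sF: "sqint M (\<lambda>x. f x + a * u x)" if "u \<in> D" for u a
      by (intro sqint_add sqint_cmult f sq that)
    define L where "L u v = Re (inner_w \<rho> S (\<lambda>x. f x + (s + z) * u x) v)" for u v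
    \<comment> \<open>The functionals at u and u' differ by the real part of (s + z) times the inner
      product of u - u' with v. Each of the two L^2 norms costs one factor 1 / sqrt (s + lam),
      whence the ratio.\<close>
    have "\<exists>u\<in>D. \<forall>v\<in>D. Re (ener u v) + s * Re (inner_w \<rho> S u v) = L u v"
    proof (rule fs.contractive_equation_solvable[where r = "cmod (s + z) / (s + lam)"])
      show "L u (\<lambda>x. v x + complex_of_real r * y x) = L u v + r * L u y" if "u \<in> D" "v \<in> D" "y \<in> D" for u v y r
        unfolding L_def inner_w_commute[of _ "\<lambda>x. f x + (s + z) * u x"]
        by (simp add: inner_w_lincomb[OF weight_\<rho>] sq sF that)
      show "\<exists>K. \<forall>v\<in>D. \<bar>L u v\<bar> \<le> K * fs.fnorm v" if u: "u \<in> D" for u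
      proof (intro exI ballI)
        fix v assume v: "v \<in> D"
        let ?h = "\<lambda>x. f x + (s + z) * u x"
        have "\<bar>L u v\<bar> \<le> cmod (inner_w \<rho> S ?h v)" unfolding L_def by (rule abs_Re_le_cmod)
        also have "\<dots> \<le> ?N ?h * ?N v" by (rule inner_w_Cauchy_Schwarz[OF weight_\<rho> sF[OF u] sq[OF v]])
        also have "\<dots> \<le> ?N ?h * (fs.fnorm v / sqrt (s + lam))"
          using Np[OF v] s2 by (intro mult_left_mono N0) (simp add: pos_le_divide_eq mult.commute)
        finally show "\<bar>L u v\<bar> \<le> (?N ?h / sqrt (s + lam)) * fs.fnorm v" by simp
      qed
      show "0 \<le> cmod (s + z) / (s + lam)" "cmod (s + z) / (s + lam) < 1" using s2 s3 by auto
      fix u u' v assume D: "u \<in> D" "u' \<in> D" "v \<in> D"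
      define d where "d = (\<lambda>x. u x - u' x)"
      have dD: "d \<in> D" unfolding d_def by (rule fs.D_diff[OF D(1,2)])
      have "inner_w \<rho> S (\<lambda>x. f x + (s + z) * u x) v
          = inner_w \<rho> S (\<lambda>x. (f x + (s + z) * u' x) + (s + z) * d x) v"
        by (simp add: d_def algebra_simps)
      also have "\<dots> = inner_w \<rho> S (\<lambda>x. f x + (s + z) * u' x) v + (s + z) * inner_w \<rho> S d v"
        by (rule inner_w_lincomb[OF weight_\<rho> sF[OF D(2)] sq[OF dD] sq[OF D(3)]])
      finally have "L u v - L u' v = Re ((s + z) * inner_w \<rho> S d v)" unfolding L_def by simp
      also have "\<dots> \<le> cmod (s + z) * cmod (inner_w \<rho> S d v)"
        unfolding norm_mult[symmetric] by (rule complex_Re_le_cmod)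
      also have "\<dots> \<le> cmod (s + z) * (?N d * ?N v)"
        by (intro mult_left_mono inner_w_Cauchy_Schwarz[OF weight_\<rho>] sq dD D) auto
      also have "\<dots> \<le> cmod (s + z) * ((fs.fnorm d / sqrt (s + lam)) * (fs.fnorm v / sqrt (s + lam)))"
        using Np[OF dD] Np[OF D(3)] s2
        by (intro mult_left_mono mult_mono N0 divide_nonneg_nonneg fs.fnorm_ge0 dD)
          (auto simp: pos_le_divide_eq mult.commute)
      also have "\<dots> = cmod (s + z) / (s + lam) * fs.fnorm d * fs.fnorm v"
        using s2 by simp
      finally show "L u v - L u' v \<le> cmod (s + z) / (s + lam) * fs.fnorm (\<lambda>x. u x - u' x) * fs.fnorm v"
        unfolding d_def .
    qed
    then obtain u where u: "u \<in> D" "\<And>v. v \<in> D \<Longrightarrow> Re (ener u v) + s * Re (inner_w \<rho> S u v) = L u v" by blast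
    let ?h = "\<lambda>x. f x + z * u x"
    note uH = H1_vanish_H1[OF u(1)]
    have re: "Re (ener u v - inner_w \<rho> S ?h v) = 0" if v: "v \<in> D" for v
    proof -
      have "inner_w \<rho> S (\<lambda>x. f x + (s + z) * u x) v = inner_w \<rho> S (\<lambda>x. ?h x + s * u x) v"
        by (simp add: algebra_simps)
      also have "\<dots> = inner_w \<rho> S ?h v + s * inner_w \<rho> S u v"
        by (rule inner_w_lincomb[OF weight_\<rho> sF[OF u(1)] sq[OF u(1)] sq[OF v]])
      finally show ?thesis using u(2)[OF v] unfolding L_def by simp
    qed
    have "ener u v = inner_w \<rho> S ?h v" if v: "v \<in> D" for v
    proof (rule complex_eqI)
      show "Re (ener u v) = Re (inner_w \<rho> S ?h v)" using re[OF v] by simp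
      \<comment> \<open>Only real parts are known so far; testing with i v recovers the imaginary
        part. The summand 0 gives the shape that the linear combination lemmas expect.\<close>
      let ?v = "\<lambda>x. 0 + \<i> * v x"
      have z0: "(\<lambda>x. 0) \<in> D" by (rule fs.D_zero)
      have vD: "?v \<in> D" by (rule fs.D_lin[OF z0 v])
      have z1: "ener (\<lambda>x. 0) u = 0" "inner_w \<rho> S (\<lambda>x. 0) ?h = 0"
        using ener_lincomb[OF H1_vanish_H1[OF z0] H1_vanish_H1[OF z0] uH, of 1] by (auto simp: inner_w_def)
      have "ener u ?v = - \<i> * ener u v"
        unfolding ener_commute[of u] ener_lincomb[OF H1_vanish_H1[OF z0] H1_vanish_H1[OF v] uH] z1 by simp
      moreover have "inner_w \<rho> S ?h ?v = - \<i> * inner_w \<rho> S ?h v"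
        unfolding inner_w_commute[of _ ?h] inner_w_lincomb[OF weight_\<rho> sq[OF z0] sq[OF v] sF[OF u(1)]] z1 by simp
      ultimately show "Im (ener u v) = Im (inner_w \<rho> S ?h v)" using re[OF vD] by simp
    qed
    then show "\<exists>u. (u, \<lambda>x. f x + z * u x) \<in> assoc_graph w \<rho> S D"
      using u(1) sF[OF u(1)] by (intro exI[of _ u]) (auto simp: assoc_graph_def L2w_iff_sqint[OF weight_\<rho>])
  next
    show "\<exists>K. \<forall>u f. L2w \<rho> S f \<and> (u, \<lambda>x. f x + z * u x) \<in> assoc_graph w \<rho> S D
            \<longrightarrow> ?N u \<le> K * ?N f"
    proof (intro exI allI impI)
      fix u f assume a: "L2w \<rho> S f \<and> (u, \<lambda>x. f x + z * u x) \<in> assoc_graph w \<rho> S D"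
      then have f: "sqint M f" and u: "u \<in> D"
        and eq: "ener u u = inner_w \<rho> S (\<lambda>x. f x + z * u x) u"
        by (auto simp: assoc_graph_def L2w_iff_sqint[OF weight_\<rho>])
      have su: "sqint M u" by (rule H1_sqint[OF H1_vanish_H1[OF u]])
      \<comment> \<open>Testing the equation with u itself: the form bound absorbs Re z, and the gap
        lam - Re z bounds the inverse.\<close>
      have "Re (ener u u) = Re (inner_w \<rho> S f u) + Re z * (?N u)\<^sup>2"
        unfolding eq inner_w_lincomb[OF weight_\<rho> f su su] norm_w_sq[OF weight_\<rho>] by simp
      then have "(lam - Re z) * (?N u)\<^sup>2 \<le> Re (inner_w \<rho> S f u)"
        using key[OF u] by (simp add: algebra_simps)
      also have "\<dots> \<le> ?N f * ?N u"
        using complex_Re_le_cmod inner_w_Cauchy_Schwarz[OF weight_\<rho> f su] by (rule order_trans)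
      finally have *: "(lam - Re z) * ?N u * ?N u \<le> ?N f * ?N u" by (simp add: power2_eq_square mult.assoc)
      have "(lam - Re z) * ?N u \<le> ?N f"
      proof (cases "?N u = 0")
        case False
        then have "?N u > 0" using N0[of u] by simp
        with * show ?thesis by (rule mult_right_le_imp_le)
      qed (simp add: N0)
      then show "?N u \<le> 1 / (lam - Re z) * ?N f"
        using less by (simp add: pos_le_divide_eq mult.commute)
    qed
  qed
  with z show False by (simp add: op_spectrum_def)
qed

lemma tendsto_norm_w:
  assumes \<sigma>: "weight \<sigma>" and u: "sqint M u" and s: "\<And>n. sqint M (s n)"
    and lim: "(\<lambda>n. nrm2 M (\<lambda>x. s n x - u x)) \<longlonglongrightarrow> 0"
  shows "(\<lambda>n. norm_w \<sigma> S (s n)) \<longlonglongrightarrow> norm_w \<sigma> S u"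
  unfolding norm_w_nrm2[OF \<sigma>]
proof (rule tendsto_nrm2[OF sqint_sqrt_weight[OF \<sigma> u] sqint_sqrt_weight[OF \<sigma> s]])
  show "(\<lambda>n. nrm2 M (\<lambda>x. complex_of_real (sqrt (\<sigma> x)) * s n x - complex_of_real (sqrt (\<sigma> x)) * u x)) \<longlonglongrightarrow> 0"
  \<comment> \<open>The bounds determine the sign of C only when S has a point; the absolute value
    secures the nonnegative constant required by \<open>nrm2_mult_bounded_le\<close>.\<close>
  proof (rule Lim_null_comparison[OF always_eventually tendsto_mult_right_zero[OF lim, of "sqrt \<bar>C\<bar>"]], rule allI)
    fix n
    have "AE x in M. norm (complex_of_real (sqrt (\<sigma> x))) \<le> sqrt \<bar>C\<bar>"
      using sqrt_weight(2)[OF \<sigma>] by eventually_elim (erule order_trans, simp)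
    then have "nrm2 M (\<lambda>x. complex_of_real (sqrt (\<sigma> x)) * (s n x - u x)) \<le> sqrt \<bar>C\<bar> * nrm2 M (\<lambda>x. s n x - u x)"
      by (intro nrm2_mult_bounded_le[OF sqint_diff[OF s u] sqrt_weight(1)[OF \<sigma>]]) auto
    then show "norm (nrm2 M (\<lambda>x. complex_of_real (sqrt (\<sigma> x)) * s n x - complex_of_real (sqrt (\<sigma> x)) * u x))
        \<le> sqrt \<bar>C\<bar> * nrm2 M (\<lambda>x. s n x - u x)"
      by (simp add: right_diff_distrib)
  qed
qed

text \<open>Both sides are continuous along an H^1 approximation because the weights are bounded. It
  therefore suffices to treat C^1 functions, where slicing and pointwise identities make
  sense.\<close>

lemma form_bound_by_density:
  assumes test: "\<And>\<phi>. C1c \<phi> \<Longrightarrow> near_zero \<Gamma> \<phi> \<Longrightarrow>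
        lam * (norm_w \<rho> S \<phi>)\<^sup>2 \<le> (\<Sum>i\<in>UNIV. (norm_w (w i) S (pd \<phi> i))\<^sup>2)"
    and u: "u \<in> D"
  shows "lam * (norm_w \<rho> S u)\<^sup>2 \<le> Re (ener u u)"
proof -
  have Sb: "S \<in> sets borel" using S by simp
  note uH = H1_vanish_H1[OF u]
  obtain q where q: "\<forall>n. C1c (q n) \<and> near_zero \<Gamma> (q n)"
    and l0: "(\<lambda>n. nrm2 M (\<lambda>x. q n x - u x)) \<longlonglongrightarrow> 0"
    and l1: "\<forall>i. (\<lambda>n. nrm2 M (\<lambda>x. pd (q n) i x - wd S u i x)) \<longlonglongrightarrow> 0"
    by (rule H1_vanish_approximation[OF S u])
  have sq: "sqint M (q n)" and sp: "sqint M (pd (q n) i)" for n i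
    using q by (auto intro: C1c_sqint C1c_sqint_pd Sb)
  have "(\<lambda>n. lam * (norm_w \<rho> S (q n))\<^sup>2) \<longlonglongrightarrow> lam * (norm_w \<rho> S u)\<^sup>2"
    by (intro tendsto_intros tendsto_norm_w[OF weight_\<rho> H1_sqint[OF uH] sq l0])
  moreover have "(\<lambda>n. \<Sum>i\<in>UNIV. (norm_w (w i) S (pd (q n) i))\<^sup>2) \<longlonglongrightarrow> (\<Sum>i\<in>UNIV. (norm_w (w i) S (wd S u i))\<^sup>2)"
    by (intro tendsto_intros tendsto_norm_w[OF weight_w H1_sqint_wd[OF uH] sp l1[rule_format]])
  ultimately have "lam * (norm_w \<rho> S u)\<^sup>2 \<le> (\<Sum>i\<in>UNIV. (norm_w (w i) S (wd S u i))\<^sup>2)"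
    by (rule LIMSEQ_le) (use test q in blast)
  then show ?thesis by (simp add: ener_self)
qed

end

subsection \<open>Fubini's theorem on cylinders\<close>

text \<open>Inverse of the splitting of x into \<open>proj12 x\<close> and \<open>x $ 3\<close>; it
  identifies the product space with three-dimensional space.\<close>

definition cyl_point :: "(real^2) \<times> real \<Rightarrow> real^3" where
  "cyl_point = (\<lambda>(y, s). vector [y $ 1, y $ 2, s])"

lemma cyl_point_nth [simp]:
  "cyl_point (y, s) $ 1 = y $ 1" "cyl_point (y, s) $ 2 = y $ 2" "cyl_point (y, s) $ 3 = s"
  by (simp_all add: cyl_point_def)

lemma proj12_nth [simp]: "proj12 x $ 1 = x $ 1" "proj12 x $ 2 = x $ 2"
  by (simp_all add: proj12_def)

lemma proj12_cyl_point [simp]: "proj12 (cyl_point (y, s)) = y"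
  by (simp add: vec_eq_iff forall_2)

lemma continuous_on_cyl_point: "continuous_on A cyl_point"
proof -
  have "continuous_on A (\<lambda>x. \<chi> i. cyl_point x $ i)"
  proof (rule continuous_on_vec_lambda)
    fix i :: 3
    have "(\<lambda>x. cyl_point x $ 1) = (\<lambda>x. fst x $ 1)" "(\<lambda>x. cyl_point x $ 2) = (\<lambda>x. fst x $ 2)"
      "(\<lambda>x. cyl_point x $ 3) = snd"
      by (auto simp: cyl_point_def)
    then have "continuous_on A (\<lambda>x. cyl_point x $ 1)" "continuous_on A (\<lambda>x. cyl_point x $ 2)"
      "continuous_on A (\<lambda>x. cyl_point x $ 3)"
      by (simp_all only:) (intro continuous_intros)+
    then show "continuous_on A (\<lambda>x. cyl_point x $ i)"
      using exhaust_3[of i] by metis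
  qed
  then show ?thesis by simp
qed

lemma continuous_on_proj12: "continuous_on A proj12"
proof -
  have "continuous_on A (\<lambda>x. \<chi> i. proj12 x $ i)"
  proof (rule continuous_on_vec_lambda)
    fix i :: 2
    have "continuous_on A (\<lambda>x. proj12 x $ 1)" "continuous_on A (\<lambda>x. proj12 x $ 2)"
      unfolding proj12_nth by (intro continuous_intros)+
    then show "continuous_on A (\<lambda>x. proj12 x $ i)"
      using exhaust_2[of i] by metis
  qed
  then show ?thesis by simp
qed

lemma open_cyl: "open A \<Longrightarrow> open (cyl A)"
  using continuous_on_open_vimage[of UNIV proj12] continuous_on_proj12[of UNIV]
  by (simp add: cyl_def vimage_def)

lemma prod_Basis_cart: "(\<Prod>b\<in>(Basis :: (real^'n) set). x \<bullet> b) = (\<Prod>i\<in>UNIV. x $ i)"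
proof -
  have b: "(Basis :: (real^'n) set) = (\<lambda>i. axis i 1) ` UNIV"
    by (auto simp: Basis_vec_def)
  have "inj (\<lambda>i::'n. axis i (1::real))"
    by (auto simp: inj_on_def axis_eq_axis)
  from prod.reindex[OF this, of "\<lambda>b. x \<bullet> b"] show ?thesis
    unfolding b by (simp add: inner_axis)
qed

text \<open>Lebesgue measure is determined by its values on boxes, and the preimage of a box is the
  product of its planar and axial parts.\<close>

lemma lborel_cyl_point: "lborel = distr (lborel \<Otimes>\<^sub>M lborel) borel cyl_point"
proof (rule lborel_eqI)
  have m: "cyl_point \<in> borel_measurable (lborel \<Otimes>\<^sub>M lborel)"
    using borel_measurable_continuous_onI[OF continuous_on_cyl_point] by (simp add: lborel_prod)
  fix l u :: "real^3" assume "\<And>b. b \<in> Basis \<Longrightarrow> l \<bullet> b \<le> u \<bullet> b"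
  then have le: "l $ i \<le> u $ i" for i
    using inner_axis[of l i 1] inner_axis[of u i 1] by (metis axis_in_Basis_iff inner_real_def mult.right_neutral Basis_real_def insertI1)
  have le2: "proj12 l $ i \<le> proj12 u $ i" for i
    using exhaust_2[of i] le by (elim disjE) simp_all
  have "cyl_point -` box l u = box (proj12 l) (proj12 u) \<times> box (l $ 3) (u $ 3)"
    by (auto simp: mem_box_cart forall_3 forall_2)
  then have "emeasure (distr (lborel \<Otimes>\<^sub>M lborel) borel cyl_point) (box l u)
      = emeasure (lborel \<Otimes>\<^sub>M lborel) (box (proj12 l) (proj12 u) \<times> box (l $ 3) (u $ 3))"
    using m by (subst emeasure_distr) (auto simp: space_pair_measure)
  also have "\<dots> = emeasure lborel (box (proj12 l) (proj12 u)) * emeasure lborel (box (l $ 3) (u $ 3))"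
    by (rule lborel.emeasure_pair_measure_Times) auto
  also have "emeasure lborel (box (proj12 l) (proj12 u)) = ennreal (\<Prod>b\<in>Basis. (proj12 u - proj12 l) \<bullet> b)"
    by (rule emeasure_lborel_box) (use le2 in \<open>auto simp: Basis_vec_def inner_axis\<close>)
  also have "emeasure lborel (box (l $ 3) (u $ 3)) = ennreal (u $ 3 - l $ 3)"
    using emeasure_lborel_Ioo[OF le[of 3]] by (simp only: box_real)
  also have "ennreal (\<Prod>b\<in>Basis. (proj12 u - proj12 l) \<bullet> b) * \<dots> = ennreal (\<Prod>i\<in>UNIV. (u - l) $ i)"
  proof -
    have "(\<Prod>i\<in>UNIV. (u - l) $ i) = (\<Prod>i\<in>UNIV. (proj12 u - proj12 l) $ i) * (u $ 3 - l $ 3)"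
      unfolding UNIV_2 UNIV_3 by simp
    moreover have "0 \<le> (\<Prod>i\<in>UNIV. (proj12 u - proj12 l) $ i)"
      using le2 by (intro prod_nonneg) simp
    ultimately show ?thesis
      unfolding prod_Basis_cart using le[of 3] by (simp only: ennreal_mult diff_ge_0_iff_ge)
  qed
  also have "\<dots> = ennreal (\<Prod>b\<in>Basis. (u - l) \<bullet> b)"
    by (simp only: prod_Basis_cart)
  finally show "emeasure (distr (lborel \<Otimes>\<^sub>M lborel) borel cyl_point) (box l u) = ennreal (\<Prod>b\<in>Basis. (u - l) \<bullet> b)" .
qed simp

text \<open>Integrates a slicewise inequality over the axis by Fubini; phrased as a sign so that it
  is applied once, to the difference of the two sides.\<close>

lemma integral_cyl_nonneg:
  fixes F :: "real^3 \<Rightarrow> real"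
  assumes \<omega>: "open \<omega>" and F: "continuous_on UNIV F" "compact K" "\<And>x. x \<notin> K \<Longrightarrow> F x = 0"
    and slice: "\<And>s. 0 \<le> (LINT y|lebesgue_on \<omega>. F (cyl_point (y, s)))"
  shows "0 \<le> (LINT x|lebesgue_on (cyl \<omega>). F x)"
proof -
  have cb [measurable]: "cyl \<omega> \<in> sets borel" "\<omega> \<in> sets borel" using \<omega> open_cyl by auto
  have Fm [measurable]: "F \<in> borel_measurable borel" by (rule borel_measurable_continuous_onI[OF F(1)])
  have m: "cyl_point \<in> borel_measurable (lborel \<Otimes>\<^sub>M lborel)"
    using borel_measurable_continuous_onI[OF continuous_on_cyl_point] by (simp add: lborel_prod)
  define H where "H x = indicat_real (cyl \<omega>) x *\<^sub>R F x" for x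
  have Hm [measurable]: "H \<in> borel_measurable borel" unfolding H_def by measurable
  have "integrable lborel H"
    unfolding H_def using integrable_mult_indicator[OF _ integrable_continuous_compact_support[OF F], of "cyl \<omega>"] cb
    by simp
  then have "integrable (distr (lborel \<Otimes>\<^sub>M lborel) borel cyl_point) H"
    by (simp only: lborel_cyl_point[symmetric])
  then have int: "integrable (lborel \<Otimes>\<^sub>M lborel) (\<lambda>(y, s). H (cyl_point (y, s)))"
    unfolding integrable_distr_eq[OF m Hm] by (simp add: case_prod_unfold)
  have "(LINT x|lebesgue_on (cyl \<omega>). F x) = (LINT x|lborel. H x)"
    unfolding H_def by (rule integral_lebesgue_on_borel[OF cb(1) Fm])
  also have "\<dots> = (LINT z|(lborel \<Otimes>\<^sub>M lborel). H (cyl_point z))"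
    by (subst lborel_cyl_point) (rule integral_distr[OF m Hm])
  also have "\<dots> = (LINT s|lborel. LINT y|lborel. H (cyl_point (y, s)))"
    using lborel_pair.integral_snd[OF int] by (simp add: case_prod_unfold)
  finally have eq: "(LINT x|lebesgue_on (cyl \<omega>). F x) = (LINT s|lborel. LINT y|lborel. H (cyl_point (y, s)))" .
  have "(LINT y|lborel. H (cyl_point (y, s))) = (LINT y|lebesgue_on \<omega>. F (cyl_point (y, s)))" for s
  proof -
    have "continuous_on UNIV (\<lambda>y. F (cyl_point (y, s)))"
      by (rule continuous_on_compose2[OF F(1)], rule continuous_on_compose2[OF continuous_on_cyl_point])
        (auto intro!: continuous_intros)
    then have "(\<lambda>y. F (cyl_point (y, s))) \<in> borel_measurable borel"
      by (rule borel_measurable_continuous_onI)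
    then show ?thesis
      by (subst integral_lebesgue_on_borel) (auto simp: H_def cyl_def indicator_def)
  qed
  then show ?thesis unfolding eq using slice by (simp add: integral_nonneg)
qed

subsection \<open>The ground state inequality on a slice\<close>

lemma integrable_mult_bounded:
  fixes f g :: "'a \<Rightarrow> real"
  assumes "integrable M f" "g \<in> borel_measurable M" "\<And>x. norm (g x) \<le> C"
  shows "integrable M (\<lambda>x. g x * f x)"
proof (rule Bochner_Integration.integrable_bound)
  show "integrable M (\<lambda>x. C * norm (f x))" using assms(1) by simp
  have "C \<ge> 0" using assms(3) norm_ge_zero order_trans by blast
  then show "AE x in M. norm (g x * f x) \<le> norm (C * norm (f x))"
    using assms(3) by (intro AE_I2) (simp add: abs_mult mult_right_mono)
qed (use assms in measurable)

text \<open>Only the monotonicity of \<open>\<psi>\<close> along \<open>e\<close> is used, so the classical and the weak gradient of the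
  merely differentiable function \<open>\<psi>\<close> need not be identified.\<close>

lemma directional_monotone_weak:
  fixes \<psi> :: "real^'n \<Rightarrow> real" and e :: "real^'n"
  assumes \<omega>: "open \<omega>" "bounded \<omega>"
    and H: "H1 \<omega> (\<lambda>x. complex_of_real (\<psi> x))"
    and diff: "\<And>x. x \<in> \<omega> \<Longrightarrow> \<psi> differentiable (at x)"
    and mono: "\<And>x. x \<in> \<omega> \<Longrightarrow> 0 \<le> (\<Sum>i\<in>UNIV. e $ i * pd \<psi> i x)"
  shows "AE x in lebesgue_on \<omega>. 0 \<le> (\<Sum>i\<in>UNIV. e $ i * Re (wd \<omega> (\<lambda>x. complex_of_real (\<psi> x)) i x))"
proof (rule fundamental_lemma_nonneg[OF \<omega>(1)])
  let ?M = "lebesgue_on \<omega>" and ?\<psi> = "\<lambda>x. complex_of_real (\<psi> x)"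
  have sp: "sqint ?M (\<lambda>x. e $ i * Re (wd \<omega> ?\<psi> i x))" for i
    by (intro sqint_cmult sqint_Re H1_sqint_wd H)
  have "sqint ?M (\<lambda>x. \<Sum>i\<in>A. e $ i * Re (wd \<omega> ?\<psi> i x))" for A
    by (induction A rule: infinite_finite_induct) (auto intro: sqint_add sp)
  then show "sqint ?M (\<lambda>x. \<Sum>i\<in>UNIV. e $ i * Re (wd \<omega> ?\<psi> i x))" .
  have \<psi>s: "sqint ?M \<psi>" using sqint_Re[OF H1_sqint[OF H]] by simp
  have \<omega>b: "\<omega> \<in> sets borel" using \<omega> by simp
  fix \<phi> assume t: "test_fun \<omega> \<phi>" and \<phi>0: "\<And>x. 0 \<le> \<phi> x"
  note c\<phi> = test_fun_C1c[OF t]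
  have \<phi>s: "sqint ?M \<phi>" "sqint ?M (pd \<phi> i)" for i
    by (intro C1c_sqint C1c_sqint_pd c\<phi> \<omega>b)+
  have wp: "(LINT x|?M. Re (wd \<omega> ?\<psi> i x) * \<phi> x) = - (LINT x|?M. \<psi> x * pd \<phi> i x)" for i
  proof -
    have "(LINT x|?M. ?\<psi> x * complex_of_real (pd \<phi> i x)) = - (LINT x|?M. wd \<omega> ?\<psi> i x * complex_of_real (\<phi> x))"
      using H1_weak_partial_wd[OF H, of i] t unfolding weak_partial_def by blast
    from arg_cong[OF this, of Re] show ?thesis
      using integral_Re[OF sqint_mult_integrable[OF H1_sqint_wd[OF H, of i] test_fun_sqint(1)[OF t \<omega>(1)]]]
        integral_Re[OF sqint_mult_integrable[OF H1_sqint[OF H] test_fun_sqint(2)[OF t \<omega>(1)]], of i]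
      by simp
  qed
  \<comment> \<open>Extension by zero makes translations of \<psi> meaningful on the whole
    space.\<close>
  define W where "W x = indicat_real \<omega> x *\<^sub>R \<psi> x" for x
  have cont: "continuous_on \<omega> \<psi>"
    by (intro continuous_at_imp_continuous_on ballI differentiable_imp_continuous_within diff)
  have Wm [measurable]: "W \<in> borel_measurable borel"
    unfolding W_def by (rule borel_measurable_continuous_on_indicator[OF \<omega>b cont])
  have Wi: "integrable lborel W"
  proof -
    have fin: "finite_measure ?M"
      using bounded_set_imp_lmeasurable[OF \<omega>(2)] \<omega>(1) by (intro finite_measure_lebesgue_on) simp
    have "sqint ?M (\<lambda>x. 1::real)"
      unfolding sqint_def using finite_measure.integrable_const[OF fin] by simp
    from sqint_mult_integrable[OF this \<psi>s] have "integrable ?M \<psi>" by simp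
    then have "integrable ?M W"
      by (subst Bochner_Integration.integrable_cong[of ?M ?M W \<psi>]) (auto simp: W_def)
    then have "integrable lborel (\<lambda>x. indicat_real \<omega> x *\<^sub>R W x)"
      by (subst (asm) integrable_lebesgue_on_borel[OF \<omega>b Wm])
    moreover have "(\<lambda>x. indicat_real \<omega> x *\<^sub>R W x) = W" by (auto simp: W_def indicator_def)
    ultimately show ?thesis by simp
  qed
  \<comment> \<open>Translating \<phi> by -h e amounts under the integral to translating W by +h e,
    so the direction -e produces W (x + h e) - W x. It also cancels the minus sign in the definition
    of the weak derivative.\<close>
  have lim: "(\<lambda>n. LINT x|lborel. W x *\<^sub>R (real (Suc n) *\<^sub>R (\<phi> (x + rcp n *\<^sub>R (- e)) - \<phi> x)))
     \<longlonglongrightarrow> (LINT x|lborel. W x *\<^sub>R (\<Sum>i\<in>UNIV. (- e) $ i *\<^sub>R pd \<phi> i x))"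
  proof (rule tendsto_integral_difference_quotient[OF c\<phi> Wm])
    show "integrable lborel (\<lambda>x. indicat_real (cball 0 R) x * W x)" for R
      using integrable_mult_indicator[OF _ Wi, of "cball 0 R"] by simp
  qed
  define K where "K = supp_closure \<phi>"
  have K: "compact K" "K \<subseteq> \<omega>" using t by (auto simp: test_fun_def K_def)
  have \<phi>z: "\<phi> x = 0" if "x \<notin> K" for x using that unfolding K_def by (rule supp_closure_zero)
  \<comment> \<open>As long as h |e| \<le> \<delta>, the segment from a point of K to its translate
    stays in \<open>\<omega>\<close>, where \<psi> is differentiable and the sign condition
    holds.\<close>
  obtain \<delta> where \<delta>: "\<delta> > 0" "(\<Union>x\<in>K. cball x \<delta>) \<subseteq> \<omega>"
    using compact_subset_open_imp_cball_epsilon_subset[OF K(1) \<omega>(1) K(2)] by blast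
  obtain C where C: "\<And>x. norm (\<phi> x) \<le> C" using C1c_bounded[OF c\<phi>] by metis
  have \<phi>m [measurable]: "\<phi> \<in> borel_measurable borel" by (rule C1fun_measurable[OF C1c_C1fun[OF c\<phi>]])
  have W\<phi>: "integrable lborel (\<lambda>x. \<phi> (x + a) * W x)" for a
    by (rule integrable_mult_bounded[OF Wi]) (use C in auto)
  have ev: "0 \<le> (LINT x|lborel. W x *\<^sub>R (real (Suc n) *\<^sub>R (\<phi> (x + rcp n *\<^sub>R (- e)) - \<phi> x)))"
    if n: "rcp n * norm e \<le> \<delta>" for n
  proof -
    define h where "h = rcp n"
    have h: "h > 0" "h * norm e \<le> \<delta>" using n by (auto simp: h_def)
    have i2: "integrable lborel (\<lambda>x. W (h *\<^sub>R e + x) * \<phi> x)"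
      using lborel_integrable_translate[OF _ W\<phi>[of "- (h *\<^sub>R e)"], of "h *\<^sub>R e"] by (simp add: mult.commute)
    have "(LINT x|lborel. W x *\<^sub>R (real (Suc n) *\<^sub>R (\<phi> (x + h *\<^sub>R (- e)) - \<phi> x)))
        = real (Suc n) * ((LINT x|lborel. \<phi> (x + - (h *\<^sub>R e)) * W x) - (LINT x|lborel. \<phi> (x + 0) * W x))"
      unfolding Bochner_Integration.integral_diff[OF W\<phi> W\<phi>, symmetric] integral_mult_right_zero[symmetric]
      by (intro Lint_cong) (auto simp: algebra_simps)
    also have "(LINT x|lborel. \<phi> (x + - (h *\<^sub>R e)) * W x) = (LINT x|lborel. W (h *\<^sub>R e + x) * \<phi> x)"
      using lborel_integral_translate[of "\<lambda>x. \<phi> (x + - (h *\<^sub>R e)) * W x" "h *\<^sub>R e"] by (simp add: mult.commute)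
    also have "\<dots> - (LINT x|lborel. \<phi> (x + 0) * W x) = (LINT x|lborel. (W (h *\<^sub>R e + x) - W x) * \<phi> x)"
    proof -
      have "integrable lborel (\<lambda>x. W x * \<phi> x)" using W\<phi>[of 0] by (simp add: mult.commute)
      from Bochner_Integration.integral_diff[OF i2 this] show ?thesis
        by (simp add: left_diff_distrib mult.commute[of "\<phi> _"])
    qed
    also have "real (Suc n) * \<dots> \<ge> 0"
    proof (rule mult_nonneg_nonneg, simp, rule integral_nonneg_AE, rule AE_I2)
      fix x
      show "0 \<le> (W (h *\<^sub>R e + x) - W x) * \<phi> x"
      proof (cases "x \<in> K")
        case True
        have seg: "x + t *\<^sub>R e \<in> \<omega>" if "0 \<le> t" "t \<le> h" for t
        proof -
          have "norm (t *\<^sub>R e) \<le> h * norm e" using that by (simp add: mult_right_mono)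
          then have "x + t *\<^sub>R e \<in> cball x \<delta>" using h by (simp add: dist_norm)
          then show ?thesis using \<delta>(2) True by blast
        qed
        \<comment> \<open>One-dimensional monotonicity along the segment: the derivative in t is the
          directional derivative of \<psi> along e, nonnegative by assumption.\<close>
        have "\<psi> (x + 0 *\<^sub>R e) \<le> \<psi> (x + h *\<^sub>R e)"
        proof (rule DERIV_nonneg_imp_nondecreasing[where f = "\<lambda>t. \<psi> (x + t *\<^sub>R e)"])
          show "0 \<le> h" using h by simp
          fix t assume t: "0 \<le> t" "t \<le> h"
          let ?y = "x + t *\<^sub>R e"
          have "((\<lambda>t. \<psi> (x + t *\<^sub>R e)) has_derivative (\<lambda>r. \<Sum>i\<in>UNIV. (r *\<^sub>R e) $ i *\<^sub>R pd \<psi> i ?y)) (at t)"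
          proof -
            have d: "((\<lambda>t. x + t *\<^sub>R e) has_derivative (\<lambda>r. r *\<^sub>R e)) (at t)"
              by (auto intro!: derivative_eq_intros)
            show ?thesis
              by (rule has_derivative_compose[OF d differentiable_has_derivative_pd[OF diff[OF seg[OF t]]]])
          qed
          then have "((\<lambda>t. \<psi> (x + t *\<^sub>R e)) has_real_derivative (\<Sum>i\<in>UNIV. e $ i * pd \<psi> i ?y)) (at t)"
            by (rule has_derivative_imp_has_field_derivative) (simp add: sum_distrib_left mult_ac)
          then show "\<exists>y. ((\<lambda>t. \<psi> (x + t *\<^sub>R e)) has_real_derivative y) (at t) \<and> 0 \<le> y"
            using mono[OF seg[OF t]] by blast
        qed
        moreover have "x \<in> \<omega>" "x + h *\<^sub>R e \<in> \<omega>" using seg[of 0] seg[of h] h by auto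
        ultimately have "W x \<le> W (h *\<^sub>R e + x)" by (simp add: W_def add.commute)
        then show ?thesis using \<phi>0 by simp
      qed (simp add: \<phi>z)
    qed
    finally show ?thesis by (simp only: h_def)
  qed
  have "eventually (\<lambda>n. rcp n * norm e < \<delta>) sequentially"
    using order_tendstoD(2)[OF tendsto_mult_left_zero[OF LIMSEQ_inverse_real_of_nat] \<delta>(1)] by simp
  then obtain N where N: "\<And>n. n \<ge> N \<Longrightarrow> rcp n * norm e < \<delta>"
    unfolding eventually_sequentially by blast
  have "0 \<le> (LINT x|lborel. W x *\<^sub>R (\<Sum>i\<in>UNIV. (- e) $ i *\<^sub>R pd \<phi> i x))"
  proof (rule LIMSEQ_le_const[OF lim], intro exI allI impI)
    fix n assume "N \<le> n"
    then show "0 \<le> (LINT x|lborel. W x *\<^sub>R (real (Suc n) *\<^sub>R (\<phi> (x + rcp n *\<^sub>R (- e)) - \<phi> x)))"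
      by (intro ev N[THEN less_imp_le])
  qed
  also have "\<dots> = (LINT x|?M. (\<Sum>i\<in>UNIV. (- e) $ i * (\<psi> x * pd \<phi> i x)))"
  proof -
    have pm: "(\<lambda>x. W x *\<^sub>R (\<Sum>i\<in>UNIV. (- e) $ i *\<^sub>R pd \<phi> i x)) \<in> borel_measurable borel"
      using C1fun_measurable_pd[OF C1c_C1fun[OF c\<phi>]] by measurable
    have "(LINT x|?M. (\<Sum>i\<in>UNIV. (- e) $ i * (\<psi> x * pd \<phi> i x)))
       = (LINT x|?M. W x *\<^sub>R (\<Sum>i\<in>UNIV. (- e) $ i *\<^sub>R pd \<phi> i x))"
      by (rule Lint_cong) (auto simp: W_def sum_distrib_left mult_ac)
    also have "\<dots> = (LINT x|lborel. W x *\<^sub>R (\<Sum>i\<in>UNIV. (- e) $ i *\<^sub>R pd \<phi> i x))"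
      by (subst integral_lebesgue_on_borel[OF \<omega>b pm])
        (rule Lint_cong, auto simp: W_def indicator_def)
    finally show ?thesis by simp
  qed
  also have "\<dots> = (\<Sum>i\<in>UNIV. (- e) $ i * (LINT x|?M. \<psi> x * pd \<phi> i x))"
    using sqint_mult_integrable[OF \<psi>s \<phi>s(2)] by (subst Bochner_Integration.integral_sum) auto
  also have "\<dots> = (\<Sum>i\<in>UNIV. e $ i * (LINT x|?M. Re (wd \<omega> ?\<psi> i x) * \<phi> x))"
    by (simp add: wp)
  also have "\<dots> = (LINT x|?M. (\<Sum>i\<in>UNIV. e $ i * Re (wd \<omega> ?\<psi> i x)) * \<phi> x)"
    using sqint_mult_integrable[OF sqint_Re[OF H1_sqint_wd[OF H]] \<phi>s(1)]
    by (simp add: sum_distrib_right mult.assoc)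
  finally show "0 \<le> (LINT x|?M. (\<Sum>i\<in>UNIV. e $ i * Re (wd \<omega> ?\<psi> i x)) * \<phi> x)" .
qed

text \<open>A bounded \<open>C\<^sup>1\<close> extension of \<open>1 / (\<epsilon> + s)\<close> from \<open>s \<ge> 0\<close> to the whole line, with bounded
  derivative: the smooth approximants of the ground state may take negative values.\<close>

definition recip :: "real \<Rightarrow> real \<Rightarrow> real" where
  "recip \<epsilon> s = (1 - s / (\<epsilon> + \<bar>s\<bar>)) / \<epsilon>"

definition recip' :: "real \<Rightarrow> real \<Rightarrow> real" where
  "recip' \<epsilon> s = - 1 / (\<epsilon> + \<bar>s\<bar>)\<^sup>2"

lemma recip_nonneg_arg: "\<epsilon> > 0 \<Longrightarrow> s \<ge> 0 \<Longrightarrow> recip \<epsilon> s = 1 / (\<epsilon> + s)"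
  by (simp add: recip_def diff_divide_distrib[symmetric] divide_simps)

text \<open>For s < 0 the function is 2/\<epsilon> - 1/(\<epsilon> - s), the point reflection of the
  positive branch about (0, 1/\<epsilon>). Hence the slope is even in s and the branches fit
  together in C^1 fashion at 0.\<close>

lemma DERIV_recip:
  assumes "\<epsilon> > 0" shows "(recip \<epsilon> has_real_derivative recip' \<epsilon> s) (at s)"
proof (cases s "0::real" rule: linorder_cases)
  case greater
  have "((\<lambda>s. 1 / (\<epsilon> + s)) has_real_derivative recip' \<epsilon> s) (at s)"
    using assms greater by (auto intro!: derivative_eq_intros simp: recip'_def power2_eq_square)
  then show ?thesis
    by (rule has_field_derivative_transform_within_open[where S="{0<..}"])
      (use assms greater in \<open>auto simp: recip_nonneg_arg\<close>)
next
  case less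
  have "((\<lambda>s. 2 / \<epsilon> - 1 / (\<epsilon> - s)) has_real_derivative recip' \<epsilon> s) (at s)"
    using assms less by (auto intro!: derivative_eq_intros simp: recip'_def power2_eq_square)
  then show ?thesis
  proof (rule has_field_derivative_transform_within_open[where S="{..<0}"])
    fix x :: real assume "x \<in> {..<0}"
    then have "\<epsilon> - x > 0" "x < 0" using assms by auto
    then show "2 / \<epsilon> - 1 / (\<epsilon> - x) = recip \<epsilon> x"
      using assms by (simp add: recip_def divide_simps) (simp add: algebra_simps)?
  qed (use less in auto)
next
  case equal
  have "((\<lambda>h. - 1 / (\<epsilon> * (\<epsilon> + \<bar>h\<bar>))) \<longlongrightarrow> - 1 / (\<epsilon> * (\<epsilon> + \<bar>0\<bar>))) (at (0::real))"
    using assms by (intro tendsto_intros) auto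
  moreover have "\<forall>\<^sub>F h in at 0. - 1 / (\<epsilon> * (\<epsilon> + \<bar>h\<bar>)) = (recip \<epsilon> (0 + h) - recip \<epsilon> 0) / h"
    unfolding eventually_at_filter
  proof (intro always_eventually allI impI)
    fix h :: real assume "h \<noteq> 0"
    moreover have "\<epsilon> + \<bar>h\<bar> \<noteq> 0" using assms by (simp add: add_pos_nonneg less_imp_neq[symmetric])
    ultimately show "- 1 / (\<epsilon> * (\<epsilon> + \<bar>h\<bar>)) = (recip \<epsilon> (0 + h) - recip \<epsilon> 0) / h"
      using assms by (simp add: recip_def diff_divide_distrib)
  qed
  ultimately have "((\<lambda>h. (recip \<epsilon> (0 + h) - recip \<epsilon> 0) / h) \<longlongrightarrow> - 1 / (\<epsilon> * (\<epsilon> + \<bar>0\<bar>))) (at 0)"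
    by (rule Lim_transform_eventually)
  then show ?thesis using equal by (simp add: DERIV_def recip'_def power2_eq_square)
qed

lemma continuous_on_recip': "\<epsilon> > 0 \<Longrightarrow> continuous_on A (recip' \<epsilon>)"
  unfolding recip'_def by (intro continuous_intros) (auto simp: add_pos_nonneg less_imp_neq[symmetric])

lemma continuous_on_recip: "\<epsilon> > 0 \<Longrightarrow> continuous_on A (recip \<epsilon>)"
  unfolding recip_def by (intro continuous_intros) (auto simp: add_pos_nonneg less_imp_neq[symmetric])

lemma recip_bound: assumes "\<epsilon> > 0" shows "\<bar>recip \<epsilon> s\<bar> \<le> 2 / \<epsilon>"
proof -
  have "\<bar>s / (\<epsilon> + \<bar>s\<bar>)\<bar> \<le> 1" using assms by (simp add: divide_le_eq)
  then have "\<bar>1 - s / (\<epsilon> + \<bar>s\<bar>)\<bar> \<le> 2" by linarith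
  then show ?thesis using assms by (simp add: recip_def divide_right_mono)
qed

lemma recip'_bound: assumes "\<epsilon> > 0" shows "\<bar>recip' \<epsilon> s\<bar> \<le> 1 / \<epsilon>\<^sup>2"
proof -
  have "\<epsilon>\<^sup>2 \<le> (\<epsilon> + \<bar>s\<bar>)\<^sup>2" using assms by (intro power_mono) auto
  then show ?thesis using assms by (simp add: recip'_def frac_le)
qed

lemma tendsto_integral_bounded_factor:
  fixes h :: "'a \<Rightarrow> real" and c :: "nat \<Rightarrow> 'a \<Rightarrow> real"
  assumes h: "integrable M h" and [measurable]: "\<And>n. c n \<in> borel_measurable M" "d \<in> borel_measurable M"
    and lim: "AE x in M. (\<lambda>n. c n x) \<longlonglongrightarrow> d x" and bd: "\<And>n. AE x in M. \<bar>c n x\<bar> \<le> C"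
  shows "(\<lambda>n. LINT x|M. h x * c n x) \<longlonglongrightarrow> (LINT x|M. h x * d x)"
proof (rule integral_dominated_convergence[where w = "\<lambda>x. norm (h x) * C"])
  have [measurable]: "h \<in> borel_measurable M" using h by (rule borel_measurable_integrable)
  show "(\<lambda>x. h x * d x) \<in> borel_measurable M" "(\<lambda>x. h x * c n x) \<in> borel_measurable M" for n
    by measurable
  show "integrable M (\<lambda>x. norm (h x) * C)" using h by simp
  show "AE x in M. (\<lambda>n. h x * c n x) \<longlonglongrightarrow> h x * d x"
    using lim by eventually_elim (intro tendsto_intros)
  show "AE x in M. norm (h x * c n x) \<le> norm (h x) * C" for n
    using bd[of n] by eventually_elim (simp add: abs_mult mult_left_mono)
qed

lemma C1c_real_H1_vanish:
  fixes h :: "real^'n \<Rightarrow> real"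
  assumes \<omega>: "open \<omega>" and h: "C1c h" and z: "near_zero \<gamma> h"
  shows "(\<lambda>x. complex_of_real (h x)) \<in> H1_vanish \<omega> \<gamma>"
    and "AE x in lebesgue_on \<omega>. wd \<omega> (\<lambda>x. complex_of_real (h x)) i x = complex_of_real (pd h i x)"
proof -
  have c: "C1c (\<lambda>x. complex_of_real (h x))" by (rule C1c_linear[OF bounded_linear_of_real h])
  have p: "pd (\<lambda>x. complex_of_real (h x)) i x = complex_of_real (pd h i x)" for x
    by (rule pd_linear[OF bounded_linear_of_real C1fun_differentiable[OF C1c_C1fun[OF h]]])
  show "(\<lambda>x. complex_of_real (h x)) \<in> H1_vanish \<omega> \<gamma>"
    by (rule C1c_H1_vanish[OF \<omega> c]) (use z in \<open>auto simp: near_zero_def\<close>)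
  show "AE x in lebesgue_on \<omega>. wd \<omega> (\<lambda>x. complex_of_real (h x)) i x = complex_of_real (pd h i x)"
    using wd_C1c[OF \<omega> c, of i] by (simp add: p)
qed

text \<open>The ground state enters the test function nonlinearly, so convergence in L^2 alone is
  not enough: pointwise convergence almost everywhere is extracted along a subsequence. Real parts
  keep the approximants in the domain of \<open>recip\<close>.\<close>

lemma H1_vanish_real_approximation:
  fixes \<psi> :: "real^'n \<Rightarrow> real"
  assumes \<omega>: "open \<omega>" and \<psi>: "(\<lambda>x. complex_of_real (\<psi> x)) \<in> H1_vanish \<omega> \<gamma>"
  obtains \<zeta> :: "nat \<Rightarrow> real^'n \<Rightarrow> real" where "\<forall>n. C1c (\<zeta> n)"
    and "AE x in lebesgue_on \<omega>. (\<lambda>n. \<zeta> n x) \<longlonglongrightarrow> \<psi> x"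
    and "\<forall>i. (\<lambda>n. nrm2 (lebesgue_on \<omega>) (\<lambda>x. pd (\<zeta> n) i x - Re (wd \<omega> (\<lambda>x. complex_of_real (\<psi> x)) i x))) \<longlonglongrightarrow> 0"
proof -
  let ?M = "lebesgue_on \<omega>" and ?\<psi> = "\<lambda>x. complex_of_real (\<psi> x)"
  have \<omega>b: "\<omega> \<in> sets borel" using \<omega> by simp
  note H = H1_vanish_H1[OF \<psi>]
  obtain q where q': "\<forall>n. C1c (q n) \<and> near_zero \<gamma> (q n)"
    and q0: "(\<lambda>n. nrm2 ?M (\<lambda>x. q n x - ?\<psi> x)) \<longlonglongrightarrow> 0"
    and q1: "\<forall>i. (\<lambda>n. nrm2 ?M (\<lambda>x. pd (q n) i x - wd \<omega> ?\<psi> i x)) \<longlonglongrightarrow> 0"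
    by (rule H1_vanish_approximation[OF \<omega> \<psi>])
  have q: "C1c (q n)" for n using q' by blast
  define \<zeta> where "\<zeta> n x = Re (q n x)" for n x
  have C\<zeta>: "C1c (\<zeta> n)" for n unfolding \<zeta>_def by (rule C1c_linear[OF bounded_linear_Re q])
  have pd\<zeta>: "pd (\<zeta> n) i x = Re (pd (q n) i x)" for n i x
    unfolding \<zeta>_def by (rule pd_linear[OF bounded_linear_Re C1fun_differentiable[OF C1c_C1fun[OF q]]])
  have re: "(\<lambda>n. nrm2 ?M (\<lambda>x. Re (a n x) - Re (b x))) \<longlonglongrightarrow> 0"
    if "(\<lambda>n. nrm2 ?M (\<lambda>x. a n x - b x)) \<longlonglongrightarrow> 0" "\<And>n. sqint ?M (a n)" "sqint ?M b" for a and b :: "real^'n \<Rightarrow> complex"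
  proof (rule Lim_null_comparison[OF always_eventually that(1)], rule allI)
    fix n
    have "nrm2 ?M (\<lambda>x. Re (a n x) - Re (b x)) \<le> nrm2 ?M (\<lambda>x. a n x - b x)"
      by (rule nrm2_mono[OF sqint_diff[OF that(2,3)] sqint_measurable[OF sqint_diff[OF sqint_Re[OF that(2)] sqint_Re[OF that(3)]]]])
        (use abs_Re_le_cmod[of "a n _ - b _"] in simp)
    then show "norm (nrm2 ?M (\<lambda>x. Re (a n x) - Re (b x))) \<le> nrm2 ?M (\<lambda>x. a n x - b x)" by simp
  qed
  have s\<zeta>: "sqint ?M (\<lambda>x. \<zeta> n x - \<psi> x)" for n
    using C1c_sqint[OF C\<zeta> \<omega>b] sqint_Re[OF H1_sqint[OF H]] by (intro sqint_diff) auto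
  have l1: "(\<lambda>n. nrm2 ?M (\<lambda>x. \<zeta> n x - \<psi> x)) \<longlonglongrightarrow> 0"
    using re[OF q0 C1c_sqint[OF q \<omega>b] H1_sqint[OF H]] by (simp add: \<zeta>_def)
  have l2: "(\<lambda>n. nrm2 ?M (\<lambda>x. pd (\<zeta> n) i x - Re (wd \<omega> ?\<psi> i x))) \<longlonglongrightarrow> 0" for i
    unfolding pd\<zeta> by (rule re[OF q1[rule_format] C1c_sqint_pd[OF q \<omega>b] H1_sqint_wd[OF H]])
  have "(\<lambda>n. LINT x|?M. norm ((norm (\<zeta> n x - \<psi> x))\<^sup>2)) \<longlonglongrightarrow> 0"
    using tendsto_power[OF l1, of 2] by (simp add: nrm2_sq)
  \<comment> \<open>Convergence in L^2 is convergence in L^1 of the squared differences, which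
    yields the subsequence.\<close>
  from tendsto_L1_AE_subseq[OF sqint_integrable[OF s\<zeta>] this]
  obtain r :: "nat \<Rightarrow> nat" where r: "strict_mono r" "AE x in ?M. (\<lambda>n. (norm (\<zeta> (r n) x - \<psi> x))\<^sup>2) \<longlonglongrightarrow> 0"
    by blast
  have "AE x in ?M. (\<lambda>n. \<zeta> (r n) x) \<longlonglongrightarrow> \<psi> x"
    using r(2)
  proof eventually_elim
    case (elim x)
    have "(\<lambda>n. \<bar>\<zeta> (r n) x - \<psi> x\<bar>) \<longlonglongrightarrow> 0"
      using tendsto_real_sqrt[OF elim] by simp
    then have "(\<lambda>n. \<zeta> (r n) x - \<psi> x) \<longlonglongrightarrow> 0" by (rule tendsto_rabs_zero_cancel)
    then show ?case by (rule Lim_null[THEN iffD2])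
  qed
  moreover have "(\<lambda>n. nrm2 ?M (\<lambda>x. pd (\<zeta> (r n)) i x - Re (wd \<omega> ?\<psi> i x))) \<longlonglongrightarrow> 0" for i
    using LIMSEQ_subseq_LIMSEQ[OF l2 r(1)] by (simp add: o_def)
  ultimately show ?thesis using C\<zeta> by (intro that[of "\<lambda>n. \<zeta> (r n)"]) auto
qed

text \<open>The weak equation tested with A times \<open>recip\<close> of \<psi>, which is not C^1
  when \<psi> is merely Sobolev. It is tested with A times \<open>recip\<close> of smooth
  approximants instead; A already vanishes near the Dirichlet part, so these are admissible whatever
  the approximants do there.\<close>

lemma ground_state_test_identity:
  fixes \<psi> A :: "real^'n \<Rightarrow> real"
  assumes \<omega>: "open \<omega>" and \<psi>: "(\<lambda>x. complex_of_real (\<psi> x)) \<in> H1_vanish \<omega> \<gamma>"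
    and weak: "\<And>v. v \<in> H1_vanish \<omega> \<gamma> \<Longrightarrow> formw (\<lambda>_ _. 1) \<omega> (\<lambda>x. complex_of_real (\<psi> x)) v
        = inner_w (\<lambda>_. 1) \<omega> (\<lambda>x. complex_of_real (lam * \<psi> x)) v"
    and A: "C1c A" "near_zero \<gamma> A" and \<epsilon>: "\<epsilon> > 0"
    and p_def: "\<And>i x. p i x = Re (wd \<omega> (\<lambda>x. complex_of_real (\<psi> x)) i x)"
  shows "(\<Sum>i\<in>UNIV. LINT x|lebesgue_on \<omega>. A x * recip' \<epsilon> (\<psi> x) * (p i x)\<^sup>2 + recip \<epsilon> (\<psi> x) * (p i x * pd A i x))
    = lam * (LINT x|lebesgue_on \<omega>. \<psi> x * A x * recip \<epsilon> (\<psi> x))"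
    and "integrable (lebesgue_on \<omega>) (\<lambda>x. A x * recip' \<epsilon> (\<psi> x) * (p i x)\<^sup>2 + recip \<epsilon> (\<psi> x) * (p i x * pd A i x))"
proof -
  let ?M = "lebesgue_on \<omega>" and ?\<psi> = "\<lambda>x. complex_of_real (\<psi> x)"
  let ?F = "recip \<epsilon>" and ?F' = "recip' \<epsilon>"
  have \<omega>b: "\<omega> \<in> sets borel" using \<omega> by simp
  note H = H1_vanish_H1[OF \<psi>]
  have sp: "sqint ?M (p i)" for i
    unfolding p_def[abs_def] by (intro sqint_Re H1_sqint_wd H)
  have s\<psi>: "sqint ?M \<psi>" using sqint_Re[OF H1_sqint[OF H]] by simp
  have pm [measurable]: "p i \<in> borel_measurable ?M" for i by (rule sqint_measurable[OF sp])
  have \<psi>m [measurable]: "\<psi> \<in> borel_measurable ?M" by (rule sqint_measurable[OF s\<psi>])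
  have sA: "sqint ?M A" "sqint ?M (pd A i)" for i
    by (intro C1c_sqint C1c_sqint_pd A \<omega>b)+
  have Am [measurable]: "A \<in> borel_measurable ?M" "pd A i \<in> borel_measurable ?M" for i
    by (rule sqint_measurable[OF sA(1)], rule sqint_measurable[OF sA(2)])
  have Fm [measurable]: "?F \<in> borel_measurable borel" "?F' \<in> borel_measurable borel"
    by (intro borel_measurable_continuous_onI continuous_on_recip continuous_on_recip' \<epsilon>)+
  obtain CA where CA: "CA \<ge> 0" "\<And>x. norm (A x) \<le> CA" using C1c_bounded[OF A(1)] by metis
  \<comment> \<open>For real smooth test functions the complex weak equation reduces to a real one,
    with the chosen derivative of h replaced by its classical derivative.\<close>
  have weak_real: "(\<Sum>i\<in>UNIV. LINT x|?M. p i x * pd h i x) = lam * (LINT x|?M. \<psi> x * h x)"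
    if h: "C1c h" "near_zero \<gamma> h" for h
  proof -
    note hv = C1c_real_H1_vanish[OF \<omega> h]
    have sh: "sqint ?M (\<lambda>x. complex_of_real (h x))" "sqint ?M (\<lambda>x. complex_of_real (pd h i x))" for i
      by (intro sqint_of_real C1c_sqint C1c_sqint_pd h \<omega>b)+
    have a: "(LINT x|?M. complex_of_real 1 * wd \<omega> ?\<psi> i x * cnj (wd \<omega> (\<lambda>x. complex_of_real (h x)) i x))
        = (LINT x|?M. wd \<omega> ?\<psi> i x * complex_of_real (pd h i x))" for i
    proof (rule integral_cong_AE)
      show "AE x in ?M. complex_of_real 1 * wd \<omega> ?\<psi> i x * cnj (wd \<omega> (\<lambda>x. complex_of_real (h x)) i x)
          = wd \<omega> ?\<psi> i x * complex_of_real (pd h i x)"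
        using hv(2)[of i] by eventually_elim simp
      show "(\<lambda>x. complex_of_real 1 * wd \<omega> ?\<psi> i x * cnj (wd \<omega> (\<lambda>x. complex_of_real (h x)) i x)) \<in> borel_measurable ?M"
        using sqint_mult_integrable[OF H1_sqint_wd[OF H] sqint_cnj[OF H1_sqint_wd[OF H1_vanish_H1[OF hv(1)]]], of i i]
        by (simp add: borel_measurable_integrable)
      show "(\<lambda>x. wd \<omega> ?\<psi> i x * complex_of_real (pd h i x)) \<in> borel_measurable ?M"
        by (rule borel_measurable_integrable[OF sqint_mult_integrable[OF H1_sqint_wd[OF H] sh(2)]])
    qed
    have "(\<Sum>i\<in>UNIV. LINT x|?M. wd \<omega> ?\<psi> i x * complex_of_real (pd h i x))
        = (LINT x|?M. complex_of_real (lam * (\<psi> x * h x)))"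
      using weak[OF hv(1)] unfolding formw_def inner_w_def a by (simp add: mult.assoc)
    also have "\<dots> = complex_of_real (lam * (LINT x|?M. \<psi> x * h x))"
      by (simp only: integral_complex_of_real integral_mult_right_zero)
    finally have "(\<Sum>i\<in>UNIV. LINT x|?M. wd \<omega> ?\<psi> i x * complex_of_real (pd h i x))
        = complex_of_real (lam * (LINT x|?M. \<psi> x * h x))" .
    from arg_cong[OF this, of Re] show ?thesis
      using integral_Re[OF sqint_mult_integrable[OF H1_sqint_wd[OF H] sh(2)]]
      by (simp add: p_def)
  qed
  obtain \<zeta> :: "nat \<Rightarrow> real^'n \<Rightarrow> real" where \<zeta>': "\<forall>n. C1c (\<zeta> n)"
    "AE x in ?M. (\<lambda>n. \<zeta> n x) \<longlonglongrightarrow> \<psi> x"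
    "\<forall>i. (\<lambda>n. nrm2 ?M (\<lambda>x. pd (\<zeta> n) i x - p i x)) \<longlonglongrightarrow> 0"
    by (rule H1_vanish_real_approximation[OF \<omega> \<psi>, folded p_def])
  note \<zeta> = \<zeta>'(1)[rule_format] \<zeta>'(2) \<zeta>'(3)[rule_format]
  have s\<zeta>: "sqint ?M (pd (\<zeta> n) i)" for n i by (intro C1c_sqint_pd \<zeta> \<omega>b)
  have \<zeta>m [measurable]: "\<zeta> n \<in> borel_measurable ?M" for n
    by (rule sqint_measurable[OF C1c_sqint[OF \<zeta>(1) \<omega>b]])
  have isF: "isCont ?F t" "isCont ?F' t" for t
    using continuous_on_recip[OF \<epsilon>, of UNIV] continuous_on_recip'[OF \<epsilon>, of UNIV]
    by (auto simp: continuous_on_eq_continuous_at)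
  have limF: "AE x in ?M. (\<lambda>n. ?F (\<zeta> n x)) \<longlonglongrightarrow> ?F (\<psi> x)" "AE x in ?M. (\<lambda>n. ?F' (\<zeta> n x)) \<longlonglongrightarrow> ?F' (\<psi> x)"
    by (rule eventually_mono[OF \<zeta>(2)], rule isCont_tendsto_compose, rule isF, assumption)+
  define h where "h n x = ?F (\<zeta> n x) * A x" for n x
  have C1F: "C1fun (\<lambda>x. ?F (\<zeta> n x))" for n
    by (rule C1fun_compose[OF C1c_C1fun[OF \<zeta>(1)] DERIV_recip[OF \<epsilon>] continuous_on_recip'[OF \<epsilon>]])
  have h: "C1c (h n)" "near_zero \<gamma> (h n)" for n
    unfolding h_def using A(2) by (auto simp: near_zero_def intro!: C1c_mult_left A(1) C1F)
  have pdh: "pd (h n) i x = ?F (\<zeta> n x) * pd A i x + ?F' (\<zeta> n x) * pd (\<zeta> n) i x * A x" for n i x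
    unfolding h_def
    by (subst pd_mult[OF C1fun_differentiable[OF C1F] C1fun_differentiable[OF C1c_C1fun[OF A(1)]]])
      (simp add: pd_compose[OF C1fun_differentiable[OF C1c_C1fun[OF \<zeta>(1)]] DERIV_recip[OF \<epsilon>]])
  have AF': "(\<lambda>x. A x * ?F' (c x)) \<in> borel_measurable ?M" "AE x in ?M. norm (A x * ?F' (c x)) \<le> CA * (1 / \<epsilon>\<^sup>2)"
    if [measurable]: "c \<in> borel_measurable ?M" for c
    using CA recip'_bound[OF \<epsilon>] by (measurable, auto simp: abs_mult simp del: times_divide_eq_right intro!: mult_mono)
  have i1: "integrable ?M (\<lambda>x. p i x * pd A i x)" for i by (rule sqint_mult_integrable[OF sp sA(2)])
  have i2: "integrable ?M (\<lambda>x. (p i x)\<^sup>2)" for i using sqint_integrable[OF sp] by simp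
  have i3: "integrable ?M (\<lambda>x. \<psi> x * A x)" by (rule sqint_mult_integrable[OF s\<psi> sA(1)])
  have j1: "integrable ?M (\<lambda>x. ?F (c x) * (p i x * pd A i x))" if [measurable]: "c \<in> borel_measurable ?M" for c i
    by (rule integrable_mult_bounded[OF i1, where C="2/\<epsilon>"]) (use recip_bound[OF \<epsilon>] in auto)
  have sAp: "sqint ?M (\<lambda>x. A x * ?F' (c x) * p i x)" if "c \<in> borel_measurable ?M" for c i
    by (rule sqint_mult_bounded[OF sp AF'[OF that]])
  have l1: "(\<lambda>n. LINT x|?M. ?F (\<zeta> n x) * (p i x * pd A i x)) \<longlonglongrightarrow> (LINT x|?M. ?F (\<psi> x) * (p i x * pd A i x))" for i
    using tendsto_integral_bounded_factor[OF i1 _ _ limF(1), of "2/\<epsilon>" i] recip_bound[OF \<epsilon>]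
    by (simp add: mult.commute[of "?F _"])
  \<comment> \<open>Two factors vary with n. Writing the derivative of the approximant as
    \<open>p i\<close> plus an error separates them: dominated convergence with majorant a multiple
    of \<open>(p i x)^2\<close> handles the main part, and Cauchy-Schwarz the error.\<close>
  have l2: "(\<lambda>n. LINT x|?M. (A x * ?F' (\<zeta> n x) * p i x) * pd (\<zeta> n) i x) \<longlonglongrightarrow> (LINT x|?M. A x * ?F' (\<psi> x) * (p i x)\<^sup>2)" for i
  proof -
    have "(\<lambda>n. LINT x|?M. (p i x)\<^sup>2 * (A x * ?F' (\<zeta> n x))) \<longlonglongrightarrow> (LINT x|?M. (p i x)\<^sup>2 * (A x * ?F' (\<psi> x)))"
      using limF(2) by (intro tendsto_integral_bounded_factor[OF i2 AF'(1) AF'(1) _ AF'(2)[unfolded real_norm_def]] \<zeta>m \<psi>m)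
        (auto elim!: eventually_mono intro!: tendsto_intros)
    moreover have "(\<lambda>n. LINT x|?M. (A x * ?F' (\<zeta> n x) * p i x) * (pd (\<zeta> n) i x - p i x)) \<longlonglongrightarrow> 0"
    proof (rule Lim_null_comparison)
      have "norm (LINT x|?M. (A x * ?F' (\<zeta> n x) * p i x) * (pd (\<zeta> n) i x - p i x))
         \<le> CA * (1 / \<epsilon>\<^sup>2) * nrm2 ?M (p i) * nrm2 ?M (\<lambda>x. pd (\<zeta> n) i x - p i x)" for n
      proof (rule order_trans[OF norm_integral_mult_le[OF sAp[OF \<zeta>m] sqint_diff[OF s\<zeta> sp]]], rule mult_right_mono)
        show "nrm2 ?M (\<lambda>x. A x * ?F' (\<zeta> n x) * p i x) \<le> CA * (1 / \<epsilon>\<^sup>2) * nrm2 ?M (p i)"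
          by (rule nrm2_mult_bounded_le[OF sp AF'[OF \<zeta>m]]) (use CA in auto)
      qed simp
      then show "\<forall>\<^sub>F n in sequentially. norm (LINT x|?M. (A x * ?F' (\<zeta> n x) * p i x) * (pd (\<zeta> n) i x - p i x))
         \<le> CA * (1 / \<epsilon>\<^sup>2) * nrm2 ?M (p i) * nrm2 ?M (\<lambda>x. pd (\<zeta> n) i x - p i x)" by simp
      show "(\<lambda>n. CA * (1 / \<epsilon>\<^sup>2) * nrm2 ?M (p i) * nrm2 ?M (\<lambda>x. pd (\<zeta> n) i x - p i x)) \<longlonglongrightarrow> 0"
        by (rule tendsto_mult_right_zero[OF \<zeta>(3)])
    qed
    ultimately have "(\<lambda>n. (LINT x|?M. (p i x)\<^sup>2 * (A x * ?F' (\<zeta> n x)))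
        + (LINT x|?M. (A x * ?F' (\<zeta> n x) * p i x) * (pd (\<zeta> n) i x - p i x))) \<longlonglongrightarrow> (LINT x|?M. (p i x)\<^sup>2 * (A x * ?F' (\<psi> x))) + 0"
      by (rule tendsto_add)
    moreover have "(LINT x|?M. (p i x)\<^sup>2 * (A x * ?F' (\<zeta> n x)))
        + (LINT x|?M. (A x * ?F' (\<zeta> n x) * p i x) * (pd (\<zeta> n) i x - p i x))
        = (LINT x|?M. (A x * ?F' (\<zeta> n x) * p i x) * pd (\<zeta> n) i x)" for n
    proof -
      have eq: "(LINT x|?M. (p i x)\<^sup>2 * (A x * ?F' (\<zeta> n x))) = (LINT x|?M. (A x * ?F' (\<zeta> n x) * p i x) * p i x)"
        by (rule Lint_cong) (auto simp: power2_eq_square)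
      show ?thesis
        unfolding eq Bochner_Integration.integral_add[OF sqint_mult_integrable[OF sAp[OF \<zeta>m] sp]
            sqint_mult_integrable[OF sAp[OF \<zeta>m] sqint_diff[OF s\<zeta> sp]], symmetric]
        by (rule Lint_cong) (auto simp: algebra_simps)
    qed
    ultimately show ?thesis by (simp add: mult.commute[of "(p i _)\<^sup>2"])
  qed
  have l3: "(\<lambda>n. LINT x|?M. \<psi> x * h n x) \<longlonglongrightarrow> (LINT x|?M. \<psi> x * A x * ?F (\<psi> x))"
    using tendsto_integral_bounded_factor[OF i3 _ _ limF(1), of "2/\<epsilon>"] recip_bound[OF \<epsilon>]
    by (simp add: h_def mult_ac)
  have eqn: "(\<Sum>i\<in>UNIV. (LINT x|?M. (A x * ?F' (\<zeta> n x) * p i x) * pd (\<zeta> n) i x) + (LINT x|?M. ?F (\<zeta> n x) * (p i x * pd A i x)))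
      = lam * (LINT x|?M. \<psi> x * h n x)" for n
    unfolding weak_real[OF h, symmetric]
  proof (rule sum.cong[OF refl])
    fix i :: 'n
    show "(LINT x|?M. (A x * ?F' (\<zeta> n x) * p i x) * pd (\<zeta> n) i x) + (LINT x|?M. ?F (\<zeta> n x) * (p i x * pd A i x))
      = (LINT x|?M. p i x * pd (h n) i x)"
      unfolding Bochner_Integration.integral_add[OF sqint_mult_integrable[OF sAp[OF \<zeta>m] s\<zeta>] j1[OF \<zeta>m], symmetric] pdh
      by (rule Lint_cong) (auto simp: algebra_simps)
  qed
  have "(\<lambda>n. \<Sum>i\<in>UNIV. (LINT x|?M. (A x * ?F' (\<zeta> n x) * p i x) * pd (\<zeta> n) i x) + (LINT x|?M. ?F (\<zeta> n x) * (p i x * pd A i x)))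
     \<longlonglongrightarrow> (\<Sum>i\<in>UNIV. (LINT x|?M. A x * ?F' (\<psi> x) * (p i x)\<^sup>2) + (LINT x|?M. ?F (\<psi> x) * (p i x * pd A i x)))"
    by (intro tendsto_sum tendsto_add l1 l2)
  moreover have "(\<lambda>n. lam * (LINT x|?M. \<psi> x * h n x)) \<longlonglongrightarrow> lam * (LINT x|?M. \<psi> x * A x * ?F (\<psi> x))"
    by (intro tendsto_mult_left l3)
  ultimately have eq: "(\<Sum>i\<in>UNIV. (LINT x|?M. A x * ?F' (\<psi> x) * (p i x)\<^sup>2) + (LINT x|?M. ?F (\<psi> x) * (p i x * pd A i x)))
      = lam * (LINT x|?M. \<psi> x * A x * ?F (\<psi> x))"
    unfolding eqn by (rule LIMSEQ_unique)
  have i4: "integrable ?M (\<lambda>x. A x * ?F' (\<psi> x) * (p i x)\<^sup>2)" for i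
    using sqint_mult_integrable[OF sAp[OF \<psi>m] sp, of i i] by (simp add: power2_eq_square mult.assoc)
  show "integrable ?M (\<lambda>x. A x * ?F' (\<psi> x) * (p i x)\<^sup>2 + ?F (\<psi> x) * (p i x * pd A i x))" for i
    by (intro Bochner_Integration.integrable_add i4 j1 \<psi>m)
  show "(\<Sum>i\<in>UNIV. LINT x|?M. A x * ?F' (\<psi> x) * (p i x)\<^sup>2 + ?F (\<psi> x) * (p i x * pd A i x))
      = lam * (LINT x|?M. \<psi> x * A x * ?F (\<psi> x))"
    using eq by (simp add: Bochner_Integration.integral_add[OF i4 j1[OF \<psi>m]])
qed

text \<open>A weighted Picone inequality. With A = G \<phi>^2 the only extra term beyond the usual
  square comes from the gradient of G, and \<open>sign\<close> makes it nonpositive.\<close>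

lemma ground_state_inequality:
  fixes \<psi> G \<phi> :: "real^'n \<Rightarrow> real"
  assumes \<omega>: "open \<omega>" and \<psi>: "(\<lambda>x. complex_of_real (\<psi> x)) \<in> H1_vanish \<omega> \<gamma>"
    and weak: "\<And>v. v \<in> H1_vanish \<omega> \<gamma> \<Longrightarrow> formw (\<lambda>_ _. 1) \<omega> (\<lambda>x. complex_of_real (\<psi> x)) v
        = inner_w (\<lambda>_. 1) \<omega> (\<lambda>x. complex_of_real (lam * \<psi> x)) v"
    and pos: "\<And>x. x \<in> \<omega> \<Longrightarrow> \<psi> x > 0"
    and G: "C1fun G" "\<And>x. x \<in> \<omega> \<Longrightarrow> G x \<ge> 0"
    and sign: "AE x in lebesgue_on \<omega>. (\<Sum>i\<in>UNIV. pd G i x * Re (wd \<omega> (\<lambda>x. complex_of_real (\<psi> x)) i x)) \<le> 0"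
    and \<phi>: "C1c \<phi>" "near_zero \<gamma> \<phi>"
  shows "lam * (LINT x|lebesgue_on \<omega>. G x * (\<phi> x)\<^sup>2) \<le> (LINT x|lebesgue_on \<omega>. G x * (\<Sum>i\<in>UNIV. (pd \<phi> i x)\<^sup>2))"
proof -
  let ?M = "lebesgue_on \<omega>"
  have \<omega>b: "\<omega> \<in> sets borel" using \<omega> by simp
  define p where "p i x = Re (wd \<omega> (\<lambda>x. complex_of_real (\<psi> x)) i x)" for i x
  define A where "A x = (G x * \<phi> x) * \<phi> x" for x
  have C1G\<phi>: "C1fun (\<lambda>x. G x * \<phi> x)" by (rule C1fun_mult[OF G(1) C1c_C1fun[OF \<phi>(1)]])
  have A: "C1c A" unfolding A_def by (rule C1c_mult_left[OF \<phi>(1) C1G\<phi>])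
  have A0: "near_zero \<gamma> A" using \<phi>(2) by (auto simp: near_zero_def A_def)
  have pdA: "pd A i x = 2 * (G x * \<phi> x * pd \<phi> i x) + pd G i x * (\<phi> x)\<^sup>2" for i x
    unfolding A_def
    by (subst pd_mult[OF C1fun_differentiable[OF C1G\<phi>] C1fun_differentiable[OF C1c_C1fun[OF \<phi>(1)]]],
        subst pd_mult[OF C1fun_differentiable[OF G(1)] C1fun_differentiable[OF C1c_C1fun[OF \<phi>(1)]]])
      (simp add: algebra_simps power2_eq_square)
  have \<psi>s: "sqint ?M \<psi>" using sqint_Re[OF H1_sqint[OF H1_vanish_H1[OF \<psi>]]] by simp
  have \<psi>m [measurable]: "\<psi> \<in> borel_measurable ?M" by (rule sqint_measurable[OF \<psi>s])
  let ?R = "\<lambda>x. G x * (\<Sum>i\<in>UNIV. (pd \<phi> i x)\<^sup>2)"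
  have K: "compact (supp_closure \<phi>)" using \<phi>(1) by (simp add: C1c_def)
  have iR: "integrable ?M ?R"
  proof (rule integrable_lebesgue_on_continuous_compact_support[OF _ K _ \<omega>b])
    show "continuous_on UNIV ?R"
      by (intro continuous_intros C1fun_continuous[OF G(1)] C1fun_continuous_pd[OF C1c_C1fun[OF \<phi>(1)]])
  qed (simp add: pd_supp_closure_zero)
  have iA: "integrable ?M A"
  proof (rule integrable_lebesgue_on_continuous_compact_support[OF C1fun_continuous[OF C1c_C1fun[OF A]] _ _ \<omega>b])
    show "compact (supp_closure A)" using A by (simp add: C1c_def)
  qed (rule supp_closure_zero)
  have step: "lam * (LINT x|?M. A x * (\<psi> x * recip \<epsilon> (\<psi> x))) \<le> (LINT x|?M. ?R x)" if \<epsilon>: "\<epsilon> > 0" for \<epsilon>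
  proof -
    note id = ground_state_test_identity[OF \<omega> \<psi> weak A A0 \<epsilon> p_def]
    have "lam * (LINT x|?M. A x * (\<psi> x * recip \<epsilon> (\<psi> x))) = lam * (LINT x|?M. \<psi> x * A x * recip \<epsilon> (\<psi> x))"
      by (simp add: mult_ac)
    also have "\<dots> = (LINT x|?M. (\<Sum>i\<in>UNIV. A x * recip' \<epsilon> (\<psi> x) * (p i x)\<^sup>2 + recip \<epsilon> (\<psi> x) * (p i x * pd A i x)))"
      by (simp only: id(1) Bochner_Integration.integral_sum id(2))
    also have "\<dots> \<le> (LINT x|?M. ?R x)"
    proof (rule integral_mono_AE)
      show "integrable ?M (\<lambda>x. \<Sum>i\<in>UNIV. A x * recip' \<epsilon> (\<psi> x) * (p i x)\<^sup>2 + recip \<epsilon> (\<psi> x) * (p i x * pd A i x))"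
        by (rule Bochner_Integration.integrable_sum) (rule id(2))
      show "AE x in ?M. (\<Sum>i\<in>UNIV. A x * recip' \<epsilon> (\<psi> x) * (p i x)\<^sup>2 + recip \<epsilon> (\<psi> x) * (p i x * pd A i x)) \<le> ?R x"
        using sign AE_space
      proof eventually_elim
        case (elim x)
        then have x: "x \<in> \<omega>" by simp
        define r where "r = 1 / (\<epsilon> + \<psi> x)"
        have r: "recip \<epsilon> (\<psi> x) = r" "recip' \<epsilon> (\<psi> x) = - r\<^sup>2" "r \<ge> 0"
          using pos[OF x] \<epsilon> by (auto simp: r_def recip_nonneg_arg recip'_def power_one_over)
        \<comment> \<open>With r = 1 / (\<epsilon> + \<psi>), the terms 2 r \<phi> p_i d_i\<phi> -
          r^2 \<phi>^2 p_i^2 equal (d_i\<phi>)^2 - (d_i\<phi> - r \<phi> p_i)^2, and the remaining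
          part of d_i A is d_i G times \<phi>^2.\<close>
        have "(\<Sum>i\<in>UNIV. A x * recip' \<epsilon> (\<psi> x) * (p i x)\<^sup>2 + recip \<epsilon> (\<psi> x) * (p i x * pd A i x))
          = (\<Sum>i\<in>UNIV. G x * ((pd \<phi> i x)\<^sup>2 - (pd \<phi> i x - r * \<phi> x * p i x)\<^sup>2) + r * (\<phi> x)\<^sup>2 * (pd G i x * p i x))"
          unfolding r pdA by (intro sum.cong) (auto simp: A_def power2_eq_square algebra_simps)
        also have "\<dots> \<le> (\<Sum>i\<in>UNIV. G x * (pd \<phi> i x)\<^sup>2 + r * (\<phi> x)\<^sup>2 * (pd G i x * p i x))"
          using G(2)[OF x] by (intro sum_mono add_right_mono mult_left_mono) auto
        also have "\<dots> = ?R x + r * (\<phi> x)\<^sup>2 * (\<Sum>i\<in>UNIV. pd G i x * p i x)"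
          by (simp add: sum.distrib sum_distrib_left)
        also have "\<dots> \<le> ?R x"
          using elim(1) r(3) by (simp add: p_def mult_nonneg_nonpos)
        finally show ?case .
      qed
    qed (rule iR)
    finally show ?thesis .
  qed
  \<comment> \<open>On \<open>\<omega>\<close> the factor is \<psi> / (\<epsilon> + \<psi>).
    Positivity of \<psi> keeps it in [0, 1], so A dominates, and makes it tend to 1 at every
    point.\<close>
  have lim: "(\<lambda>n. LINT x|?M. A x * (\<psi> x * recip (rcp n) (\<psi> x))) \<longlonglongrightarrow> (LINT x|?M. A x * 1)"
  proof (rule tendsto_integral_bounded_factor[OF iA, where C=1])
    show "(\<lambda>x. \<psi> x * recip (rcp n) (\<psi> x)) \<in> borel_measurable ?M" for n
      unfolding recip_def by measurable
    show "AE x in ?M. (\<lambda>n. \<psi> x * recip (rcp n) (\<psi> x)) \<longlonglongrightarrow> 1"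
      using AE_space
    proof eventually_elim
      case (elim x)
      then have x: "\<psi> x > 0" using pos by simp
      have "(\<lambda>n. \<psi> x / (rcp n + \<psi> x)) \<longlonglongrightarrow> \<psi> x / (0 + \<psi> x)"
        using x by (intro tendsto_intros LIMSEQ_inverse_real_of_nat) auto
      then show ?case using x by (simp add: recip_nonneg_arg del: of_nat_Suc)
    qed
    show "AE x in ?M. \<bar>\<psi> x * recip (rcp n) (\<psi> x)\<bar> \<le> 1" for n
      using AE_space
    proof eventually_elim
      case (elim x)
      then have x: "\<psi> x > 0" using pos by simp
      define e where "e = rcp n"
      have e: "e > 0" by (simp add: e_def)
      show ?case unfolding e_def[symmetric] using x e by (simp add: recip_nonneg_arg)
    qed
  qed simp
  have "lam * (LINT x|?M. A x * 1) \<le> (LINT x|?M. ?R x)"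
    by (rule LIMSEQ_le_const2[OF tendsto_mult_left[OF lim]]) (intro exI[of _ 0] allI impI step, simp)
  then show ?thesis by (simp add: A_def power2_eq_square mult.assoc)
qed

section \<open>Restriction to cross-sections\<close>

lemma cyl_point_shift: "cyl_point (y, s) = cyl_point (y, 0) + s *\<^sub>R axis 3 1"
  by (simp add: vec_eq_iff forall_3 axis_def)

lemma linear_cyl_point: "bounded_linear (\<lambda>y. cyl_point (y, 0))"
  by (rule linear_conv_bounded_linear[THEN iffD1], rule linearI) (simp_all add: vec_eq_iff forall_3)

lemma has_derivative_cyl_point: "((\<lambda>y. cyl_point (y, s)) has_derivative (\<lambda>h. cyl_point (h, 0))) (at y)"
proof -
  have "((\<lambda>y. cyl_point (y, 0) + s *\<^sub>R axis 3 1) has_derivative (\<lambda>h. cyl_point (h, 0) + 0)) (at y)"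
    by (intro has_derivative_add bounded_linear_imp_has_derivative linear_cyl_point has_derivative_const)
  then show ?thesis by (simp add: cyl_point_shift[symmetric])
qed

definition slice :: "real \<Rightarrow> (real^3 \<Rightarrow> 'b) \<Rightarrow> real^2 \<Rightarrow> 'b" where
  "slice s f = (\<lambda>y. f (cyl_point (y, s)))"

lemma C1fun_slice:
  fixes f :: "real^3 \<Rightarrow> 'b::real_normed_vector"
  assumes f: "C1fun f"
  shows "C1fun (slice s f)" "pd (slice s f) 1 = slice s (pd f 1)" "pd (slice s f) 2 = slice s (pd f 2)"
proof -
  let ?D = "\<lambda>y h. \<Sum>i\<in>UNIV. cyl_point (h, 0) $ i *\<^sub>R pd f i (cyl_point (y, s))"
  have d: "(slice s f has_derivative ?D y) (at y)" for y
    unfolding slice_def by (rule has_derivative_compose[OF has_derivative_cyl_point C1fun_has_derivative[OF f]])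
  have D: "?D y (axis 1 1) = pd f 1 (cyl_point (y, s))" "?D y (axis 2 1) = pd f 2 (cyl_point (y, s))" for y
    by (simp_all add: sum_3 axis_def)
  show "pd (slice s f) 1 = slice s (pd f 1)" "pd (slice s f) 2 = slice s (pd f 2)"
    unfolding slice_def[of s "pd f _"] D[symmetric] by (rule ext, rule pd_eq[OF d])+
  have cs: "continuous_on UNIV (\<lambda>y. pd f i (cyl_point (y, s)))" for i
    by (rule continuous_on_compose2[OF C1fun_continuous_pd[OF f]], rule continuous_on_compose2[OF continuous_on_cyl_point])
      (auto intro!: continuous_intros)
  show "C1fun (slice s f)"
  proof (rule C1funI[OF d])
    fix i :: 2
    consider "i = 1" | "i = 2" using exhaust_2 by blast
    then show "continuous_on UNIV (\<lambda>y. ?D y (axis i 1))"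
      by cases (simp_all only: D cs)
  qed
qed

lemma C1c_slice:
  fixes f :: "real^3 \<Rightarrow> 'b::real_normed_vector"
  assumes f: "C1c f" shows "C1c (slice s f)"
proof (rule C1cI[OF C1fun_slice(1)[OF C1c_C1fun[OF f]]])
  show "compact (proj12 ` supp_closure f)"
    using f by (intro compact_continuous_image continuous_on_proj12) (simp add: C1c_def)
  fix y assume "y \<notin> proj12 ` supp_closure f"
  then have "cyl_point (y, s) \<notin> supp_closure f"
    using imageI[of "cyl_point (y, s)" "supp_closure f" proj12] by auto
  then show "slice s f y = 0" unfolding slice_def by (rule supp_closure_zero)
qed

lemma near_zero_slice:
  assumes "near_zero (cyl \<gamma>) f" shows "near_zero \<gamma> (slice s f)"
proof -
  obtain U where U: "open U" "cyl \<gamma> \<subseteq> U" "\<forall>x\<in>U. f x = 0" using assms by (auto simp: near_zero_def)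
  have "continuous_on UNIV (\<lambda>y. cyl_point (y, s))"
    by (rule continuous_on_compose2[OF continuous_on_cyl_point]) (auto intro!: continuous_intros)
  then have "open ((\<lambda>y. cyl_point (y, s)) -` U)"
    by (rule open_vimage[OF U(1)])
  moreover have "\<gamma> \<subseteq> (\<lambda>y. cyl_point (y, s)) -` U" using U(2) by (force simp: cyl_def)
  ultimately show ?thesis
    unfolding near_zero_def slice_def
    by (intro exI[of _ "(\<lambda>y. cyl_point (y, s)) -` U"]) (use U(3) in auto)
qed

text \<open>On the cross-section at height s the weight is an affine function G of x', so the planar
  inequality applies there; integration over s is left to Fubini. Only the two transverse
  derivatives occur, as slices know nothing of the axial one.\<close>

lemma transverse_energy_bound:
  fixes \<psi> :: "real^2 \<Rightarrow> real" and \<phi> :: "real^3 \<Rightarrow> complex"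
  assumes \<omega>: "open \<omega>" "bounded \<omega>"
    and \<psi>: "(\<lambda>x. complex_of_real (\<psi> x)) \<in> H1_vanish \<omega> \<gamma>"
    and weak: "\<And>v. v \<in> H1_vanish \<omega> \<gamma> \<Longrightarrow> formw (\<lambda>_ _. 1) \<omega> (\<lambda>x. complex_of_real (\<psi> x)) v
        = inner_w (\<lambda>_. 1) \<omega> (\<lambda>x. complex_of_real (lam * \<psi> x)) v"
    and pos: "\<And>x. x \<in> \<omega> \<Longrightarrow> \<psi> x > 0"
    and diff: "\<And>x. x \<in> \<omega> \<Longrightarrow> \<psi> differentiable (at x)"
    and hyp: "\<And>s x. x \<in> \<omega> \<Longrightarrow> \<kappa> s * (pd \<psi> 1 x * cos (\<beta> s) + pd \<psi> 2 x * sin (\<beta> s)) \<ge> 0"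
    and g0: "\<And>x. x \<in> cyl \<omega> \<Longrightarrow> gfun \<kappa> \<beta> x \<ge> 0" and gc: "continuous_on UNIV (gfun \<kappa> \<beta>)"
    and \<phi>: "C1c \<phi>" "near_zero (cyl \<gamma>) \<phi>"
  shows "lam * (LINT x|lebesgue_on (cyl \<omega>). gfun \<kappa> \<beta> x * (cmod (\<phi> x))\<^sup>2)
    \<le> (LINT x|lebesgue_on (cyl \<omega>). gfun \<kappa> \<beta> x * ((cmod (pd \<phi> 1 x))\<^sup>2 + (cmod (pd \<phi> 2 x))\<^sup>2))"
proof -
  let ?g = "gfun \<kappa> \<beta>" and ?K = "supp_closure \<phi>"
  have \<omega>b: "\<omega> \<in> sets borel" "cyl \<omega> \<in> sets borel" using \<omega> open_cyl by auto
  have K: "compact ?K" using \<phi>(1) by (simp add: C1c_def)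
  let ?P = "\<lambda>x. ?g x * ((cmod (pd \<phi> 1 x))\<^sup>2 + (cmod (pd \<phi> 2 x))\<^sup>2)" and ?Q = "\<lambda>x. ?g x * (cmod (\<phi> x))\<^sup>2"
  have cP: "continuous_on UNIV ?P"
    by (intro continuous_intros gc C1fun_continuous_pd[OF C1c_C1fun[OF \<phi>(1)]])
  have cQ: "continuous_on UNIV ?Q"
    by (intro continuous_intros gc C1fun_continuous[OF C1c_C1fun[OF \<phi>(1)]])
  have zP: "?P x = 0" "?Q x = 0" if "x \<notin> ?K" for x
    using that by (simp_all add: supp_closure_zero pd_supp_closure_zero)
  have "0 \<le> (LINT x|lebesgue_on (cyl \<omega>). ?P x - lam * ?Q x)"
  proof (rule integral_cyl_nonneg[OF \<omega>(1) _ K])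
    show "continuous_on UNIV (\<lambda>x. ?P x - lam * ?Q x)" by (intro continuous_intros cP cQ)
    show "?P x - lam * ?Q x = 0" if "x \<notin> ?K" for x
      unfolding zP[OF that] by simp
    fix s
    let ?M = "lebesgue_on \<omega>"
    define G where "G = (\<lambda>y::real^2. 1 - (y $ 1 * cos (\<beta> s) + y $ 2 * sin (\<beta> s)) * \<kappa> s)"
    have gG: "?g (cyl_point (y, s)) = G y" for y by (simp add: gfun_def G_def)
    have dG: "(G has_derivative (\<lambda>h. - ((h $ 1 * cos (\<beta> s) + h $ 2 * sin (\<beta> s)) * \<kappa> s))) (at y)" for y
      unfolding G_def
      by (auto intro!: derivative_eq_intros bounded_linear_imp_has_derivative[OF bounded_linear_vec_nth])
    have C1G: "C1fun G" by (rule C1funI[OF dG]) simp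
    have pdG: "pd G 1 y = - (cos (\<beta> s) * \<kappa> s)" "pd G 2 y = - (sin (\<beta> s) * \<kappa> s)" for y
      unfolding pd_eq[OF dG] by (simp_all add: axis_def)
    \<comment> \<open>Minus the gradient of G. The curvature is kept as a factor, so that
      nonnegativity of the derivative of \<psi> along e is exactly the sign condition, also where
      \<kappa> is zero.\<close>
    define e :: "real^2" where "e = vector [cos (\<beta> s) * \<kappa> s, sin (\<beta> s) * \<kappa> s]"
    have e: "e $ 1 = cos (\<beta> s) * \<kappa> s" "e $ 2 = sin (\<beta> s) * \<kappa> s" by (simp_all add: e_def)
    have "AE x in ?M. 0 \<le> (\<Sum>i\<in>UNIV. e $ i * Re (wd \<omega> (\<lambda>x. complex_of_real (\<psi> x)) i x))"
      by (rule directional_monotone_weak[OF \<omega> H1_vanish_H1[OF \<psi>] diff])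
        (use hyp[of _ s] in \<open>auto simp: sum_2 e algebra_simps\<close>)
    then have sign: "AE x in ?M. (\<Sum>i\<in>UNIV. pd G i x * Re (wd \<omega> (\<lambda>x. complex_of_real (\<psi> x)) i x)) \<le> 0"
      by eventually_elim (simp add: sum_2 e pdG)
    have G0: "G y \<ge> 0" if "y \<in> \<omega>" for y
      using g0[of "cyl_point (y, s)"] that by (simp add: cyl_def gG)
    define f where "f = slice s \<phi>"
    have f: "C1c f" unfolding f_def by (rule C1c_slice[OF \<phi>(1)])
    have pdf: "pd f 1 y = pd \<phi> 1 (cyl_point (y, s))" "pd f 2 y = pd \<phi> 2 (cyl_point (y, s))" for y
      unfolding f_def C1fun_slice[OF C1c_C1fun[OF \<phi>(1)]] by (simp_all add: slice_def)
    have fs: "f y = \<phi> (cyl_point (y, s))" for y by (simp add: f_def slice_def)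
    have fz: "near_zero \<gamma> f" unfolding f_def by (rule near_zero_slice[OF \<phi>(2)])
    \<comment> \<open>F stands for \<open>Re\<close> and \<open>Im\<close>: the planar inequality
      concerns real functions, and the two instances add up to squared moduli.\<close>
    have part: "lam * (LINT y|?M. G y * (F (f y))\<^sup>2) \<le> (LINT y|?M. G y * ((F (pd f 1 y))\<^sup>2 + (F (pd f 2 y))\<^sup>2))"
      and int: "integrable ?M (\<lambda>y. G y * (F (f y))\<^sup>2)" "integrable ?M (\<lambda>y. G y * ((F (pd f 1 y))\<^sup>2 + (F (pd f 2 y))\<^sup>2))"
      if F: "bounded_linear F" for F :: "complex \<Rightarrow> real"
    proof -
      have h: "C1c (\<lambda>y. F (f y))" by (rule C1c_linear[OF F f])
      have hz: "near_zero \<gamma> (\<lambda>y. F (f y))"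
        using fz linear_0[OF bounded_linear.linear[OF F]] unfolding near_zero_def by fastforce
      have p: "pd (\<lambda>y. F (f y)) i y = F (pd f i y)" for i y
        by (rule pd_linear[OF F C1fun_differentiable[OF C1c_C1fun[OF f]]])
      show "lam * (LINT y|?M. G y * (F (f y))\<^sup>2) \<le> (LINT y|?M. G y * ((F (pd f 1 y))\<^sup>2 + (F (pd f 2 y))\<^sup>2))"
        using ground_state_inequality[OF \<omega>(1) \<psi> weak pos C1G G0 sign h hz] by (simp add: sum_2 p)
      have Ks: "compact (supp_closure f)" using f by (simp add: C1c_def)
      show "integrable ?M (\<lambda>y. G y * (F (f y))\<^sup>2)" "integrable ?M (\<lambda>y. G y * ((F (pd f 1 y))\<^sup>2 + (F (pd f 2 y))\<^sup>2))"
        by (rule integrable_lebesgue_on_continuous_compact_support[OF _ Ks _ \<omega>b(1)],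
            intro continuous_intros bounded_linear.continuous_on[OF F] C1fun_continuous[OF C1G]
              C1fun_continuous[OF C1c_C1fun[OF f]] C1fun_continuous_pd[OF C1c_C1fun[OF f]],
            simp add: supp_closure_zero pd_supp_closure_zero linear_0[OF bounded_linear.linear[OF F]])+
    qed
    have "(LINT y|?M. ?P (cyl_point (y, s)) - lam * ?Q (cyl_point (y, s)))
      = (LINT y|?M. (G y * ((Re (pd f 1 y))\<^sup>2 + (Re (pd f 2 y))\<^sup>2) + G y * ((Im (pd f 1 y))\<^sup>2 + (Im (pd f 2 y))\<^sup>2))
         - lam * (G y * (Re (f y))\<^sup>2 + G y * (Im (f y))\<^sup>2))"
      by (rule Lint_cong)
        (auto simp: gG pdf fs cmod_power2 algebra_simps)
    also have "\<dots> = ((LINT y|?M. G y * ((Re (pd f 1 y))\<^sup>2 + (Re (pd f 2 y))\<^sup>2)) + (LINT y|?M. G y * ((Im (pd f 1 y))\<^sup>2 + (Im (pd f 2 y))\<^sup>2)))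
       - lam * ((LINT y|?M. G y * (Re (f y))\<^sup>2) + (LINT y|?M. G y * (Im (f y))\<^sup>2))"
      by (subst Bochner_Integration.integral_diff)
        (auto intro!: Bochner_Integration.integrable_add integrable_mult_right int bounded_linear_Re bounded_linear_Im
          simp: Bochner_Integration.integral_add[OF int(2)[OF bounded_linear_Re] int(2)[OF bounded_linear_Im]]
            Bochner_Integration.integral_add[OF int(1)[OF bounded_linear_Re] int(1)[OF bounded_linear_Im]])
    also have "\<dots> \<ge> 0"
      using part[OF bounded_linear_Re] part[OF bounded_linear_Im] by (simp add: distrib_left)
    finally show "0 \<le> (LINT y|?M. ?P (cyl_point (y, s)) - lam * ?Q (cyl_point (y, s)))" .
  qed
  moreover have "integrable (lebesgue_on (cyl \<omega>)) ?P"
    by (rule integrable_lebesgue_on_continuous_compact_support[OF cP K zP(1) \<omega>b(2)])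
  moreover have "integrable (lebesgue_on (cyl \<omega>)) ?Q"
    by (rule integrable_lebesgue_on_continuous_compact_support[OF cQ K zP(2) \<omega>b(2)])
  ultimately show ?thesis by simp
qed

section \<open>Bounds for g and the conclusion\<close>

lemma pw_C2_domain_open_bounded: "pw_C2_domain \<omega> \<Longrightarrow> open \<omega> \<and> bounded \<omega>"
  by (simp add: pw_C2_domain_def)

text \<open>The deviation of g from 1 is the curvature times the inner product of x' with a unit
  vector. The thinness condition makes the resulting bound smaller than 1, which keeps g uniformly
  away from zero.\<close>

lemma gfun_bounds:
  assumes "bounded \<omega>" "bdd_above (range \<kappa>)" "\<And>s. \<kappa> s \<ge> 0" "x \<in> cyl \<omega>"
  shows "\<bar>gfun \<kappa> \<beta> x - 1\<bar> \<le> (SUP x\<in>\<omega>. norm x) * (SUP s. \<kappa> s)"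
proof -
  let ?y = "proj12 x"
  have y: "?y \<in> \<omega>" using assms(4) by (simp add: cyl_def)
  have "bdd_above (norm ` \<omega>)" using assms(1) by (auto simp: bounded_iff bdd_above_def)
  then have R: "norm ?y \<le> (SUP x\<in>\<omega>. norm x)" by (rule cSUP_upper[OF y])
  have S: "\<kappa> (x $ 3) \<le> (SUP s. \<kappa> s)" by (rule cSUP_upper[OF UNIV_I assms(2)])
  define e :: "real^2" where "e = vector [cos (\<beta> (x $ 3)), sin (\<beta> (x $ 3))]"
  have "norm e = 1"
    by (simp add: e_def norm_eq_sqrt_inner inner_vec_def sum_2 power2_eq_square[symmetric])
  then have "\<bar>?y \<bullet> e\<bar> \<le> norm ?y" using Cauchy_Schwarz_ineq2[of ?y e] by simp
  moreover have "gfun \<kappa> \<beta> x - 1 = - ((?y \<bullet> e) * \<kappa> (x $ 3))"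
    by (simp add: gfun_def e_def inner_vec_def sum_2)
  ultimately have "\<bar>gfun \<kappa> \<beta> x - 1\<bar> \<le> norm ?y * \<kappa> (x $ 3)"
    using assms(3) by (simp add: abs_mult mult_right_mono)
  also have "\<dots> \<le> (SUP x\<in>\<omega>. norm x) * (SUP s. \<kappa> s)"
    using R S assms(3) by (intro mult_mono) (auto intro: order_trans[OF norm_ge_zero])
  finally show ?thesis .
qed

lemma continuous_gfun:
  assumes "continuous_on UNIV \<kappa>" "continuous_on UNIV \<beta>"
  shows "continuous_on UNIV (gfun \<kappa> \<beta>)"
proof -
  have "continuous_on UNIV (\<lambda>x::real^3. \<kappa> (x $ 3))" "continuous_on UNIV (\<lambda>x::real^3. \<beta> (x $ 3))"
    by (rule continuous_on_compose2[OF assms(1)] continuous_on_compose2[OF assms(2)];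
        auto intro!: continuous_intros)+
  then show ?thesis unfolding gfun_def by (intro continuous_intros)
qed

theorem theorem2:
  fixes \<omega> \<gamma>D :: "(real^2) set"
    and lambda1 :: real and \<psi>1 :: "real^2 \<Rightarrow> real"
    and l t n b :: "real \<Rightarrow> real^3"
    and \<kappa> \<tau> \<beta> :: "real \<Rightarrow> real"
  assumes dom: "pw_C2_domain \<omega>"
    and gD: "dirichlet_part \<omega> \<gamma>D"
    and lam1: "is_eigenvalue2 \<omega> \<gamma>D lambda1"
    and lam1_least: "\<forall>\<mu>. is_eigenvalue2 \<omega> \<gamma>D \<mu> \<longrightarrow> lambda1 \<le> \<mu>"
    and psi_eig: "(\<lambda>x. complex_of_real (\<psi>1 x), \<lambda>x. complex_of_real (lambda1 * \<psi>1 x)) \<in> graph2 \<omega> \<gamma>D"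
    and psi_pos: "\<forall>x\<in>\<omega>. \<psi>1 x > 0"
    and psi_norm: "(LINT x|lebesgue_on \<omega>. (\<psi>1 x)\<^sup>2) = 1"
    and psi_diff: "\<forall>x\<in>\<omega>. \<psi>1 differentiable (at x)"
    and l_C3: "\<exists>l2 l3. (\<forall>s. (l has_vector_derivative t s) (at s)) \<and>
                 (\<forall>s. (t has_vector_derivative l2 s) (at s)) \<and>
                 (\<forall>s. (l2 has_vector_derivative l3 s) (at s)) \<and> continuous_on UNIV l3"
    and arclength: "\<forall>s. norm (t s) = 1"
    and l_emb: "inj l \<and> (\<exists>l'. homeomorphism UNIV (range l) l l')"
    and kappa_def: "\<forall>s. \<kappa> s = norm (vector_derivative t (at s))"
    and frenet_t: "\<forall>s. (t has_vector_derivative (\<kappa> s *\<^sub>R n s)) (at s)"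
    and frenet_n: "\<forall>s. (n has_vector_derivative (- (\<kappa> s *\<^sub>R t s) + \<tau> s *\<^sub>R b s)) (at s)"
    and frenet_b: "\<forall>s. (b has_vector_derivative (- (\<tau> s *\<^sub>R n s))) (at s)"
    and frame_on: "\<forall>s. norm (n s) = 1 \<and> norm (b s) = 1 \<and> t s \<bullet> n s = 0 \<and> t s \<bullet> b s = 0
                     \<and> n s \<bullet> b s = 0 \<and> b s = cross3 (t s) (n s)"
    and beta: "\<forall>s. (\<beta> has_real_derivative \<tau> s) (at s)"
    and beta_C1: "continuous_on UNIV \<tau>"
    and kappa_bdd: "bdd_above (range \<kappa>)"
    and thin: "(SUP x\<in>\<omega>. norm x) * (SUP s. \<kappa> s) < 1"
    and no_selfint: "inj_on (tube_map l n b \<beta>) (cyl \<omega>)"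
    and hyp: "\<forall>x3. \<forall>x\<in>\<omega>. \<kappa> x3 * (pd \<psi>1 1 x * cos (\<beta> x3) + pd \<psi>1 2 x * sin (\<beta> x3)) \<ge> 0"
  shows "\<forall>z\<in>T_spectrum \<omega> \<gamma>D \<kappa> \<beta>. lambda1 \<le> Re z"
proof
  fix z assume z: "z \<in> T_spectrum \<omega> \<gamma>D \<kappa> \<beta>"
  let ?g = "gfun \<kappa> \<beta>" and ?q = "(SUP x\<in>\<omega>. norm x) * (SUP s. \<kappa> s)"
  define W :: "3 \<Rightarrow> real^3 \<Rightarrow> real" where "W = (\<lambda>i x. if i = 3 then 1 / ?g x else ?g x)"
  have \<omega>: "open \<omega>" "bounded \<omega>" using pw_C2_domain_open_bounded[OF dom] by auto
  have \<kappa>0: "\<kappa> s \<ge> 0" for s using kappa_def by simp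
  have "continuous_on UNIV \<kappa>"
  proof -
    obtain l2 l3 where l: "\<And>s. (t has_vector_derivative l2 s) (at s)" "\<And>s. (l2 has_vector_derivative l3 s) (at s)"
      using l_C3 by blast
    have "\<kappa> = (\<lambda>s. norm (l2 s))" using kappa_def vector_derivative_at[OF l(1)] by auto
    moreover have "continuous_on UNIV l2"
      using has_vector_derivative_continuous[OF l(2)] continuous_at_imp_continuous_on by blast
    ultimately show ?thesis by (simp add: continuous_on_norm)
  qed
  moreover have "continuous_on UNIV \<beta>"
    using beta DERIV_isCont by (intro continuous_at_imp_continuous_on) blast
  ultimately have gc: "continuous_on UNIV ?g" by (rule continuous_gfun)
  have gm [measurable]: "?g \<in> borel_measurable borel" by (rule borel_measurable_continuous_onI[OF gc])
  have gb: "1 - ?q \<le> ?g x" "?g x \<le> 2" if "x \<in> cyl \<omega>" for x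
    using gfun_bounds[OF \<omega>(2) kappa_bdd \<kappa>0 that, of \<beta>] thin by linarith+
  \<comment> \<open>One pair of bounds for both weights: g lies between 1 - q and 2, hence 1 / g
    between 1/2 and 1 / (1 - q), where q is the product of the suprema.\<close>
  define c C where "c = min (1 - ?q) (1 / 2)" and "C = max 2 (1 / (1 - ?q))"
  have c0: "1 - ?q > 0" using thin by simp
  have wb: "c \<le> ?g x \<and> ?g x \<le> C" "c \<le> 1 / ?g x \<and> 1 / ?g x \<le> C" if "x \<in> cyl \<omega>" for x
  proof -
    show "c \<le> ?g x \<and> ?g x \<le> C" using gb[OF that] by (auto simp: c_def C_def)
    have "1 / 2 \<le> 1 / ?g x" "1 / ?g x \<le> 1 / (1 - ?q)"
      using gb[OF that] c0 by (intro frac_le; simp)+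
    then show "c \<le> 1 / ?g x \<and> 1 / ?g x \<le> C" by (auto simp: c_def C_def)
  qed
  interpret weighted_form "cyl \<omega>" "cyl \<gamma>D" W ?g c C
  proof
    show "open (cyl \<omega>)" by (rule open_cyl[OF \<omega>(1)])
    show "c > 0" using c0 by (simp add: c_def)
    show "W i \<in> borel_measurable (lebesgue_on (cyl \<omega>))" for i
      unfolding W_def by (rule measurable_lebesgue_on_borel) measurable
    show "?g \<in> borel_measurable (lebesgue_on (cyl \<omega>))" by (rule measurable_lebesgue_on_borel[OF gm])
    show "c \<le> W i x \<and> W i x \<le> C" if "x \<in> cyl \<omega>" for i x using wb[OF that] by (simp add: W_def)
    show "c \<le> ?g x \<and> ?g x \<le> C" if "x \<in> cyl \<omega>" for x using wb(1)[OF that] .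
  qed
  have \<psi>: "(\<lambda>x. complex_of_real (\<psi>1 x)) \<in> H1_vanish \<omega> \<gamma>D"
    and weak: "\<And>v. v \<in> H1_vanish \<omega> \<gamma>D \<Longrightarrow> formw (\<lambda>_ _. 1) \<omega> (\<lambda>x. complex_of_real (\<psi>1 x)) v
        = inner_w (\<lambda>_. 1) \<omega> (\<lambda>x. complex_of_real (lambda1 * \<psi>1 x)) v"
    using psi_eig by (auto simp: graph2_def assoc_graph_def)
  have bound: "lambda1 * (norm_w ?g (cyl \<omega>) \<phi>)\<^sup>2 \<le> (\<Sum>i\<in>UNIV. (norm_w (W i) (cyl \<omega>) (pd \<phi> i))\<^sup>2)"
    if \<phi>: "C1c \<phi>" "near_zero (cyl \<gamma>D) \<phi>" for \<phi> :: "real^3 \<Rightarrow> complex"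
  proof -
    let ?M = "lebesgue_on (cyl \<omega>)"
    have sp: "sqint ?M (pd \<phi> i)" for i
      by (rule C1c_sqint_pd[OF \<phi>(1)]) (simp add: open_cyl[OF \<omega>(1)])
    have "lambda1 * (norm_w ?g (cyl \<omega>) \<phi>)\<^sup>2
        \<le> (LINT x|?M. ?g x * ((cmod (pd \<phi> 1 x))\<^sup>2 + (cmod (pd \<phi> 2 x))\<^sup>2))"
      unfolding norm_w_power2[OF weight_\<rho>]
    proof (rule transverse_energy_bound[OF \<omega> \<psi> weak _ _ _ _ gc \<phi>])
      show "0 \<le> ?g x" if "x \<in> cyl \<omega>" for x using gb(1)[OF that] c0 by linarith
    qed (use psi_pos psi_diff hyp in auto)
    also have "\<dots> = (norm_w ?g (cyl \<omega>) (pd \<phi> 1))\<^sup>2 + (norm_w ?g (cyl \<omega>) (pd \<phi> 2))\<^sup>2"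
      unfolding norm_w_power2[OF weight_\<rho>]
      using integrable_weight[OF weight_\<rho> sp[of 1]] integrable_weight[OF weight_\<rho> sp[of 2]]
      by (simp add: distrib_left)
    \<comment> \<open>The added third summand is the axial energy with weight 1 / g, a
      square.\<close>
    also have "\<dots> \<le> (\<Sum>i\<in>UNIV. (norm_w (W i) (cyl \<omega>) (pd \<phi> i))\<^sup>2)"
      by (simp add: sum_3 W_def)
    finally show ?thesis .
  qed
  show "lambda1 \<le> Re z"
  proof (rule spectrum_lower_bound[OF form_bound_by_density[OF bound]])
    show "z \<in> op_spectrum ?g (cyl \<omega>) (assoc_graph W ?g (cyl \<omega>) (H1_vanish (cyl \<omega>) (cyl \<gamma>D)))"
      using z by (simp add: T_spectrum_def T_graph_def W_def)
  qed
qed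

end
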